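(* Let $X, Y$ be $\mathbb{R}^d$-valued random vectors such that the pair $(X,Y)$ has a joint density on $\mathbb{R}^d\times\mathbb{R}^d$ which is log-supermodular. Then $$ e^{\frac{2}{d} h(X+Y)} \geq e^{\frac{2}{d} h(X|Y)} + e^{\frac{2}{d} h(Y|X)}. $$
   Context: For a random vector $W$ with density $f$, $h(W)=-\int f\log f$ is its (differential) entropy. For random vectors $U,V$ with a joint density, the conditional entropy is $h(U|V) := h(U,V)-h(V)$. A function $u:(\mathbb{R}^d)^n\to(0,\infty)$ is log-supermodular if $u(x)u(y)\le u(x\wedge y)\,u(x\vee y)$ for all $x,y\in(\mathbb{R}^d)^n$, where $x\wedge y$ and $x\vee y$ denote the coordinatewise minimum and maximum over all $nd$ real coordinates (here $n=2$). Standing assumptions: all random vectors have finite second moments, all densities $f$ involved are such that $f\log f$ is integrable (so all entropies are well defined and finite), and densities are smooth enough for the relevant derivatives to exist classically. *)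

theory Defs
  imports "HOL-Probability.Probability"
begin

definition vmin :: "real^'d \<Rightarrow> real^'d \<Rightarrow> real^'d" where
  "vmin x y = (\<chi> i. min (x $ i) (y $ i))"

definition vmax :: "real^'d \<Rightarrow> real^'d \<Rightarrow> real^'d" where
  "vmax x y = (\<chi> i. max (x $ i) (y $ i))"

definition log_supermodular :: "((real^'d) \<times> (real^'d) \<Rightarrow> real) \<Rightarrow> bool" where
  "log_supermodular u \<longleftrightarrow>
     (\<forall>z. 0 < u z) \<and>
     (\<forall>x1 x2 y1 y2. u (x1, x2) * u (y1, y2)
        \<le> u (vmin x1 y1, vmin x2 y2) * u (vmax x1 y1, vmax x2 y2))"

definition diff_entropy :: "('a::euclidean_space \<Rightarrow> real) \<Rightarrow> real" where
  "diff_entropy f = - (\<integral>x. f x * ln (f x) \<partial>lborel)"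

end

(*
A transport proof. Each pair (x_k, y_k) is mapped, conditionally on the previous pairs, to a pair
(a, b) of independent standard Gaussians: a depends on x_k alone, b on x_k and y_k. Along the
rotated direction sqrt theta * a + sqrt (1 - theta) * b the sum x_k + y_k is increasing, and
log-supermodularity makes y_k increase with a at fixed b, so that its derivative is at least
sqrt theta * dx/da + sqrt (1 - theta) * dy/db. Substitution and the weighted AM-GM inequality give,
for every test function r, a bound of exponential type for one pair. Such bounds multiply over k,
so no entropies of intermediate marginals are needed.
Writing f = P * Q, where P collects
the densities of x_k given the previous pairs and Q those of y_k given x_k and the previous pairs,
this bounds the expectation of P^(-theta) Q^(-(1 - theta)) f_S(X+Y) exp(const + mean-zero term) by 1.
Since moreover the expectations of P f_Y / f and Q f_X / f are at most 1, ln t <= t - 1 yields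
  h(X+Y) >= theta h(X|Y) + (1 - theta) h(Y|X) - d/2 (theta ln theta + (1 - theta) ln (1 - theta)),
and the optimal theta gives the claim.
*)

theory Submission
  imports Defs
begin

section \<open>Monotone substitution and differentiation\<close>

text \<open>The rotation is dictated by the exponents. Put l = sqrt theta, m = sqrt (1 - theta), t =
  l a + m b, u = l b - m a. The Gaussian weight then splits into the law of u, of total mass one,
  and a part that AM-GM bounds by the t-derivative of the sum. The leftover cross term l m a b has
  no pointwise bound, but a and b are independent and centred, so it vanishes once logarithms are
  integrated. Integrability of ln P and ln Q is not at hand; only ln f and the logarithms of the
  laws of X, Y and X + Y are integrable. Exponential bounds are multiplied instead, and ln P and ln
  Q cancel to ln f before any logarithm is integrated. The bounds with f_Y and f_X stand for
  "conditioning reduces entropy": formally, -E ln P is the sum of the entropies of x_k given the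
  previous pairs, which dominates h(X|Y), and similarly for Q. The densities are merely measurable,
  so derivatives of the transport maps enter only through lower bounds for difference quotients, and
  substitution is an inequality. Conditional densities exist at every point, not just almost
  everywhere, because log-supermodularity makes every section integrable.\<close>

lemma emeasure_le_lborelI:
  fixes M :: "real measure"
  assumes sets: "sets M = sets borel"
    and Icc: "\<And>c d. c \<le> d \<Longrightarrow> emeasure M {c..d} \<le> ennreal (d - c)"
    and B: "B \<in> sets borel"
  shows "emeasure M B \<le> emeasure lborel B"
proof -
  \<comment> \<open>Outer regularity of Lebesgue measure: a bounded Borel set is covered by
    countably many non-overlapping intervals of total length at most \<open>e\<close> above its
    measure, and on each of them \<open>M\<close> is controlled by the hypothesis.\<close>
  have bounded: "emeasure M S \<le> emeasure lborel S"
    if S: "S \<in> sets borel" and sub: "S \<subseteq> {a..b}" for S a b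
  proof (rule ennreal_le_epsilon)
    fix e :: real assume e: "0 < e"
    have lm: "S \<in> lmeasurable"
      by (rule lmeasurable_cbox[THEN fmeasurableI2, of S a b]) (use S sub in auto)
    obtain D where D: "countable D"
        "\<And>K. K \<in> D \<Longrightarrow> K \<subseteq> cbox a b \<and> K \<noteq> {} \<and> (\<exists>c d. K = cbox c d)"
        "pairwise (\<lambda>A B. interior A \<inter> interior B = {}) D"
        "S \<subseteq> \<Union>D" "\<Union>D \<in> lmeasurable" "measure lebesgue (\<Union>D) \<le> measure lebesgue S + e"
      using measurable_outer_intervals_bounded[OF lm _ e, of a b] sub by (metis box_real(2))
    have Kb: "K \<in> sets borel" if "K \<in> D" for K
      using D(2)[OF that] by auto
    have le1: "emeasure M (interior K) \<le> emeasure lborel (interior K)"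
      and bd: "K - interior K \<in> null_sets M" if K: "K \<in> D" for K
    proof -
      obtain c d where cd: "K = {c..d}" "c \<le> d"
        using D(2)[OF K] by force
      have "emeasure M (interior K) \<le> emeasure M K"
        by (rule emeasure_mono) (use Kb[OF K] sets interior_subset in auto)
      then show "emeasure M (interior K) \<le> emeasure lborel (interior K)"
        using Icc[OF cd(2)] cd by (simp add: interior_atLeastAtMost_real)
      have pt: "{x} \<in> null_sets M" for x
        using Icc[of x x] sets by (simp add: null_sets_def)
      have "K - interior K \<subseteq> {c, d}" using cd by (auto simp: interior_atLeastAtMost_real)
      then show "K - interior K \<in> null_sets M"
        using null_sets_subset[of "{c, d}" M "K - interior K"] null_sets.Un[OF pt[of c] pt[of d]] Kb[OF K] sets
        by (simp add: insert_commute)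
    qed
    have N: "(\<Union>K\<in>D. K - interior K) \<in> null_sets M"
      by (rule null_sets_UN') (use D(1) bd in auto)
    have O: "(\<Union>K\<in>D. interior K) \<in> sets borel"
      by (intro borel_open open_UN ballI open_interior)
    have disj: "disjoint_family_on interior D"
      using D(3) by (simp add: disjoint_family_on_def pairwise_def)
    have "emeasure M S \<le> emeasure M ((\<Union>K\<in>D. interior K) \<union> (\<Union>K\<in>D. K - interior K))"
    proof (rule emeasure_mono)
      show "S \<subseteq> (\<Union>K\<in>D. interior K) \<union> (\<Union>K\<in>D. K - interior K)"
        using D(4) by blast
      show "(\<Union>K\<in>D. interior K) \<union> (\<Union>K\<in>D. K - interior K) \<in> sets M"
      proof (rule sets.Un)
        show "(\<Union>K\<in>D. interior K) \<in> sets M"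
          using O sets by blast
        show "(\<Union>K\<in>D. K - interior K) \<in> sets M" using N by (rule null_setsD2)
      qed
    qed
    also have "\<dots> = emeasure M (\<Union>K\<in>D. interior K)"
      by (rule emeasure_Un_null_set[OF _ N]) (use O sets in blast)
    also have "\<dots> = (\<integral>\<^sup>+K. emeasure M (interior K) \<partial>count_space D)"
      by (rule emeasure_UN_countable[OF _ D(1) disj]) (use sets in \<open>blast intro: borel_open open_interior\<close>)
    also have "\<dots> \<le> (\<integral>\<^sup>+K. emeasure lborel (interior K) \<partial>count_space D)"
      by (rule nn_integral_mono) (use le1 in auto)
    also have "\<dots> = emeasure lborel (\<Union>K\<in>D. interior K)"
      by (rule emeasure_UN_countable[OF _ D(1) disj, symmetric]) simp
    also have "\<dots> = emeasure lebesgue (\<Union>K\<in>D. interior K)"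
      using O by simp
    also have "\<dots> \<le> emeasure lebesgue (\<Union>D)"
      by (rule emeasure_mono) (use D(5) interior_subset in \<open>blast intro: fmeasurableD\<close>)+
    also have "\<dots> \<le> ennreal (measure lebesgue S + e)"
      using D(5,6) by (metis emeasure_eq_measure2 ennreal_leI)
    also have "\<dots> = emeasure lebesgue S + e"
      using e by (simp add: ennreal_plus emeasure_eq_measure2[OF lm])
    finally show "emeasure M S \<le> emeasure lborel S + ennreal e" using S by simp
  qed
  let ?B = "\<lambda>n::nat. B \<inter> {- real n..real n}"
  have U: "(\<Union>n. ?B n) = B"
  proof -
    have "\<exists>n::nat. x \<in> {- real n..real n}" for x :: real
      using real_arch_simple[of "\<bar>x\<bar>"] by (force simp: abs_le_iff)
    then show ?thesis by blast
  qed
  have "emeasure M B = (SUP n. emeasure M (?B n))"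
    by (subst SUP_emeasure_incseq) (use B sets U in \<open>auto simp: incseq_def\<close>)
  also have "\<dots> \<le> (SUP n. emeasure lborel (?B n))"
    by (rule SUP_mono') (rule bounded[OF _ Int_lower2], use B in auto)
  also have "\<dots> = emeasure lborel B"
    by (subst SUP_emeasure_incseq) (use B U in \<open>auto simp: incseq_def\<close>)
  finally show ?thesis .
qed

lemma emeasure_lborel_le_diameter:
  fixes S :: "real set"
  assumes S: "S \<in> sets borel" and d: "\<And>x y. x \<in> S \<Longrightarrow> y \<in> S \<Longrightarrow> x \<le> y \<Longrightarrow> y - x \<le> d"
  shows "emeasure lborel S \<le> ennreal d"
proof (cases "S = {}")
  case False
  then obtain x0 where x0: "x0 \<in> S" by auto
  have bdd: "bdd_below S"
  proof (rule bdd_belowI)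
    fix y assume "y \<in> S" then show "min x0 (x0 - d) \<le> y"
      using d[of y x0] x0 by (cases "y \<le> x0") auto
  qed
  have 1: "y - d \<le> x" if "x \<in> S" "y \<in> S" for x y
    using d[of x y] d[of x x] that by (cases "x \<le> y") auto
  have "S \<subseteq> {Inf S..Inf S + d}"
  proof
    fix y assume y: "y \<in> S"
    have "y - d \<le> Inf S" using 1 y False by (intro cInf_greatest) auto
    then show "y \<in> {Inf S..Inf S + d}" using cInf_lower[OF y bdd] by auto
  qed
  then have "emeasure lborel S \<le> emeasure lborel {Inf S..Inf S + d}"
    by (intro emeasure_mono) auto
  also have "\<dots> = ennreal d" using d[OF x0 x0] by simp
  finally show ?thesis .
qed simp

text \<open>An increment is the length of the set of levels v with
  \<open>\<sigma> t < v \<le> \<sigma> (t + h)\<close>. After exchanging the integrals, the set of t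
  that straddle a fixed level has diameter at most \<open>h\<close>, and only levels in
  \<open>{c..d}\<close> occur.\<close>

lemma nn_integral_mono_increment_le:
  fixes \<sigma> :: "real \<Rightarrow> real"
  assumes mono: "mono \<sigma>" and bnd: "\<And>t. c \<le> \<sigma> t" "\<And>t. \<sigma> t \<le> d" and h: "0 < h"
  shows "(\<integral>\<^sup>+t. ennreal (\<sigma> (t + h) - \<sigma> t) \<partial>lborel) \<le> ennreal h * ennreal (d - c)"
proof -
  have [measurable]: "\<sigma> \<in> borel_measurable borel" by (rule borel_measurable_mono[OF mono])
  have cd: "c \<le> d" using bnd[of 0] by simp
  have inner: "emeasure lborel {t. \<sigma> t < v \<and> v \<le> \<sigma> (t + h)} \<le> ennreal h" for v
  proof (rule emeasure_lborel_le_diameter)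
    fix x y assume a: "x \<in> {t. \<sigma> t < v \<and> v \<le> \<sigma> (t + h)}" "y \<in> {t. \<sigma> t < v \<and> v \<le> \<sigma> (t + h)}"
    then have "\<sigma> y < \<sigma> (x + h)" by auto
    then have "y < x + h" using mono by (meson linorder_not_le monoD)
    then show "y - x \<le> h" by simp
  qed measurable
  have "(\<integral>\<^sup>+t. ennreal (\<sigma> (t + h) - \<sigma> t) \<partial>lborel)
      = (\<integral>\<^sup>+t. \<integral>\<^sup>+v. indicator {v. \<sigma> t < v \<and> v \<le> \<sigma> (t + h)} v * indicator {c..d} v \<partial>lborel \<partial>lborel)"
  proof (rule nn_integral_cong)
    fix t
    have "{\<sigma> t<..\<sigma> (t + h)} \<inter> {c..d} = {\<sigma> t<..\<sigma> (t + h)}" using bnd[of t] bnd[of "t+h"] by auto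
    moreover have "{v. \<sigma> t < v \<and> v \<le> \<sigma> (t + h)} = {\<sigma> t<..\<sigma> (t + h)}" by auto
    moreover have "\<sigma> t \<le> \<sigma> (t + h)" using mono h by (simp add: monoD)
    ultimately show "ennreal (\<sigma> (t + h) - \<sigma> t)
        = (\<integral>\<^sup>+v. indicator {v. \<sigma> t < v \<and> v \<le> \<sigma> (t + h)} v * indicator {c..d} v \<partial>lborel)"
      by (simp add: indicator_inter_arith[symmetric])
  qed
  also have "\<dots> = (\<integral>\<^sup>+v. \<integral>\<^sup>+t. indicator {v. \<sigma> t < v \<and> v \<le> \<sigma> (t + h)} v * indicator {c..d} v \<partial>lborel \<partial>lborel)"
    by (rule lborel_pair.Fubini'[symmetric]) measurable
  also have "\<dots> \<le> (\<integral>\<^sup>+v. ennreal h * indicator {c..d} v \<partial>lborel)"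
  proof (rule nn_integral_mono)
    fix v
    have "(\<integral>\<^sup>+t. indicator {v. \<sigma> t < v \<and> v \<le> \<sigma> (t + h)} v * indicator {c..d} v \<partial>lborel)
        = (\<integral>\<^sup>+t. indicator {t. \<sigma> t < v \<and> v \<le> \<sigma> (t + h)} t * indicator {c..d} v \<partial>lborel)"
      by (intro nn_integral_cong) (auto simp: indicator_def)
    also have "\<dots> = emeasure lborel {t. \<sigma> t < v \<and> v \<le> \<sigma> (t + h)} * indicator {c..d} v"
      by (subst nn_integral_multc) auto
    finally show "(\<integral>\<^sup>+t. indicator {v. \<sigma> t < v \<and> v \<le> \<sigma> (t + h)} v * indicator {c..d} v \<partial>lborel)
        \<le> ennreal h * indicator {c..d} v"
      using inner[of v] by (simp add: mult_right_mono)
  qed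
  also have "\<dots> = ennreal h * ennreal (d - c)"
    using cd by (simp add: nn_integral_cmult)
  finally show ?thesis .
qed

text \<open>A monotone \<open>s\<close> may jump and need not be absolutely continuous, so only its a.e. difference
  quotients are used; clipping \<open>s\<close> to \<open>[c, d]\<close> turns the bound into Fatou's lemma.\<close>

lemma nn_integral_mono_substitution_le:
  fixes s :: "real \<Rightarrow> real" and r :: "real \<Rightarrow> ennreal"
  assumes mono: "mono s" and [measurable]: "r \<in> borel_measurable borel"
  shows "(\<integral>\<^sup>+t. r (s t) * liminf (\<lambda>n. ennreal (real (Suc n) * (s (t + 1 / real (Suc n)) - s t))) \<partial>lborel)
          \<le> (\<integral>\<^sup>+x. r x \<partial>lborel)"
proof -
  have [measurable]: "s \<in> borel_measurable borel" by (rule borel_measurable_mono[OF mono])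
  define L where "L t = liminf (\<lambda>n. ennreal (real (Suc n) * (s (t + 1 / real (Suc n)) - s t)))" for t
  have [measurable]: "L \<in> borel_measurable borel" unfolding L_def by measurable
  \<comment> \<open>The claim is that the image under \<open>s\<close> of the measure with density
    \<open>L\<close> is dominated by Lebesgue measure; it suffices to test this on
    intervals.\<close>
  define m where "m = distr (density lborel L) borel s"
  have m_sets: "sets m = sets borel" by (simp add: m_def)
  have em: "emeasure m {c..d} \<le> ennreal (d - c)" if cd: "c \<le> d" for c d
  proof -
    define \<sigma> where "\<sigma> t = max c (min d (s t))" for t
    have ms: "mono \<sigma>" using mono by (auto simp: mono_def \<sigma>_def) (smt (verit, best))+
    have [measurable]: "\<sigma> \<in> borel_measurable borel" by (rule borel_measurable_mono[OF ms])
    \<comment> \<open>The only places in the preimage of \<open>{c..d}\<close> where clipping can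
      change arbitrarily short increments to the right: \<open>s\<close> leaves the interval
      immediately after t. Monotonicity allows at most one such point.\<close>
    define E where "E = {t. c \<le> s t \<and> s t \<le> d \<and> (\<forall>t'>t. d < s t')}"
    have E1: "t = t'" if "t \<in> E" "t' \<in> E" for t t'
      using that by (auto simp: E_def) (metis linorder_less_linear not_le)
    have E0: "E \<in> null_sets lborel"
    proof (cases "E = {}")
      case False
      then obtain t where "E = {t}" using E1 by blast
      then show ?thesis by (simp add: null_sets_def)
    qed simp
    have "emeasure m {c..d} = (\<integral>\<^sup>+t. L t * indicator {t. c \<le> s t \<and> s t \<le> d} t \<partial>lborel)"
      unfolding m_def
      by (subst emeasure_distr) (auto simp: emeasure_density vimage_def intro!: nn_integral_cong)
    also have "\<dots> \<le> (\<integral>\<^sup>+t. liminf (\<lambda>n. ennreal (real (Suc n) * (\<sigma> (t + 1 / real (Suc n)) - \<sigma> t))) \<partial>lborel)"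
    proof (rule nn_integral_mono_AE)
      show "AE t in lborel. L t * indicator {t. c \<le> s t \<and> s t \<le> d} t
        \<le> liminf (\<lambda>n. ennreal (real (Suc n) * (\<sigma> (t + 1 / real (Suc n)) - \<sigma> t)))"
        using AE_not_in[OF E0]
      proof eventually_elim
        case (elim t)
        show ?case
        proof (cases "c \<le> s t \<and> s t \<le> d")
          case True
          with elim obtain t' where t': "t < t'" "s t' \<le> d" by (auto simp: E_def not_less)
          have "eventually (\<lambda>n. 1 / real (Suc n) < t' - t) sequentially"
            using t' by (intro order_tendstoD[OF LIMSEQ_Suc[OF lim_1_over_n]]) auto
          then have ev: "eventually (\<lambda>n. \<sigma> (t + 1 / real (Suc n)) - \<sigma> t = s (t + 1 / real (Suc n)) - s t) sequentially"
          proof eventually_elim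
            case (elim n)
            have "s (t + 1 / real (Suc n)) \<le> s t'" "s t \<le> s (t + 1 / real (Suc n))"
              using elim by (intro monoD[OF mono]; simp)+
            then show ?case using True t' by (simp add: \<sigma>_def)
          qed
          have "L t = liminf (\<lambda>n. ennreal (real (Suc n) * (\<sigma> (t + 1 / real (Suc n)) - \<sigma> t)))"
            unfolding L_def by (rule Liminf_eq) (use ev in \<open>eventually_elim, simp\<close>)
          then show ?thesis by (simp add: indicator_def)
        qed simp
      qed
    qed
    also have "\<dots> \<le> liminf (\<lambda>n. (\<integral>\<^sup>+t. ennreal (real (Suc n) * (\<sigma> (t + 1 / real (Suc n)) - \<sigma> t)) \<partial>lborel))"
      by (rule nn_integral_liminf) measurable
    also have "\<dots> \<le> liminf (\<lambda>n::nat. ennreal (d - c))"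
    proof (rule Liminf_mono, rule always_eventually, rule allI)
      fix n
      have "(\<integral>\<^sup>+t. ennreal (real (Suc n) * (\<sigma> (t + 1 / real (Suc n)) - \<sigma> t)) \<partial>lborel)
          = ennreal (real (Suc n)) * (\<integral>\<^sup>+t. ennreal (\<sigma> (t + 1 / real (Suc n)) - \<sigma> t) \<partial>lborel)"
        by (subst nn_integral_cmult[symmetric]) (auto simp: ennreal_mult' simp del: of_nat_Suc)
      also have "\<dots> \<le> ennreal (real (Suc n)) * (ennreal (1 / real (Suc n)) * ennreal (d - c))"
        by (intro mult_left_mono nn_integral_mono_increment_le[OF ms]) (use cd in \<open>auto simp: \<sigma>_def\<close>)
      also have "\<dots> = ennreal (d - c)"
        using cd by (simp add: ennreal_mult[symmetric] del: of_nat_Suc)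
      finally show "(\<integral>\<^sup>+t. ennreal (real (Suc n) * (\<sigma> (t + 1 / real (Suc n)) - \<sigma> t)) \<partial>lborel) \<le> ennreal (d - c)" .
    qed
    also have "\<dots> = ennreal (d - c)" by (simp add: Liminf_const)
    finally show ?thesis .
  qed
  have "(\<integral>\<^sup>+t. r (s t) * L t \<partial>lborel) = (\<integral>\<^sup>+x. r x \<partial>m)"
    unfolding m_def by (simp add: nn_integral_distr nn_integral_density mult.commute)
  also have "\<dots> \<le> (\<integral>\<^sup>+x. r x \<partial>lborel)"
  proof (rule nn_integral_mono_measure)
    show "m \<le> lborel"
      by (subst le_measure) (simp_all add: m_sets le_fun_def emeasure_le_lborelI[OF m_sets em])
  qed (simp add: m_sets)
  finally show ?thesis unfolding L_def .
qed

text \<open>On the exceptional set \<open>v\<close> is at least \<tau>, yet arbitrarily short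
  intervals \<open>{a..a + h n}\<close> carry an integral of \<open>v\<close> below \<rho> times
  their length. Vitali's theorem selects disjoint such intervals that cover the set up to a null set
  inside an open set of nearly the same measure, so \<tau> times the measure is at most \<rho> times
  the measure, which forces it to be zero.\<close>

lemma lower_density_null_set:
  fixes v V :: "real \<Rightarrow> real" and h :: "nat \<Rightarrow> real"
  assumes [measurable]: "v \<in> borel_measurable borel" "V \<in> borel_measurable borel"
    and V: "\<And>a b. a \<le> b \<Longrightarrow> (\<integral>\<^sup>+t. ennreal (v t) * indicator {a<..b} t \<partial>lborel) = ennreal (V b - V a)"
    and h: "\<And>n. 0 < h n" "h \<longlonglongrightarrow> 0" and \<rho>: "0 \<le> \<rho>" "\<rho> < \<tau>"
  shows "{a \<in> {c..d}. \<tau> \<le> v a \<and> (\<exists>\<^sub>F n in sequentially. V (a + h n) - V a < \<rho> * h n)} \<in> null_sets lborel"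
    (is "?E \<in> _")
proof -
  have E[measurable]: "?E \<in> sets borel"
    unfolding frequently_sequentially by measurable
  have fin: "emeasure lborel ?E < \<infinity>"
  proof -
    have "emeasure lborel ?E \<le> emeasure lborel {c..d}" by (rule emeasure_mono) auto
    then show ?thesis by (simp add: emeasure_lborel_Icc_eq le_less_trans split: if_splits)
  qed
  have bound: "ennreal \<tau> * emeasure lborel ?E \<le> ennreal \<rho> * emeasure lborel ?E + ennreal e" if "0 < e" for e
  proof -
    \<comment> \<open>The summand 1 covers the case \<rho> = 0.\<close>
    define \<epsilon> where "\<epsilon> = e / (\<rho> + 1)"
    have \<epsilon>: "0 < \<epsilon>" "\<rho> * \<epsilon> \<le> e" using that \<rho> by (auto simp: \<epsilon>_def field_simps)
    obtain U where U: "open U" "?E \<subseteq> U" "emeasure lborel (U - ?E) \<le> \<epsilon>"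
      using outer_regular_lborel_le[OF E \<epsilon>(1)] by blast
    define K where "K = {(a, n). a \<in> ?E \<and> {a..a + h n} \<subseteq> U \<and> V (a + h n) - V a < \<rho> * h n}"
    \<comment> \<open>The covering theorem speaks of closed balls, so an interval that starts at a
      is written as the ball around its midpoint.\<close>
    define ctr where "ctr = (\<lambda>(a, n). a + h n / 2)"
    define rad where "rad = (\<lambda>(a::real, n). h n / 2)"
    have ball: "cball (ctr p) (rad p) = {fst p..fst p + h (snd p)}" for p
      by (auto simp: ctr_def rad_def cball_eq_atLeastAtMost split: prod.splits)
    obtain C where C: "countable C" "C \<subseteq> K"
      "pairwise (\<lambda>i j. disjnt (cball (ctr i) (rad i)) (cball (ctr j) (rad j))) C"
      "negligible (?E - (\<Union>i \<in> C. cball (ctr i) (rad i)))"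
    proof (rule Vitali_covering_theorem_cballs[of K rad ?E ctr])
      fix i assume "i \<in> K" then show "0 < rad i" using h by (auto simp: rad_def split: prod.splits)
    next
      fix x d' :: real assume x: "x \<in> ?E" and d': "0 < d'"
      obtain \<delta> where \<delta>: "0 < \<delta>" "ball x \<delta> \<subseteq> U" using U x by (meson openE subsetD)
      have "\<forall>\<^sub>F n in sequentially. h n < min \<delta> d'"
        using h(2) \<delta> d' by (intro order_tendstoD) auto
      moreover have "\<exists>\<^sub>F n in sequentially. V (x + h n) - V x < \<rho> * h n" using x by simp
      ultimately have "\<exists>\<^sub>F n in sequentially. V (x + h n) - V x < \<rho> * h n \<and> h n < min \<delta> d'"
        by (auto intro: eventually_mono elim!: frequently_rev_mp)
      then obtain n where n: "V (x + h n) - V x < \<rho> * h n" "h n < min \<delta> d'"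
        using frequently_ex by blast
      have "{x..x + h n} \<subseteq> ball x \<delta>" using n by (auto simp: dist_real_def)
      then have "(x, n) \<in> K" using n \<delta> x by (auto simp: K_def)
      moreover have "x \<in> cball (ctr (x, n)) (rad (x, n))" using h(1)[of n] by (simp add: ball less_imp_le)
      moreover have "rad (x, n) < d'" using n h(1)[of n] by (simp add: rad_def)
      ultimately show "\<exists>i. i \<in> K \<and> x \<in> cball (ctr i) (rad i) \<and> rad i < d'" by blast
    qed blast
    let ?I = "\<lambda>i. cball (ctr i) (rad i)"
    have disj: "disjoint_family_on ?I C"
      using C(3) by (auto simp: disjoint_family_on_def pairwise_def disjnt_def)
    have UI: "(\<Union>i\<in>C. ?I i) \<in> sets borel" using C(1) by auto
    have N: "?E - (\<Union>i\<in>C. ?I i) \<in> null_sets lborel"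
      using C(4) E UI by (simp add: negligible_iff_null_sets null_sets_completion_iff)
    have each: "(\<integral>\<^sup>+t. ennreal (v t) * indicator (?I i) t \<partial>lborel) \<le> ennreal \<rho> * emeasure lborel (?I i)"
      if "i \<in> C" for i
    proof -
      obtain a n where i: "i = (a, n)" by force
      have K: "V (a + h n) - V a < \<rho> * h n" using that C(2) by (auto simp: i K_def)
      have "(\<integral>\<^sup>+t. ennreal (v t) * indicator (?I i) t \<partial>lborel)
          = (\<integral>\<^sup>+t. ennreal (v t) * indicator {a<..a + h n} t \<partial>lborel)"
        by (rule nn_integral_cong_AE, use AE_lborel_singleton[of a] in eventually_elim)
           (auto simp: ball i indicator_def)
      also have "\<dots> = ennreal (V (a + h n) - V a)" using V[of a "a + h n"] h(1)[of n] by simp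
      also have "\<dots> \<le> ennreal (\<rho> * h n)" using K by (intro ennreal_leI) simp
      also have "\<dots> = ennreal \<rho> * emeasure lborel (?I i)"
        using \<rho> h(1)[of n] by (simp add: ball i ennreal_mult less_imp_le)
      finally show ?thesis .
    qed
    have "ennreal \<tau> * emeasure lborel ?E = (\<integral>\<^sup>+t. ennreal \<tau> * indicator ?E t \<partial>lborel)"
      by (rule nn_integral_cmult_indicator[symmetric]) (use E in simp)
    also have "\<dots> \<le> (\<integral>\<^sup>+t. ennreal (v t) * indicator (\<Union>i\<in>C. ?I i) t \<partial>lborel)"
      by (rule nn_integral_mono_AE, use AE_not_in[OF N] in eventually_elim)
         (auto simp: indicator_def intro: ennreal_leI)
    also have "\<dots> = (\<integral>\<^sup>+t. (\<integral>\<^sup>+i. ennreal (v t) * indicator (?I i) t \<partial>count_space C) \<partial>lborel)"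
    proof (rule nn_integral_cong)
      fix t
      show "ennreal (v t) * indicator (\<Union>i\<in>C. ?I i) t = (\<integral>\<^sup>+i. ennreal (v t) * indicator (?I i) t \<partial>count_space C)"
      proof (cases "t \<in> (\<Union>i\<in>C. ?I i)")
        case True
        then obtain i where i: "i \<in> C" "t \<in> ?I i" by auto
        have "(\<integral>\<^sup>+j. ennreal (v t) * indicator (?I j) t \<partial>count_space C) = (\<integral>\<^sup>+j. ennreal (v t) * indicator {i} j \<partial>count_space C)"
        proof (rule nn_integral_cong)
          fix j assume "j \<in> space (count_space C)"
          then have "t \<in> ?I j \<longleftrightarrow> j = i" using i disj by (auto simp: disjoint_family_on_def simp del: mem_cball)
          then show "ennreal (v t) * indicator (?I j) t = ennreal (v t) * indicator {i} j"
            by (simp only: indicator_def) simp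
        qed
        also have "\<dots> = ennreal (v t)" using i by (simp add: nn_integral_cmult_indicator)
        finally show ?thesis using True by simp
      next
        case False
        then have "(\<integral>\<^sup>+i. ennreal (v t) * indicator (?I i) t \<partial>count_space C) = (\<integral>\<^sup>+i. 0 \<partial>count_space C)"
          by (intro nn_integral_cong) (auto simp: indicator_def)
        then show ?thesis using False by simp
      qed
    qed
    also have "\<dots> = (\<integral>\<^sup>+i. (\<integral>\<^sup>+t. ennreal (v t) * indicator (?I i) t \<partial>lborel) \<partial>count_space C)"
    proof (rule nn_integral_count_space_nn_integral[OF C(1)])
      fix i
      have [measurable]: "?I i \<in> sets borel" by simp
      show "(\<lambda>t. ennreal (v t) * indicator (?I i) t) \<in> borel_measurable lborel" by measurable
    qed
    also have "\<dots> \<le> (\<integral>\<^sup>+i. ennreal \<rho> * emeasure lborel (?I i) \<partial>count_space C)"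
      by (rule nn_integral_mono) (use each in auto)
    also have "\<dots> = ennreal \<rho> * emeasure lborel (\<Union>i\<in>C. ?I i)"
      by (subst emeasure_UN_countable[OF _ C(1) disj]) (auto simp: nn_integral_cmult)
    also have "\<dots> \<le> ennreal \<rho> * emeasure lborel U"
    proof (intro mult_left_mono emeasure_mono)
      show "(\<Union>i\<in>C. ?I i) \<subseteq> U" using C(2) by (force simp: K_def ball)
    qed (use U in auto)
    also have "\<dots> \<le> ennreal \<rho> * (emeasure lborel ?E + ennreal \<epsilon>)"
    proof (rule mult_left_mono)
      have "emeasure lborel U = emeasure lborel ?E + emeasure lborel (U - ?E)"
        using U E by (subst plus_emeasure) (auto intro!: arg_cong[where f="emeasure lborel"])
      then show "emeasure lborel U \<le> emeasure lborel ?E + ennreal \<epsilon>" using U(3) by (simp add: add_left_mono)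
    qed simp
    also have "\<dots> = ennreal \<rho> * emeasure lborel ?E + ennreal (\<rho> * \<epsilon>)"
      using \<rho> \<epsilon> by (simp add: distrib_left ennreal_mult)
    also have "\<dots> \<le> ennreal \<rho> * emeasure lborel ?E + ennreal e"
      using \<epsilon> by (intro add_left_mono ennreal_leI)
    finally show ?thesis .
  qed
  have "ennreal \<tau> * emeasure lborel ?E \<le> ennreal \<rho> * emeasure lborel ?E"
    by (rule ennreal_le_epsilon) (use bound in auto)
  moreover obtain x where x: "emeasure lborel ?E = ennreal x" "0 \<le> x"
    using fin by (cases "emeasure lborel ?E") auto
  ultimately have "\<tau> * x \<le> \<rho> * x"
    using \<rho> by (simp add: ennreal_mult[symmetric])
  then have "x = 0" using \<rho> x by (smt (verit) mult_less_cancel_right_pos)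
  then show ?thesis using x E by (auto simp: null_sets_def)
qed

text \<open>The lower half of Lebesgue differentiation, along one sequence of right increments. Two
  rationals between \<rho> and \<open>v a\<close>, together with a bounded window, reduce the
  uncountably many \<rho> to countably many null sets.\<close>

lemma AE_le_liminf_difference_quotient:
  fixes v V :: "real \<Rightarrow> real" and h :: "nat \<Rightarrow> real"
  assumes [measurable]: "v \<in> borel_measurable borel" "V \<in> borel_measurable borel"
    and V: "\<And>a b. a \<le> b \<Longrightarrow> (\<integral>\<^sup>+t. ennreal (v t) * indicator {a<..b} t \<partial>lborel) = ennreal (V b - V a)"
    and h: "\<And>n. 0 < h n" "h \<longlonglongrightarrow> 0"
  shows "AE a in lborel. \<forall>\<rho>\<ge>0. \<rho> < v a \<longrightarrow> (\<forall>\<^sub>F n in sequentially. \<rho> * h n \<le> V (a + h n) - V a)"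
proof -
  have "AE a in lborel. \<forall>p q :: rat. \<forall>N::nat. 0 \<le> p \<and> p < q \<longrightarrow>
      a \<notin> {a \<in> {-real N..real N}. of_rat q \<le> v a \<and> (\<exists>\<^sub>F n in sequentially. V (a + h n) - V a < of_rat p * h n)}"
    unfolding AE_all_countable
  proof (intro allI)
    fix p q :: rat and N :: nat
    show "AE a in lborel. 0 \<le> p \<and> p < q \<longrightarrow>
      a \<notin> {a \<in> {-real N..real N}. of_rat q \<le> v a \<and> (\<exists>\<^sub>F n in sequentially. V (a + h n) - V a < of_rat p * h n)}"
    proof (cases "0 \<le> p \<and> p < q")
      case True
      then have "0 \<le> (of_rat p :: real)" "(of_rat p :: real) < of_rat q" by (auto simp: of_rat_less)
      then have "{a \<in> {-real N..real N}. of_rat q \<le> v a \<and> (\<exists>\<^sub>F n in sequentially. V (a + h n) - V a < of_rat p * h n)}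
          \<in> null_sets lborel"
        by (intro lower_density_null_set V h) auto
      from AE_not_in[OF this] show ?thesis by eventually_elim simp
    next
      case False
      then show ?thesis by (intro AE_I2) blast
    qed
  qed
  then show ?thesis
  proof eventually_elim
    case (elim a)
    show ?case
    proof (intro allI impI)
      fix \<rho> :: real assume \<rho>: "0 \<le> \<rho>" "\<rho> < v a"
      obtain p where p: "\<rho> < of_rat p" "of_rat p < v a" using of_rat_dense[OF \<rho>(2)] by blast
      obtain q where q: "of_rat p < (of_rat q :: real)" "of_rat q < v a" using of_rat_dense[OF p(2)] by blast
      obtain N :: nat where N: "\<bar>a\<bar> \<le> real N" using real_arch_simple by blast
      have "0 < (of_rat p :: real)" using p \<rho> by linarith
      then have "0 \<le> p" "p < q" using q by (auto simp: of_rat_less zero_less_of_rat_iff)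
      then have "\<not> (\<exists>\<^sub>F n in sequentially. V (a + h n) - V a < of_rat p * h n)"
        using elim[rule_format, of p q N] N q by (auto simp: abs_le_iff)
      then have "\<forall>\<^sub>F n in sequentially. of_rat p * h n \<le> V (a + h n) - V a"
        by (simp add: not_frequently not_less)
      then show "\<forall>\<^sub>F n in sequentially. \<rho> * h n \<le> V (a + h n) - V a"
      proof eventually_elim
        case (elim n)
        have "\<rho> * h n \<le> of_rat p * h n" using p h(1)[of n] by (intro mult_right_mono) auto
        then show ?case using elim by simp
      qed
    qed
  qed
qed

section \<open>Transport to the Gaussian measure\<close>

text \<open>Strict positivity makes the distribution function strictly increasing, so that the
  transport maps below are bijections of the line.\<close>

definition positive_density :: "(real \<Rightarrow> real) \<Rightarrow> bool" where
  "positive_density h \<longleftrightarrow> h \<in> borel_measurable borel \<and> (\<forall>x. 0 < h x) \<and> (\<integral>\<^sup>+x. ennreal (h x) \<partial>lborel) = 1"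

definition density_cdf :: "(real \<Rightarrow> real) \<Rightarrow> real \<Rightarrow> real" where
  "density_cdf h y = enn2real (\<integral>\<^sup>+t. ennreal (h t) * indicator {..y} t \<partial>lborel)"

text \<open>The increasing transport of the standard Gaussian law to the law with density
  \<open>h\<close>; \<open>gauss_rank\<close> is the transport back. For a positive density both
  distribution functions map onto the open unit interval, so the inverse is always taken at a value
  that is attained.\<close>

definition gauss_map :: "(real \<Rightarrow> real) \<Rightarrow> real \<Rightarrow> real" where
  "gauss_map h b = inv_into UNIV (density_cdf h) (density_cdf std_normal_density b)"

definition gauss_rank :: "(real \<Rightarrow> real) \<Rightarrow> real \<Rightarrow> real" where
  "gauss_rank h y = inv_into UNIV (density_cdf std_normal_density) (density_cdf h y)"

lemma positive_density_std_normal: "positive_density std_normal_density"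
proof -
  interpret N: prob_space "density lborel std_normal_density"
    by (rule prob_space_normal_density) simp
  have "(\<integral>\<^sup>+x. ennreal (std_normal_density x) \<partial>lborel) = 1"
    using N.emeasure_space_1 by (simp add: emeasure_density)
  then show ?thesis
    by (simp add: positive_density_def normal_density_pos)
qed

context
  fixes h :: "real \<Rightarrow> real"
  assumes h: "positive_density h"
begin

lemma positive_density_measurable: "h \<in> borel_measurable borel"
  and positive_density_pos: "0 < h x"
  and positive_density_integral: "(\<integral>\<^sup>+x. ennreal (h x) \<partial>lborel) = 1"
  using h by (auto simp: positive_density_def)

lemma real_distribution_positive_density: "real_distribution (density lborel h)"
proof -
  note [measurable] = positive_density_measurable
  have "prob_space (density lborel h)"
    by (rule prob_spaceI) (simp add: emeasure_density positive_density_integral)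
  then show ?thesis by (simp add: real_distribution_def real_distribution_axioms_def)
qed

interpretation D: real_distribution "density lborel h"
  by (rule real_distribution_positive_density)

lemma cdf_density_eq: "cdf (density lborel h) = density_cdf h"
  using positive_density_measurable by (auto simp: cdf_def density_cdf_def measure_def emeasure_density)

lemma density_cdf_diff:
  assumes "a \<le> b"
  shows "ennreal (density_cdf h b - density_cdf h a) = (\<integral>\<^sup>+t. ennreal (h t) * indicator {a<..b} t \<partial>lborel)"
proof -
  have "ennreal (density_cdf h b - density_cdf h a) = emeasure (density lborel h) {a<..b}"
  proof (cases "a = b")
    case False
    then have "a < b" using assms by simp
    from D.cdf_diff_eq[OF this] show ?thesis
      by (simp add: cdf_density_eq D.emeasure_eq_measure)
  qed simp
  then show ?thesis using positive_density_measurable by (simp add: emeasure_density)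
qed

lemma strict_mono_density_cdf: "strict_mono (density_cdf h)"
proof (rule strict_monoI)
  note [measurable] = positive_density_measurable
  fix a b :: real assume ab: "a < b"
  have "0 < (\<integral>\<^sup>+t. ennreal (h t) * indicator {a<..b} t \<partial>lborel)"
  proof (rule ccontr)
    assume "\<not> ?thesis"
    then have "AE t in lborel. ennreal (h t) * indicator {a<..b} t = 0"
      by (simp add: nn_integral_0_iff_AE not_less)
    then have "AE t in lborel. t \<notin> {a<..b}"
    proof eventually_elim
      case (elim t)
      then show ?case using positive_density_pos[of t] by (auto simp: indicator_def ennreal_eq_0_iff split: if_splits)
    qed
    then have "emeasure lborel {a<..b} = 0"
      by (subst (asm) AE_iff_measurable[of "{a<..b}"]) auto
    then show False using ab by simp
  qed
  then show "density_cdf h a < density_cdf h b"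
    using density_cdf_diff[of a b] ab by (metis diff_gt_0_iff_gt ennreal_less_zero_iff less_imp_le)
qed

lemma density_cdf_less_iff: "density_cdf h a < density_cdf h b \<longleftrightarrow> a < b"
  and density_cdf_le_iff: "density_cdf h a \<le> density_cdf h b \<longleftrightarrow> a \<le> b"
  using strict_mono_density_cdf by (simp_all add: strict_mono_less strict_mono_less_eq)

lemma density_cdf_pos: "0 < density_cdf h y"
  using density_cdf_less_iff[of "y - 1" y] D.cdf_nonneg[of "y - 1"] by (simp add: cdf_density_eq)

lemma density_cdf_less_1: "density_cdf h y < 1"
  using density_cdf_less_iff[of y "y + 1"] D.cdf_bounded_prob[of "y + 1"] by (simp add: cdf_density_eq)

lemma ennreal_density_cdf: "ennreal (density_cdf h y) = (\<integral>\<^sup>+t. ennreal (h t) * indicator {..y} t \<partial>lborel)"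
proof -
  have "(\<integral>\<^sup>+t. ennreal (h t) * indicator {..y} t \<partial>lborel) \<le> (\<integral>\<^sup>+t. ennreal (h t) \<partial>lborel)"
    by (intro nn_integral_mono) (auto simp: indicator_def)
  then show ?thesis unfolding density_cdf_def positive_density_integral
    by (intro ennreal_enn2real) (metis ennreal_one_less_top le_less_trans)
qed

lemma density_cdf_surj:
  assumes p: "0 < p" "p < 1" shows "\<exists>y. density_cdf h y = p"
proof -
  note [measurable] = positive_density_measurable
  have cont: "isCont (density_cdf h) x" for x
  proof -
    have "measure (density lborel h) {x} = 0"
      by (simp add: measure_def emeasure_density nn_integral_0_iff_AE AE_lborel_singleton)
    then show ?thesis using D.isCont_cdf[of x] by (simp add: cdf_density_eq)
  qed
  have "\<forall>\<^sub>F x in at_bot. density_cdf h x < p"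
    using D.cdf_lim_at_bot p by (auto simp: cdf_density_eq intro: order_tendstoD)
  then obtain a where a: "density_cdf h a < p" by (auto simp: eventually_at_bot_linorder)
  have "\<forall>\<^sub>F x in at_top. p < density_cdf h x"
    using D.cdf_lim_at_top_prob p by (auto simp: cdf_density_eq intro: order_tendstoD)
  then obtain b where b: "p < density_cdf h b" by (auto simp: eventually_at_top_linorder)
  have "a \<le> b" using a b density_cdf_less_iff by (metis less_trans less_imp_le)
  then show ?thesis using IVT[of "density_cdf h" a p b] a b cont by auto
qed

end

lemma density_cdf_gauss_map:
  assumes "positive_density h" shows "density_cdf h (gauss_map h b) = density_cdf std_normal_density b"
  unfolding gauss_map_def
  by (intro f_inv_into_f)
     (metis assms density_cdf_surj density_cdf_pos density_cdf_less_1 positive_density_std_normal rangeI)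

lemma density_cdf_gauss_rank:
  assumes "positive_density h" shows "density_cdf std_normal_density (gauss_rank h y) = density_cdf h y"
  unfolding gauss_rank_def
  by (intro f_inv_into_f)
     (metis assms density_cdf_surj density_cdf_pos density_cdf_less_1 positive_density_std_normal rangeI)

context
  fixes h :: "real \<Rightarrow> real"
  assumes h: "positive_density h"
begin

lemma gauss_rank_map [simp]: "gauss_rank h (gauss_map h b) = b"
  by (metis density_cdf_gauss_map density_cdf_gauss_rank h positive_density_std_normal
      strict_mono_density_cdf strict_mono_eq)

lemma gauss_map_rank [simp]: "gauss_map h (gauss_rank h y) = y"
  by (metis density_cdf_gauss_map density_cdf_gauss_rank h strict_mono_density_cdf strict_mono_eq)

lemma le_gauss_map_iff: "y \<le> gauss_map h b \<longleftrightarrow> density_cdf h y \<le> density_cdf std_normal_density b"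
  by (metis density_cdf_gauss_map density_cdf_le_iff h)

lemma gauss_map_le_iff: "gauss_map h b \<le> y \<longleftrightarrow> density_cdf std_normal_density b \<le> density_cdf h y"
  by (metis density_cdf_gauss_map density_cdf_le_iff h)

lemma gauss_rank_le_iff: "gauss_rank h y \<le> b \<longleftrightarrow> y \<le> gauss_map h b"
  by (metis density_cdf_gauss_rank density_cdf_le_iff h le_gauss_map_iff positive_density_std_normal)

lemma strict_mono_gauss_map: "strict_mono (gauss_map h)"
  by (rule strict_monoI)
     (metis density_cdf_less_iff gauss_map_le_iff h linorder_not_le density_cdf_gauss_map positive_density_std_normal)

lemma mono_gauss_map: "mono (gauss_map h)"
  by (rule strict_mono_mono[OF strict_mono_gauss_map])

lemma mono_gauss_rank: "mono (gauss_rank h)"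
  by (rule monoI) (metis gauss_map_rank gauss_rank_le_iff order_trans)

lemma borel_measurable_gauss_map: "gauss_map h \<in> borel_measurable borel"
  by (rule borel_measurable_mono[OF mono_gauss_map])

lemma borel_measurable_gauss_rank: "gauss_rank h \<in> borel_measurable borel"
  by (rule borel_measurable_mono[OF mono_gauss_rank])

text \<open>The distribution functions agree, because \<open>gauss_rank h y \<le> b\<close> is the
  same event as \<open>y \<le> gauss_map h b\<close>.\<close>

lemma distr_gauss_rank:
  "distr (density lborel h) borel (gauss_rank h) = density lborel std_normal_density"
proof (rule cdf_unique)
  note [measurable] = borel_measurable_gauss_rank
  note [measurable] = positive_density_measurable[OF h]
  interpret D: real_distribution "density lborel h"
    by (rule real_distribution_positive_density[OF h])
  show "real_distribution (distr (density lborel h) borel (gauss_rank h))"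
    by (rule D.real_distribution_distr) simp
  show "real_distribution (density lborel std_normal_density)"
    by (rule real_distribution_positive_density[OF positive_density_std_normal])
  show "cdf (distr (density lborel h) borel (gauss_rank h)) = cdf (density lborel std_normal_density)"
  proof
    fix b
    have "cdf (distr (density lborel h) borel (gauss_rank h)) b = cdf (density lborel h) (gauss_map h b)"
      unfolding cdf_def by (subst measure_distr) (auto simp: vimage_def gauss_rank_le_iff atMost_def)
    then show "cdf (distr (density lborel h) borel (gauss_rank h)) b = cdf (density lborel std_normal_density) b"
      by (simp add: cdf_density_eq h density_cdf_gauss_map positive_density_std_normal)
  qed
qed

lemma nn_integral_gauss_map:
  assumes [measurable]: "k \<in> borel_measurable borel"
  shows "(\<integral>\<^sup>+y. ennreal (h y) * k y \<partial>lborel) = (\<integral>\<^sup>+b. ennreal (std_normal_density b) * k (gauss_map h b) \<partial>lborel)"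
proof -
  note [measurable] = borel_measurable_gauss_rank borel_measurable_gauss_map positive_density_measurable[OF h]
  have "(\<integral>\<^sup>+y. ennreal (h y) * k y \<partial>lborel) = (\<integral>\<^sup>+y. k (gauss_map h (gauss_rank h y)) \<partial>density lborel h)"
    by (simp add: nn_integral_density)
  also have "\<dots> = (\<integral>\<^sup>+b. k (gauss_map h b) \<partial>density lborel std_normal_density)"
    by (subst distr_gauss_rank[symmetric], subst nn_integral_distr) simp_all
  also have "\<dots> = (\<integral>\<^sup>+b. ennreal (std_normal_density b) * k (gauss_map h b) \<partial>lborel)"
    by (simp add: nn_integral_density)
  finally show ?thesis .
qed

text \<open>The length of the image interval is the integral of \<open>h * (1 / h)\<close> over it,
  which is then pulled back to the Gaussian side. As \<open>h\<close> is merely measurable, the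
  formula for the derivative of \<open>gauss_map h\<close> is recorded in this integrated form, the
  input of the differentiation lemma.\<close>

lemma gauss_map_increment:
  assumes "a \<le> b"
  shows "(\<integral>\<^sup>+t. ennreal (std_normal_density t / h (gauss_map h t)) * indicator {a<..b} t \<partial>lborel)
      = ennreal (gauss_map h b - gauss_map h a)"
proof -
  note [measurable] = borel_measurable_gauss_map positive_density_measurable[OF h]
  let ?I = "{gauss_map h a<..gauss_map h b}"
  have "ennreal (gauss_map h b - gauss_map h a) = (\<integral>\<^sup>+y. indicator ?I y \<partial>lborel)"
    using mono_gauss_map assms by (simp add: monoD)
  also have "\<dots> = (\<integral>\<^sup>+y. ennreal (h y) * (ennreal (1 / h y) * indicator ?I y) \<partial>lborel)"
  proof (rule nn_integral_cong)
    fix y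
    have "ennreal (h y) * ennreal (1 / h y) = 1"
      using positive_density_pos[OF h, of y] by (simp add: ennreal_mult[symmetric])
    then show "indicator ?I y = ennreal (h y) * (ennreal (1 / h y) * indicator ?I y)"
      by (simp add: mult.assoc[symmetric])
  qed
  also have "\<dots> = (\<integral>\<^sup>+b'. ennreal (std_normal_density b') *
      (ennreal (1 / h (gauss_map h b')) * indicator ?I (gauss_map h b')) \<partial>lborel)"
    by (rule nn_integral_gauss_map) measurable
  also have "\<dots> = (\<integral>\<^sup>+t. ennreal (std_normal_density t / h (gauss_map h t)) * indicator {a<..b} t \<partial>lborel)"
  proof (rule nn_integral_cong)
    fix t
    have "gauss_map h t \<in> ?I \<longleftrightarrow> t \<in> {a<..b}"
      using strict_mono_gauss_map by (simp add: strict_mono_less strict_mono_less_eq)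
    moreover have "ennreal (std_normal_density t) * ennreal (1 / h (gauss_map h t))
        = ennreal (std_normal_density t / h (gauss_map h t))"
      using positive_density_pos[OF h, of "gauss_map h t"] by (simp add: ennreal_mult[symmetric])
    ultimately show "ennreal (std_normal_density t) *
      (ennreal (1 / h (gauss_map h t)) * indicator ?I (gauss_map h t))
      = ennreal (std_normal_density t / h (gauss_map h t)) * indicator {a<..b} t"
      by (simp add: indicator_def)
  qed
  finally show ?thesis by simp
qed

end

section \<open>The inequality for one pair\<close>

text \<open>Half the binary entropy of \<theta> in nats. The half appears because the rotation has
  the coefficients \<open>sqrt \<theta>\<close> and \<open>sqrt (1 - \<theta>)\<close>, whose
  logarithms are \<open>ln \<theta> / 2\<close> and \<open>ln (1 - \<theta>) / 2\<close>.\<close>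

definition mixing_entropy :: "real \<Rightarrow> real" where
  "mixing_entropy \<theta> = - (\<theta> * ln \<theta> + (1 - \<theta>) * ln (1 - \<theta>)) / 2"

text \<open>Completing the square produces the rotated Gaussian coordinate; the remaining factor is
  estimated by the weighted arithmetic-geometric mean inequality.\<close>

lemma gauss_rotation_bound:
  fixes \<theta> :: real
  assumes \<theta>: "0 < \<theta>" "\<theta> < 1" and p: "0 < p" and w: "0 < w"
  shows "std_normal_density a * std_normal_density b *
      (p powr (- \<theta>) * w powr (- (1 - \<theta>)) * exp (mixing_entropy \<theta> + sqrt (\<theta> * (1 - \<theta>)) * (a * b)))
    \<le> std_normal_density (sqrt \<theta> * b - sqrt (1 - \<theta>) * a) *
      (sqrt \<theta> * (std_normal_density a / p) + sqrt (1 - \<theta>) * (std_normal_density b / w))"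
proof -
  define l m where "l = sqrt \<theta>" and "m = sqrt (1 - \<theta>)"
  have lm: "0 < l" "0 < m" "l\<^sup>2 = \<theta>" "m\<^sup>2 = 1 - \<theta>" using \<theta> by (auto simp: l_def m_def)
  have k: "sqrt (\<theta> * (1 - \<theta>)) = l * m" by (simp add: l_def m_def real_sqrt_mult)
  \<comment> \<open>Scaled so that \<open>\<theta> * A\<close> and \<open>(1 - \<theta>) * B\<close>
    are exactly the two summands of the claimed bound; the factors \<open>l\<close> and
    \<open>m\<close> in the denominators are what produces
    \<open>mixing_entropy \<theta>\<close>.\<close>
  define A B where "A = std_normal_density a / (l * p)" and "B = std_normal_density b / (m * w)"
  have AB: "0 < A" "0 < B" using lm p w by (auto simp: A_def B_def normal_density_pos)
  define C where "C = - ln (sqrt (2 * pi))"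
  have "exp C = 1 / sqrt (2 * pi)" by (simp add: C_def exp_minus inverse_eq_divide)
  then have sn: "std_normal_density x = exp (C - x\<^sup>2 / 2)" for x
    using exp_add[of C "- x\<^sup>2 / 2"] by (simp add: std_normal_density_def)
  have lnl: "ln l = ln \<theta> / 2" "ln m = ln (1 - \<theta>) / 2" using \<theta> by (auto simp: l_def m_def ln_sqrt)
  have lnA: "ln A = C - a\<^sup>2 / 2 - ln \<theta> / 2 - ln p"
    using lm p by (simp add: A_def sn ln_div ln_mult lnl)
  have lnB: "ln B = C - b\<^sup>2 / 2 - ln (1 - \<theta>) / 2 - ln w"
    using lm w by (simp add: B_def sn ln_div ln_mult lnl)
  \<comment> \<open>With the cross term added, the square of u = l b - m a leaves \<theta> times the
    square of a and 1 - \<theta> times the square of b in the exponent: precisely the Gaussian parts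
    of \<open>A powr \<theta>\<close> and \<open>B powr (1 - \<theta>)\<close>.\<close>
  have sq: "(l * b - m * a)\<^sup>2 = \<theta> * b\<^sup>2 + (1 - \<theta>) * a\<^sup>2 - 2 * (l * m) * (a * b)"
    by (simp add: power2_diff power_mult_distrib lm(3,4))
  have "std_normal_density a * std_normal_density b *
      (p powr (- \<theta>) * w powr (- (1 - \<theta>)) * exp (mixing_entropy \<theta> + sqrt (\<theta> * (1 - \<theta>)) * (a * b)))
    = exp ((C - a\<^sup>2 / 2) + (C - b\<^sup>2 / 2) + (- \<theta> * ln p - (1 - \<theta>) * ln w + (mixing_entropy \<theta> + l * m * (a * b))))"
    unfolding k using p w by (simp add: sn powr_def exp_add[symmetric] algebra_simps)
  also have "(C - a\<^sup>2 / 2) + (C - b\<^sup>2 / 2) + (- \<theta> * ln p - (1 - \<theta>) * ln w + (mixing_entropy \<theta> + l * m * (a * b)))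
    = (C - (l * b - m * a)\<^sup>2 / 2) + (\<theta> * ln A + (1 - \<theta>) * ln B)"
    unfolding sq lnA lnB mixing_entropy_def by (simp add: field_simps)
  also have "exp \<dots> = std_normal_density (l * b - m * a) * (A powr \<theta> * B powr (1 - \<theta>))"
    using AB by (simp add: sn powr_def exp_add)
  also have "\<dots> \<le> std_normal_density (l * b - m * a) * (\<theta> * A + (1 - \<theta>) * B)"
    using Youngs_inequality_0[of \<theta> "1 - \<theta>" A B] \<theta> AB by (intro mult_left_mono) auto
  also have "\<theta> * A + (1 - \<theta>) * B = l * (std_normal_density a / p) + m * (std_normal_density b / w)"
  proof -
    have "\<theta> * A = l * (std_normal_density a / p)"
      unfolding A_def lm(3)[symmetric] using lm(1) by (simp add: power2_eq_square)
    moreover have "(1 - \<theta>) * B = m * (std_normal_density b / w)"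
      unfolding B_def lm(4)[symmetric] using lm(2) by (simp add: power2_eq_square)
    ultimately show ?thesis by simp
  qed
  finally show ?thesis by (simp add: l_def m_def)
qed

text \<open>The rotation t = l a + m b, u = l b - m a is split into two one-dimensional affine
  substitutions, b to t at fixed a and then a to u at fixed t. Their Jacobians \<open>1 / m\<close>
  and \<open>m\<close> cancel.\<close>

lemma nn_integral_rotate:
  fixes H :: "real \<Rightarrow> real \<Rightarrow> ennreal"
  assumes [measurable]: "(\<lambda>(a, b). H a b) \<in> borel_measurable (borel \<Otimes>\<^sub>M borel)"
    and lm: "0 < l" "0 < m" "l\<^sup>2 + m\<^sup>2 = 1"
  shows "(\<integral>\<^sup>+a. \<integral>\<^sup>+b. H a b \<partial>lborel \<partial>lborel)
       = (\<integral>\<^sup>+u. \<integral>\<^sup>+t. H (l * t - m * u) (m * t + l * u) \<partial>lborel \<partial>lborel)"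
proof -
  have "(\<integral>\<^sup>+a. \<integral>\<^sup>+b. H a b \<partial>lborel \<partial>lborel)
      = (\<integral>\<^sup>+a. \<integral>\<^sup>+t. ennreal (1 / m) * H a (t / m - l / m * a) \<partial>lborel \<partial>lborel)"
  proof (rule nn_integral_cong)
    fix a
    have "(\<integral>\<^sup>+b. H a b \<partial>lborel) = ennreal \<bar>1 / m\<bar> * (\<integral>\<^sup>+t. H a (- (l / m * a) + 1 / m * t) \<partial>lborel)"
      by (rule nn_integral_real_affine) (use lm in simp_all)
    then show "(\<integral>\<^sup>+b. H a b \<partial>lborel) = (\<integral>\<^sup>+t. ennreal (1 / m) * H a (t / m - l / m * a) \<partial>lborel)"
      using lm by (subst nn_integral_cmult) (auto simp: algebra_simps)
  qed
  also have "\<dots> = (\<integral>\<^sup>+t. \<integral>\<^sup>+a. ennreal (1 / m) * H a (t / m - l / m * a) \<partial>lborel \<partial>lborel)"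
    by (rule lborel_pair.Fubini'[symmetric]) measurable
  also have "\<dots> = (\<integral>\<^sup>+t. \<integral>\<^sup>+u. H (l * t - m * u) (m * t + l * u) \<partial>lborel \<partial>lborel)"
  proof (rule nn_integral_cong)
    fix t
    have "(\<integral>\<^sup>+a. ennreal (1 / m) * H a (t / m - l / m * a) \<partial>lborel)
      = ennreal \<bar>- m\<bar> * (\<integral>\<^sup>+u. ennreal (1 / m) * H (l * t + - m * u) (t / m - l / m * (l * t + - m * u)) \<partial>lborel)"
      by (rule nn_integral_real_affine) (use lm in simp_all)
    also have "\<dots> = (\<integral>\<^sup>+u. (ennreal m * ennreal (1 / m)) * H (l * t + - m * u) (t / m - l / m * (l * t + - m * u)) \<partial>lborel)"
      using lm by (subst nn_integral_cmult[symmetric]) (auto simp: mult.assoc)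
    also have "\<dots> = (\<integral>\<^sup>+u. H (l * t - m * u) (m * t + l * u) \<partial>lborel)"
    proof (rule nn_integral_cong)
      fix u
      have "t / m - l / m * (l * t + - m * u) = (1 - l\<^sup>2) * t / m + l * u"
        using lm by (simp add: field_simps power2_eq_square)
      also have "1 - l\<^sup>2 = m\<^sup>2" using lm(3) by simp
      finally have "t / m - l / m * (l * t + - m * u) = m * t + l * u"
        using lm by (simp add: power2_eq_square)
      moreover have "ennreal m * ennreal (1 / m) = 1" using lm by (simp add: ennreal_mult[symmetric])
      ultimately show "(ennreal m * ennreal (1 / m)) * H (l * t + - m * u) (t / m - l / m * (l * t + - m * u))
        = H (l * t - m * u) (m * t + l * u)" by simp
    qed
    finally show "(\<integral>\<^sup>+a. ennreal (1 / m) * H a (t / m - l / m * a) \<partial>lborel)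
      = (\<integral>\<^sup>+u. H (l * t - m * u) (m * t + l * u) \<partial>lborel)" .
  qed
  also have "\<dots> = (\<integral>\<^sup>+u. \<integral>\<^sup>+t. H (l * t - m * u) (m * t + l * u) \<partial>lborel \<partial>lborel)"
    by (rule lborel_pair.Fubini'[symmetric]) measurable
  finally show ?thesis .
qed

lemma measurable_density_cdf [measurable (raw)]:
  assumes [measurable]: "(\<lambda>(z, t). w z t) \<in> borel_measurable (N \<Otimes>\<^sub>M borel)"
    and [measurable]: "g \<in> borel_measurable N"
  shows "(\<lambda>z. density_cdf (w z) (g z)) \<in> borel_measurable N"
proof -
  have "(\<lambda>(z, t). ennreal (w z t) * indicator {..g z} t) \<in> borel_measurable (N \<Otimes>\<^sub>M lborel)"
    unfolding atMost_def indicator_def by measurable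
  then show ?thesis unfolding density_cdf_def by measurable
qed

text \<open>An inverse function hides its dependence on the parameter. Sublevel sets, however, turn
  into a comparison of two distribution functions, which are parameter integrals and hence jointly
  measurable.\<close>

lemma measurable_gauss_map_pair:
  assumes w: "\<And>z. z \<in> space N \<Longrightarrow> positive_density (w z)"
    and [measurable]: "(\<lambda>(z, t). w z t) \<in> borel_measurable (N \<Otimes>\<^sub>M borel)"
  shows "(\<lambda>(z, b). gauss_map (w z) b) \<in> borel_measurable (N \<Otimes>\<^sub>M borel)"
proof (rule borel_measurableI_le)
  note [measurable] = positive_density_measurable[OF positive_density_std_normal]
  fix y :: real
  have "{q \<in> space (N \<Otimes>\<^sub>M borel). (case q of (z, b) \<Rightarrow> gauss_map (w z) b) \<le> y}
     = {q \<in> space (N \<Otimes>\<^sub>M borel). density_cdf std_normal_density (snd q) \<le> density_cdf (w (fst q)) y}"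
    using w by (auto simp: space_pair_measure gauss_map_le_iff)
  also have "\<dots> \<in> sets (N \<Otimes>\<^sub>M borel)" by measurable
  finally show "{q \<in> space (N \<Otimes>\<^sub>M borel). (case q of (z, b) \<Rightarrow> gauss_map (w z) b) \<le> y} \<in> sets (N \<Otimes>\<^sub>M borel)" .
qed

lemma measurable_gauss_rank_pair:
  assumes w: "\<And>z. z \<in> space N \<Longrightarrow> positive_density (w z)"
    and [measurable]: "(\<lambda>(z, t). w z t) \<in> borel_measurable (N \<Otimes>\<^sub>M borel)"
  shows "(\<lambda>(z, y). gauss_rank (w z) y) \<in> borel_measurable (N \<Otimes>\<^sub>M borel)"
proof (rule borel_measurableI_le)
  note [measurable] = positive_density_measurable[OF positive_density_std_normal]
  fix b :: real
  have "{q \<in> space (N \<Otimes>\<^sub>M borel). (case q of (z, y) \<Rightarrow> gauss_rank (w z) y) \<le> b}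
     = {q \<in> space (N \<Otimes>\<^sub>M borel). density_cdf (w (fst q)) (snd q) \<le> density_cdf std_normal_density b}"
    using w by (auto simp: space_pair_measure gauss_rank_le_iff le_gauss_map_iff)
  also have "\<dots> \<in> sets (N \<Otimes>\<^sub>M borel)" by measurable
  finally show "{q \<in> space (N \<Otimes>\<^sub>M borel). (case q of (z, y) \<Rightarrow> gauss_rank (w z) y) \<le> b} \<in> sets (N \<Otimes>\<^sub>M borel)" .
qed

lemma AE_density_le_gauss_map_quotient:
  assumes h: "positive_density h" and l: "0 < l"
  shows "AE a in lborel. \<forall>\<rho>\<ge>0. \<rho> < std_normal_density a / h (gauss_map h a) \<longrightarrow>
    (\<forall>\<^sub>F n in sequentially. \<rho> * (l / real (Suc n)) \<le> gauss_map h (a + l / real (Suc n)) - gauss_map h a)"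
proof (rule AE_le_liminf_difference_quotient)
  note [measurable] = positive_density_measurable[OF h] borel_measurable_gauss_map[OF h]
  show "(\<lambda>a. std_normal_density a / h (gauss_map h a)) \<in> borel_measurable borel" by measurable
  show "gauss_map h \<in> borel_measurable borel" by measurable
  show "(\<lambda>n. l / real (Suc n)) \<longlonglongrightarrow> 0"
    by (rule LIMSEQ_Suc[OF lim_const_over_n])
qed (use l gauss_map_increment[OF h] in \<open>auto simp del: of_nat_Suc\<close>)


text \<open>The pair density \<open>p x * w x y\<close> multiplied by the factor that
  \<open>gauss_rotation_bound\<close> estimates, taken at the Gaussian coordinates of (x, y). The
  multiplication turns the exponents \<open>- \<theta>\<close> and \<open>- (1 - \<theta>)\<close>
  into \<open>1 - \<theta>\<close> and \<open>\<theta>\<close>.\<close>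

definition pair_kernel :: "real \<Rightarrow> (real \<Rightarrow> real) \<Rightarrow> (real \<Rightarrow> real \<Rightarrow> real) \<Rightarrow> real \<Rightarrow> real \<Rightarrow> real" where
  "pair_kernel \<theta> p w x y = p x powr (1 - \<theta>) * w x y powr \<theta> *
     exp (mixing_entropy \<theta> + sqrt (\<theta> * (1 - \<theta>)) * (gauss_rank p x * gauss_rank (w x) y))"

context
  fixes p :: "real \<Rightarrow> real" and w :: "real \<Rightarrow> real \<Rightarrow> real"
  assumes p: "positive_density p" and w: "\<And>x. positive_density (w x)"
    and wm: "(\<lambda>(x, y). w x y) \<in> borel_measurable (borel \<Otimes>\<^sub>M borel)"
    and dec: "\<And>x x' y. x \<le> x' \<Longrightarrow> density_cdf (w x') y \<le> density_cdf (w x) y"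
begin

text \<open>By \<open>dec\<close> the conditional law of y moves to the right in stochastic order as
  x grows, so each of its quantiles grows with x.\<close>

lemma gauss_map_cond_mono:
  assumes "a \<le> a'" "b \<le> b'"
  shows "gauss_map (w (gauss_map p a)) b \<le> gauss_map (w (gauss_map p a')) b'"
proof -
  let ?x = "gauss_map p a" and ?x' = "gauss_map p a'"
  have "?x \<le> ?x'" using mono_gauss_map[OF p] assms(1) by (rule monoD)
  then have "density_cdf (w ?x') (gauss_map (w ?x) b) \<le> density_cdf (w ?x) (gauss_map (w ?x) b)" by (rule dec)
  also have "\<dots> = density_cdf std_normal_density b" by (rule density_cdf_gauss_map[OF w])
  finally have "gauss_map (w ?x) b \<le> gauss_map (w ?x') b" by (simp add: le_gauss_map_iff[OF w])
  also have "\<dots> \<le> gauss_map (w ?x') b'" using mono_gauss_map[OF w] assms(2) by (rule monoD)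
  finally show ?thesis .
qed

text \<open>In Gaussian coordinates the kernel is at most the density of u times the lower
  derivative of the sum along the line on which u is constant. Monotone substitution on each line
  yields the integral of \<open>r\<close>, and the remaining weight in u has mass one.\<close>

lemma pair_kernel_le:
  assumes \<theta>: "0 < \<theta>" "\<theta> < 1" and rm [measurable]: "r \<in> borel_measurable borel"
  shows "(\<integral>\<^sup>+x. \<integral>\<^sup>+y. ennreal (pair_kernel \<theta> p w x y) * r (x + y) \<partial>lborel \<partial>lborel) \<le> (\<integral>\<^sup>+s. r s \<partial>lborel)"
proof -
  note [measurable] = positive_density_measurable[OF p] wm borel_measurable_gauss_map[OF p]
    borel_measurable_gauss_rank[OF p]
  have [measurable]: "(\<lambda>(x, b). gauss_map (w x) b) \<in> borel_measurable (borel \<Otimes>\<^sub>M borel)"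
    by (rule measurable_gauss_map_pair) (use w wm in auto)
  have [measurable]: "(\<lambda>(x, y). gauss_rank (w x) y) \<in> borel_measurable (borel \<Otimes>\<^sub>M borel)"
    by (rule measurable_gauss_rank_pair) (use w wm in auto)
  have pp: "0 < p x" and ww: "0 < w x y" for x y
    using positive_density_pos[OF p] positive_density_pos[OF w] by auto
  define l m where "l = sqrt \<theta>" and "m = sqrt (1 - \<theta>)"
  have lm: "0 < l" "0 < m" "l\<^sup>2 + m\<^sup>2 = 1" using \<theta> by (auto simp: l_def m_def)
  let ?\<phi> = std_normal_density
  define X where "X = gauss_map p"
  define Y where "Y a b = gauss_map (w (X a)) b" for a b
  define S where "S a b = X a + Y a b" for a b
  have [measurable]: "X \<in> borel_measurable borel" by (simp add: X_def)
  have [measurable]: "(\<lambda>(a, b). Y a b) \<in> borel_measurable (borel \<Otimes>\<^sub>M borel)"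
    unfolding Y_def by measurable
  have [measurable]: "(\<lambda>(a, b). S a b) \<in> borel_measurable (borel \<Otimes>\<^sub>M borel)"
    unfolding S_def by measurable
  define K where "K x y b = p x powr (- \<theta>) * w x y powr (- (1 - \<theta>)) *
     exp (mixing_entropy \<theta> + sqrt (\<theta> * (1 - \<theta>)) * (gauss_rank p x * b))" for x y b
  have K0: "0 \<le> K x y b" for x y b by (simp add: K_def)
  have pk: "pair_kernel \<theta> p w x y = p x * (w x y * K x y (gauss_rank (w x) y))" for x y
  proof -
    have "p x * p x powr (- \<theta>) = p x powr (1 - \<theta>)" "w x y * w x y powr (- (1 - \<theta>)) = w x y powr \<theta>"
      using pp[of x] ww[of x y] by (simp_all add: powr_mult_base)
    from this[symmetric] show ?thesis unfolding pair_kernel_def K_def by (simp only: ac_simps)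
  qed
  \<comment> \<open>The lower right derivative of the sum in the direction (l, m). A liminf exists
    everywhere, and it is the quantity that the substitution lemma accepts.\<close>
  define L where "L a b = liminf (\<lambda>n. ennreal (real (Suc n) *
     (S (a + l / real (Suc n)) (b + m / real (Suc n)) - S a b)))" for a b
  have [measurable]: "(\<lambda>(a, b). L a b) \<in> borel_measurable (borel \<Otimes>\<^sub>M borel)"
    unfolding L_def by measurable
  have Y_mono: "Y a b \<le> Y a' b'" if "a \<le> a'" "b \<le> b'" for a a' b b'
    unfolding Y_def X_def by (rule gauss_map_cond_mono) fact+
  have X_mono: "X a \<le> X a'" if "a \<le> a'" for a a'
    unfolding X_def by (rule monoD[OF mono_gauss_map[OF p]]) fact
  have "(\<integral>\<^sup>+x. \<integral>\<^sup>+y. ennreal (pair_kernel \<theta> p w x y) * r (x + y) \<partial>lborel \<partial>lborel)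
      = (\<integral>\<^sup>+x. ennreal (p x) * (\<integral>\<^sup>+b. ennreal (?\<phi> b) *
          (ennreal (K x (gauss_map (w x) b) b) * r (x + gauss_map (w x) b)) \<partial>lborel) \<partial>lborel)"
  proof (rule nn_integral_cong)
    fix x
    have "(\<integral>\<^sup>+y. ennreal (pair_kernel \<theta> p w x y) * r (x + y) \<partial>lborel)
      = (\<integral>\<^sup>+y. ennreal (p x) * (ennreal (w x y) * (ennreal (K x y (gauss_rank (w x) y)) * r (x + y))) \<partial>lborel)"
      using pp[of x] ww[of x] K0 by (intro nn_integral_cong) (simp add: pk ennreal_mult less_imp_le mult.assoc)
    also have "\<dots> = ennreal (p x) * (\<integral>\<^sup>+y. ennreal (w x y) * (ennreal (K x y (gauss_rank (w x) y)) * r (x + y)) \<partial>lborel)"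
      unfolding K_def by (rule nn_integral_cmult) measurable
    also have "(\<integral>\<^sup>+y. ennreal (w x y) * (ennreal (K x y (gauss_rank (w x) y)) * r (x + y)) \<partial>lborel)
      = (\<integral>\<^sup>+b. ennreal (?\<phi> b) * (ennreal (K x (gauss_map (w x) b) (gauss_rank (w x) (gauss_map (w x) b)))
          * r (x + gauss_map (w x) b)) \<partial>lborel)"
      unfolding K_def by (rule nn_integral_gauss_map[OF w]) measurable
    finally show "(\<integral>\<^sup>+y. ennreal (pair_kernel \<theta> p w x y) * r (x + y) \<partial>lborel)
      = ennreal (p x) * (\<integral>\<^sup>+b. ennreal (?\<phi> b) *
          (ennreal (K x (gauss_map (w x) b) b) * r (x + gauss_map (w x) b)) \<partial>lborel)"
      by (simp add: gauss_rank_map[OF w])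
  qed
  also have "\<dots> = (\<integral>\<^sup>+a. ennreal (?\<phi> a) * (\<integral>\<^sup>+b. ennreal (?\<phi> b) *
          (ennreal (K (X a) (Y a b) b) * r (S a b)) \<partial>lborel) \<partial>lborel)"
    unfolding S_def Y_def X_def K_def by (rule nn_integral_gauss_map[OF p]) measurable
  also have "\<dots> = (\<integral>\<^sup>+a. \<integral>\<^sup>+b. ennreal (?\<phi> a * ?\<phi> b * K (X a) (Y a b) b) * r (S a b) \<partial>lborel \<partial>lborel)"
    unfolding K_def by (subst nn_integral_cmult[symmetric]) (auto simp: ennreal_mult mult.assoc)
  also have "\<dots> \<le> (\<integral>\<^sup>+a. \<integral>\<^sup>+b. ennreal (?\<phi> (l * b - m * a)) * (r (S a b) * L a b) \<partial>lborel \<partial>lborel)"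
  proof (rule nn_integral_mono_AE)
    show "AE a in lborel. (\<integral>\<^sup>+b. ennreal (?\<phi> a * ?\<phi> b * K (X a) (Y a b) b) * r (S a b) \<partial>lborel)
      \<le> (\<integral>\<^sup>+b. ennreal (?\<phi> (l * b - m * a)) * (r (S a b) * L a b) \<partial>lborel)"
      using AE_density_le_gauss_map_quotient[OF p lm(1)]
    proof eventually_elim
      case (elim a)
      note qX = this
      show ?case
      proof (rule nn_integral_mono_AE)
        show "AE b in lborel. ennreal (?\<phi> a * ?\<phi> b * K (X a) (Y a b) b) * r (S a b)
          \<le> ennreal (?\<phi> (l * b - m * a)) * (r (S a b) * L a b)"
          \<comment> \<open>The exceptional set of b depends on a, through the conditional density
            at \<open>X a\<close>. This is harmless, because b is the inner variable of
            integration.\<close>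
          using AE_density_le_gauss_map_quotient[OF w[of "X a"] lm(2)]
        proof eventually_elim
          case (elim b)
          define u v where "u = ?\<phi> a / p (X a)" and "v = ?\<phi> b / w (X a) (Y a b)"
          have uv: "0 < u" "0 < v" using pp ww by (auto simp: u_def v_def normal_density_pos)
          have "?\<phi> a * ?\<phi> b * K (X a) (Y a b) b \<le> ?\<phi> (l * b - m * a) * (l * u + m * v)"
            using gauss_rotation_bound[OF \<theta> pp ww, of a b "X a" "X a" "Y a b"]
            unfolding K_def l_def m_def u_def v_def by (simp add: X_def gauss_rank_map[OF p])
          then have "ennreal (?\<phi> a * ?\<phi> b * K (X a) (Y a b) b)
              \<le> ennreal (?\<phi> (l * b - m * a)) * ennreal (l * u + m * v)"
            using lm uv by (subst ennreal_mult[symmetric]) (auto intro!: ennreal_leI)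
          also have "ennreal (l * u + m * v) \<le> L a b"
            unfolding L_def
          proof (subst le_Liminf_iff, intro allI impI)
            fix y assume y: "y < ennreal (l * u + m * v)"
            define c where "c = l * u + m * v"
            have c: "0 < c" using lm uv by (simp add: c_def add_pos_pos)
            obtain y' where y': "y = ennreal y'" "0 \<le> y'" "y' < c"
              using y by (cases y) (auto simp: ennreal_less_iff c_def)
            \<comment> \<open>The midpoint of y' / c and 1: the common factor \<open>q\<close>
              lowers both derivatives strictly, as the quotient bounds demand, and keeps the
              combined slope \<open>q * c\<close> above y'.\<close>
            define q where "q = (1 + y' / c) / 2"
            have q: "0 \<le> q" "q < 1" "y' < q * c" using y' c by (auto simp: q_def field_simps)
            have "q * u < u" "q * v < v" using q uv by auto
            then have "\<forall>\<^sub>F n in sequentially. q * u * (l / real (Suc n)) \<le> X (a + l / real (Suc n)) - X a"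
              "\<forall>\<^sub>F n in sequentially. q * v * (m / real (Suc n)) \<le> Y a (b + m / real (Suc n)) - Y a b"
              using qX[rule_format, of "q * u"] elim[rule_format, of "q * v"] q uv
              unfolding X_def[symmetric] Y_def[symmetric] u_def[symmetric] v_def[symmetric] by simp_all
            then show "\<forall>\<^sub>F n in sequentially. y < ennreal (real (Suc n) *
                (S (a + l / real (Suc n)) (b + m / real (Suc n)) - S a b))"
            proof eventually_elim
              case (elim n)
              \<comment> \<open>The diagonal increment of \<open>Y\<close> is compared with the
                increment in b alone. The dependence on a enters only through monotonicity;
                \<open>Y\<close> is never differentiated in a.\<close>
              have "Y a (b + m / real (Suc n)) \<le> Y (a + l / real (Suc n)) (b + m / real (Suc n))"
                using lm by (intro Y_mono) auto
              then have "q * u * (l / real (Suc n)) + q * v * (m / real (Suc n))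
                  \<le> S (a + l / real (Suc n)) (b + m / real (Suc n)) - S a b"
                using elim unfolding S_def by linarith
              then have "real (Suc n) * (q * u * (l / real (Suc n)) + q * v * (m / real (Suc n)))
                  \<le> real (Suc n) * (S (a + l / real (Suc n)) (b + m / real (Suc n)) - S a b)"
                by (intro mult_left_mono) auto
              also have "real (Suc n) * (q * u * (l / real (Suc n)) + q * v * (m / real (Suc n))) = q * c"
                by (simp add: c_def field_simps del: of_nat_Suc)
              finally show ?case using q y' by (simp add: ennreal_less_iff del: of_nat_Suc)
            qed
          qed
          finally have "ennreal (?\<phi> a * ?\<phi> b * K (X a) (Y a b) b)
              \<le> ennreal (?\<phi> (l * b - m * a)) * L a b" by (simp add: mult_left_mono)
          then show ?case by (metis mult.assoc mult.commute mult_right_mono zero_le)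
        qed
      qed
    qed
  qed
  also have "\<dots> = (\<integral>\<^sup>+u. \<integral>\<^sup>+t. ennreal (?\<phi> (l * (m * t + l * u) - m * (l * t - m * u))) *
      (r (S (l * t - m * u) (m * t + l * u)) * L (l * t - m * u) (m * t + l * u)) \<partial>lborel \<partial>lborel)"
    by (rule nn_integral_rotate[OF _ lm]) measurable
  also have "\<dots> \<le> (\<integral>\<^sup>+u. ennreal (?\<phi> u) * (\<integral>\<^sup>+s. r s \<partial>lborel) \<partial>lborel)"
  proof (rule nn_integral_mono)
    fix u
    define s where "s t = S (l * t - m * u) (m * t + l * u)" for t
    \<comment> \<open>Since \<open>l\<close> and \<open>m\<close> are positive, both a and b
      increase with t at fixed u.\<close>
    have "mono s"
      unfolding s_def S_def using lm by (auto intro!: monoI add_mono X_mono Y_mono)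
    note subst = nn_integral_mono_substitution_le[OF this rm]
    have Ls: "L (l * t - m * u) (m * t + l * u)
       = liminf (\<lambda>n. ennreal (real (Suc n) * (s (t + 1 / real (Suc n)) - s t)))" for t
    proof -
      have "l * t - m * u + l / real (Suc n) = l * (t + 1 / real (Suc n)) - m * u"
        "m * t + l * u + m / real (Suc n) = m * (t + 1 / real (Suc n)) + l * u" for n
        by (simp_all add: algebra_simps)
      then show ?thesis unfolding L_def s_def by (simp only:)
    qed
    have "l * (m * t + l * u) - m * (l * t - m * u) = (l\<^sup>2 + m\<^sup>2) * u" for t
      by (simp add: algebra_simps power2_eq_square)
    then have "(\<integral>\<^sup>+t. ennreal (?\<phi> (l * (m * t + l * u) - m * (l * t - m * u))) *
      (r (S (l * t - m * u) (m * t + l * u)) * L (l * t - m * u) (m * t + l * u)) \<partial>lborel)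
      = (\<integral>\<^sup>+t. ennreal (?\<phi> u) * (r (S (l * t - m * u) (m * t + l * u)) * L (l * t - m * u) (m * t + l * u)) \<partial>lborel)"
      using lm by simp
    also have "\<dots> = ennreal (?\<phi> u) * (\<integral>\<^sup>+t. r (S (l * t - m * u) (m * t + l * u)) * L (l * t - m * u) (m * t + l * u) \<partial>lborel)"
      by (rule nn_integral_cmult) measurable
    also have "\<dots> \<le> ennreal (?\<phi> u) * (\<integral>\<^sup>+s. r s \<partial>lborel)"
      using subst by (intro mult_left_mono) (simp_all add: Ls s_def[symmetric])
    finally show "(\<integral>\<^sup>+t. ennreal (?\<phi> (l * (m * t + l * u) - m * (l * t - m * u))) *
      (r (S (l * t - m * u) (m * t + l * u)) * L (l * t - m * u) (m * t + l * u)) \<partial>lborel)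
      \<le> ennreal (?\<phi> u) * (\<integral>\<^sup>+s. r s \<partial>lborel)" .
  qed
  also have "\<dots> = (\<integral>\<^sup>+s. r s \<partial>lborel)"
    by (subst nn_integral_multc) (simp_all add: positive_density_integral[OF positive_density_std_normal])
  finally show ?thesis .
qed

end

section \<open>Marginals of log-supermodular functions\<close>

text \<open>The product of two marginals is a double integral over t and t', which is symmetrised
  under the exchange of t and t'. The symmetrised integrands can be compared pointwise. The
  sublattice \<open>E\<close> is there because positivity and log-supermodularity will be known only
  on extensional functions.\<close>

lemma marginal_log_supermodular:
  fixes u :: "'l::lattice \<Rightarrow> real \<Rightarrow> real"
  assumes E: "\<And>z z'. z \<in> E \<Longrightarrow> z' \<in> E \<Longrightarrow> inf z z' \<in> E" "\<And>z z'. z \<in> E \<Longrightarrow> z' \<in> E \<Longrightarrow> sup z z' \<in> E"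
    and pos: "\<And>z t. z \<in> E \<Longrightarrow> 0 < u z t"
    and lsm: "\<And>z z' t t'. z \<in> E \<Longrightarrow> z' \<in> E \<Longrightarrow> u z t * u z' t' \<le> u (inf z z') (min t t') * u (sup z z') (max t t')"
    and int: "\<And>z. z \<in> E \<Longrightarrow> integrable lborel (u z)"
    and z: "z \<in> E" "z' \<in> E"
  shows "(\<integral>t. u z t \<partial>lborel) * (\<integral>t. u z' t \<partial>lborel) \<le> (\<integral>t. u (inf z z') t \<partial>lborel) * (\<integral>t. u (sup z z') t \<partial>lborel)"
proof -
  let ?i = "inf z z'" and ?s = "sup z z'"
  have in_E: "?i \<in> E" "?s \<in> E" using E z by auto
  define A where "A a b = (\<lambda>t t'. u a t * u b t')" for a b
  have four: "u z t * u z' t' + u z t' * u z' t \<le> u ?i t * u ?s t' + u ?i t' * u ?s t" for t t'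
  proof -
    \<comment> \<open>The elementary step behind four-function inequalities. The role of c falls to
      the product in which the infimum takes the smaller and the supremum the larger of t and t': it
      dominates both products on the left.\<close>
    have *: "a + b \<le> c + d" if "a \<le> c" "b \<le> c" "a * b \<le> c * d" "0 < c" for a b c d :: real
    proof -
      have "0 \<le> (c - a) * (c - b)" using that by simp
      then have "c * (a + b) \<le> c * (c + d)" using that(3) by (simp add: algebra_simps)
      then show ?thesis using that(4) by simp
    qed
    have prod: "(u z t * u z' t') * (u z t' * u z' t) \<le> (u ?i t * u ?s t') * (u ?i t' * u ?s t)"
    proof -
      have "(u z t * u z' t) * (u z t' * u z' t') \<le> (u ?i t * u ?s t) * (u ?i t' * u ?s t')"
        by (rule mult_mono[OF lsm[OF z, of t t, unfolded min.idem max.idem] lsm[OF z, of t' t', unfolded min.idem max.idem]])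
           (use pos[OF z(1)] pos[OF z(2)] pos[OF in_E(1)] pos[OF in_E(2)] in \<open>simp_all add: less_imp_le\<close>)
      then show ?thesis by (simp add: ac_simps)
    qed
    have p: "0 < u ?i s * u ?s s'" for s s'
      using pos[OF in_E(1)] pos[OF in_E(2)] by simp
    consider "t \<le> t'" | "t' \<le> t" by linarith
    then show ?thesis
    proof cases
      case 1
      then have "u z t * u z' t' \<le> u ?i t * u ?s t'" "u z t' * u z' t \<le> u ?i t * u ?s t'"
        using lsm[OF z, of t t'] lsm[OF z, of t' t] by (simp_all add: min_def max_def split: if_splits)
      then show ?thesis using prod p by (rule *)
    next
      case 2
      then have "u z t * u z' t' \<le> u ?i t' * u ?s t" "u z t' * u z' t \<le> u ?i t' * u ?s t"
        using lsm[OF z, of t t'] lsm[OF z, of t' t] by (simp_all add: min_def max_def split: if_splits)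
      moreover have "(u z t * u z' t') * (u z t' * u z' t) \<le> (u ?i t' * u ?s t) * (u ?i t * u ?s t')"
        using prod by (simp only: mult.commute)
      ultimately have "u z t * u z' t' + u z t' * u z' t \<le> u ?i t' * u ?s t + u ?i t * u ?s t'"
        using p by (rule *)
      then show ?thesis by simp
    qed
  qed
  have sym: "(\<integral>\<^sup>+t. \<integral>\<^sup>+t'. ennreal (u a t * u b t' + u a t' * u b t) \<partial>lborel \<partial>lborel)
      = ennreal (2 * ((\<integral>t. u a t \<partial>lborel) * (\<integral>t. u b t \<partial>lborel)))" if ab: "a \<in> E" "b \<in> E" for a b
  proof -
    have [measurable]: "u a \<in> borel_measurable borel" "u b \<in> borel_measurable borel"
      using int[OF ab(1)] int[OF ab(2)] by auto
    have [simp]: "0 \<le> u a t" "0 \<le> u b t" for t using pos ab by (auto simp: less_imp_le)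
    have eq: "(\<integral>\<^sup>+t. ennreal (u a t) \<partial>lborel) = ennreal (\<integral>t. u a t \<partial>lborel)"
      "(\<integral>\<^sup>+t. ennreal (u b t) \<partial>lborel) = ennreal (\<integral>t. u b t \<partial>lborel)"
      using int ab by (auto intro!: nn_integral_eq_integral)
    have "(\<integral>\<^sup>+t. \<integral>\<^sup>+t'. ennreal (u a t * u b t' + u a t' * u b t) \<partial>lborel \<partial>lborel)
      = (\<integral>\<^sup>+t. (ennreal (u a t) * ennreal (\<integral>t. u b t \<partial>lborel) + ennreal (u b t) * ennreal (\<integral>t. u a t \<partial>lborel)) \<partial>lborel)"
    proof (rule nn_integral_cong)
      fix t
      have "(\<integral>\<^sup>+t'. ennreal (u a t * u b t' + u a t' * u b t) \<partial>lborel)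
        = (\<integral>\<^sup>+t'. ennreal (u a t) * ennreal (u b t') + ennreal (u b t) * ennreal (u a t') \<partial>lborel)"
        by (intro nn_integral_cong) (simp add: ennreal_mult mult.commute)
      then show "(\<integral>\<^sup>+t'. ennreal (u a t * u b t' + u a t' * u b t) \<partial>lborel)
        = ennreal (u a t) * ennreal (\<integral>t. u b t \<partial>lborel) + ennreal (u b t) * ennreal (\<integral>t. u a t \<partial>lborel)"
        by (simp add: nn_integral_add nn_integral_cmult eq)
    qed
    also have "\<dots> = ennreal (\<integral>t. u a t \<partial>lborel) * ennreal (\<integral>t. u b t \<partial>lborel)
        + ennreal (\<integral>t. u b t \<partial>lborel) * ennreal (\<integral>t. u a t \<partial>lborel)"
      by (simp add: nn_integral_add nn_integral_multc eq)
    also have "\<dots> = ennreal (2 * ((\<integral>t. u a t \<partial>lborel) * (\<integral>t. u b t \<partial>lborel)))"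
    proof -
      have "0 \<le> (\<integral>t. u a t \<partial>lborel)" "0 \<le> (\<integral>t. u b t \<partial>lborel)" by simp_all
      then show ?thesis
        by (simp add: ennreal_mult[symmetric] ennreal_plus[symmetric] mult.commute del: ennreal_plus)
    qed
    finally show ?thesis .
  qed
  have "(\<integral>\<^sup>+t. \<integral>\<^sup>+t'. ennreal (u z t * u z' t' + u z t' * u z' t) \<partial>lborel \<partial>lborel)
     \<le> (\<integral>\<^sup>+t. \<integral>\<^sup>+t'. ennreal (u ?i t * u ?s t' + u ?i t' * u ?s t) \<partial>lborel \<partial>lborel)"
    by (intro nn_integral_mono ennreal_leI four)
  then have "ennreal (2 * ((\<integral>t. u z t \<partial>lborel) * (\<integral>t. u z' t \<partial>lborel)))
      \<le> ennreal (2 * ((\<integral>t. u ?i t \<partial>lborel) * (\<integral>t. u ?s t \<partial>lborel)))"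
    by (simp only: sym[OF z] sym[OF in_E])
  moreover have "0 \<le> (\<integral>t. u ?i t \<partial>lborel) * (\<integral>t. u ?s t \<partial>lborel)"
    using pos in_E by (intro mult_nonneg_nonneg integral_nonneg_AE) (auto simp: less_imp_le)
  ultimately show ?thesis by (simp add: ennreal_le_iff)
qed

text \<open>Sections of an integrable function are in general integrable only almost everywhere;
  for a positive log-supermodular function a section is dominated by one below and one above.\<close>

lemma section_integrable:
  fixes u :: "'l::lattice \<Rightarrow> real \<Rightarrow> real"
  assumes pos: "\<And>z t. z \<in> E \<Longrightarrow> 0 < u z t"
    and lsm: "\<And>z z' t t'. z \<in> E \<Longrightarrow> z' \<in> E \<Longrightarrow> u z t * u z' t' \<le> u (inf z z') (min t t') * u (sup z z') (max t t')"
    and z: "z \<in> E" "z1 \<in> E" "z2 \<in> E" "z1 \<le> z" "z \<le> z2"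
    and int: "integrable lborel (u z1)" "integrable lborel (u z2)"
    and meas: "u z \<in> borel_measurable borel"
  shows "integrable lborel (u z)"
proof (rule Bochner_Integration.integrable_bound)
  show "integrable lborel (\<lambda>t. u z 0 / u z1 0 * u z1 t + u z 0 / u z2 0 * u z2 t)"
    using int by auto
  show "AE t in lborel. norm (u z t) \<le> norm (u z 0 / u z1 0 * u z1 t + u z 0 / u z2 0 * u z2 t)"
  proof (rule AE_I2)
    fix t :: real
    have p: "0 < u z s" "0 < u z1 s" "0 < u z2 s" for s using pos z by auto
    \<comment> \<open>Log-supermodularity is applied against the reference point 0: to its left the
      ratio to the lower section is at most its value at 0, to its right the ratio to the upper
      section is.\<close>
    have "u z t \<le> u z 0 / u z1 0 * u z1 t + u z 0 / u z2 0 * u z2 t"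
    proof (cases "t \<le> 0")
      case True
      have "u z1 0 * u z t \<le> u z1 t * u z 0"
        using lsm[OF z(2,1), of 0 t] z True by (simp add: inf_absorb1 sup_absorb2 min.absorb2 max.absorb1)
      then have "u z t \<le> u z 0 / u z1 0 * u z1 t" using p by (simp add: field_simps)
      moreover have "0 \<le> u z 0 / u z2 0 * u z2 t" using p by (simp add: less_imp_le)
      ultimately show ?thesis by linarith
    next
      case False
      have "u z2 0 * u z t \<le> u z 0 * u z2 t"
        using lsm[OF z(3,1), of 0 t] z False by (simp add: inf_absorb2 sup_absorb1 min.absorb1 max.absorb2)
      then have "u z t \<le> u z 0 / u z2 0 * u z2 t" using p by (simp add: field_simps)
      moreover have "0 \<le> u z 0 / u z1 0 * u z1 t" using p by (simp add: less_imp_le)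
      ultimately show ?thesis by linarith
    qed
    moreover have "0 \<le> u z t" using p by (simp add: less_imp_le)
    ultimately show "norm (u z t) \<le> norm (u z 0 / u z1 0 * u z1 t + u z 0 / u z2 0 * u z2 t)" by simp
  qed
qed (use meas in simp)

lemma integral_pos_of_pos:
  fixes h :: "real \<Rightarrow> real"
  assumes "integrable lborel h" "\<And>x. 0 < h x"
  shows "0 < (\<integral>x. h x \<partial>lborel)"
proof -
  have "0 \<le> (\<integral>x. h x \<partial>lborel)" using assms by (intro integral_nonneg_AE) (auto simp: less_imp_le)
  moreover have "(\<integral>x. h x \<partial>lborel) \<noteq> 0"
  proof
    assume "(\<integral>x. h x \<partial>lborel) = 0"
    then have "AE x in lborel. h x = 0"
      using assms by (subst (asm) integral_nonneg_eq_0_iff_AE) (auto simp: less_imp_le)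
    then have "AE x in (lborel::real measure). False"
      by eventually_elim (use assms(2) in \<open>metis less_irrefl\<close>)
    then show False by (simp add: AE_iff_null null_sets_def)
  qed
  ultimately show ?thesis by simp
qed

lemma positive_density_normalize:
  assumes int: "integrable lborel h" and pos: "\<And>x. 0 < h x"
  shows "positive_density (\<lambda>x. h x / (\<integral>t. h t \<partial>lborel))"
proof -
  have I: "0 < (\<integral>t. h t \<partial>lborel)" by (rule integral_pos_of_pos[OF int pos])
  have "(\<integral>\<^sup>+x. ennreal (h x / (\<integral>t. h t \<partial>lborel)) \<partial>lborel) = ennreal (\<integral>x. h x / (\<integral>t. h t \<partial>lborel) \<partial>lborel)"
    using int pos I by (intro nn_integral_eq_integral) (auto simp: less_imp_le)
  then show ?thesis
    using int pos I by (auto simp: positive_density_def)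
qed

text \<open>Monotone likelihood ratio implies stochastic order: integrating \<open>lr\<close> over s
  \<le> y < t gives \<open>le\<close>, in which the product of the two distribution functions
  cancels.\<close>

lemma density_cdf_antimono_of_lsm:
  assumes h: "positive_density h" and k: "positive_density k"
    and lr: "\<And>s t. s \<le> t \<Longrightarrow> k s * h t \<le> h s * k t"
  shows "density_cdf k y \<le> density_cdf h y"
proof -
  have le: "(1 - density_cdf h y) * density_cdf k y \<le> (1 - density_cdf k y) * density_cdf h y"
  proof -
    note [measurable] = positive_density_measurable[OF h] positive_density_measurable[OF k]
    have compl: "ennreal (1 - density_cdf g y) = (\<integral>\<^sup>+t. ennreal (g t) * indicator {y<..} t \<partial>lborel)"
      if g: "positive_density g" for g
    proof -
      note [measurable] = positive_density_measurable[OF g]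
      have "(\<integral>\<^sup>+t. ennreal (g t) * indicator {y<..} t \<partial>lborel) + ennreal (density_cdf g y)
        = (\<integral>\<^sup>+t. ennreal (g t) \<partial>lborel)"
        unfolding ennreal_density_cdf[OF g]
        by (subst nn_integral_add[symmetric]) (auto intro!: nn_integral_cong simp: indicator_def)
      also have "\<dots> = ennreal (1 - density_cdf g y) + ennreal (density_cdf g y)"
        using density_cdf_pos[OF g, of y] density_cdf_less_1[OF g, of y]
        by (simp add: positive_density_integral[OF g] ennreal_plus[symmetric] del: ennreal_plus)
      finally show ?thesis by (simp add: add.commute[of _ "ennreal (density_cdf g y)"] ennreal_add_left_cancel)
    qed
    have prod: "ennreal ((1 - density_cdf g y) * density_cdf g' y)
       = (\<integral>\<^sup>+t. \<integral>\<^sup>+s. ennreal (g t * g' s) * (indicator {y<..} t * indicator {..y} s) \<partial>lborel \<partial>lborel)"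
      if g: "positive_density g" "positive_density g'" for g g'
    proof -
      note [measurable] = positive_density_measurable[OF g(1)] positive_density_measurable[OF g(2)]
      have "ennreal ((1 - density_cdf g y) * density_cdf g' y) = ennreal (1 - density_cdf g y) * ennreal (density_cdf g' y)"
        using density_cdf_pos[OF g(2), of y] density_cdf_less_1[OF g(1), of y] by (simp add: ennreal_mult)
      also have "\<dots> = (\<integral>\<^sup>+t. \<integral>\<^sup>+s. (ennreal (g t) * indicator {y<..} t) * (ennreal (g' s) * indicator {..y} s) \<partial>lborel \<partial>lborel)"
        unfolding compl[OF g(1)] ennreal_density_cdf[OF g(2)]
        by (subst nn_integral_multc[symmetric], simp, intro nn_integral_cong) (simp add: nn_integral_cmult)
      also have "\<dots> = (\<integral>\<^sup>+t. \<integral>\<^sup>+s. ennreal (g t * g' s) * (indicator {y<..} t * indicator {..y} s) \<partial>lborel \<partial>lborel)"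
        using positive_density_pos[OF g(1)] positive_density_pos[OF g(2)]
        by (intro nn_integral_cong) (simp add: ennreal_mult less_imp_le ac_simps)
      finally show ?thesis .
    qed
    have "ennreal ((1 - density_cdf h y) * density_cdf k y) \<le> ennreal ((1 - density_cdf k y) * density_cdf h y)"
      unfolding prod[OF h k] prod[OF k h]
      by (intro nn_integral_mono) (use lr in \<open>auto simp: indicator_def mult.commute intro!: ennreal_leI\<close>)
    then show ?thesis
      using density_cdf_pos[OF h, of y] density_cdf_less_1[OF k, of y]
      by (subst (asm) ennreal_le_iff) auto
  qed
  then show ?thesis by (simp add: algebra_simps)
qed

section \<open>Iteration over pairs of coordinates\<close>

lemma nn_integral_abs_gauss_rank:
  assumes h: "positive_density h"
  shows "(\<integral>\<^sup>+y. ennreal (h y) * ennreal \<bar>gauss_rank h y\<bar> \<partial>lborel)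
       = (\<integral>\<^sup>+b. ennreal (std_normal_density b) * ennreal \<bar>b\<bar> \<partial>lborel)"
  using borel_measurable_gauss_rank[OF h]
  by (subst nn_integral_gauss_map[OF h]) (simp_all add: gauss_rank_map[OF h])

lemma integral_gauss_rank:
  assumes h: "positive_density h"
  shows "(\<integral>y. h y * gauss_rank h y \<partial>lborel) = 0"
proof -
  note [measurable] = borel_measurable_gauss_rank[OF h] positive_density_measurable[OF h]
    positive_density_measurable[OF positive_density_std_normal]
  have "(\<integral>y. h y * gauss_rank h y \<partial>lborel) = (\<integral>y. gauss_rank h y \<partial>density lborel h)"
    using positive_density_pos[OF h] by (subst integral_density) (auto simp: less_imp_le)
  also have "\<dots> = (\<integral>b. b \<partial>distr (density lborel h) borel (gauss_rank h))"
    by (subst integral_distr) auto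
  also have "\<dots> = (\<integral>b. std_normal_density b * b \<partial>lborel)"
    unfolding distr_gauss_rank[OF h] by (subst integral_density) auto
  also have "\<dots> = 0"
    using std_normal_moment_odd[of 0] by (simp add: has_bochner_integral_integral_eq)
  finally show ?thesis .
qed

lemma std_normal_abs_moment_finite:
  "(\<integral>\<^sup>+b. ennreal (std_normal_density b) * ennreal \<bar>b\<bar> \<partial>lborel) < \<infinity>"
proof -
  have "integrable lborel (\<lambda>b. std_normal_density b * \<bar>b\<bar> ^ (2 * 0 + 1))"
    using std_normal_moment_abs_odd[of 0] by (simp add: has_bochner_integral_iff)
  then have "(\<integral>\<^sup>+b. ennreal (norm (std_normal_density b * \<bar>b\<bar> ^ (2 * 0 + 1))) \<partial>lborel) < \<infinity>"
    by (simp only: integrable_iff_bounded)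
  then show ?thesis by (simp add: ennreal_mult abs_mult)
qed

context
  fixes p :: "real \<Rightarrow> real" and w :: "real \<Rightarrow> real \<Rightarrow> real"
  assumes p: "positive_density p" and w: "\<And>x. positive_density (w x)"
    and wm: "(\<lambda>(x, y). w x y) \<in> borel_measurable (borel \<Otimes>\<^sub>M borel)"
begin

text \<open>Given x, the second rank is standard Gaussian whatever x is, so the two ranks are
  independent. The value is the same for all \<open>p\<close> and \<open>w\<close>; this uniformity
  keeps the new term integrable after integration over the previous pairs.\<close>

lemma nn_integral_pair_abs_rank:
  "(\<integral>\<^sup>+q. ennreal (p (fst q) * w (fst q) (snd q) * \<bar>gauss_rank p (fst q) * gauss_rank (w (fst q)) (snd q)\<bar>) \<partial>lborel)
   = (\<integral>\<^sup>+b. ennreal (std_normal_density b) * ennreal \<bar>b\<bar> \<partial>lborel)\<^sup>2"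
proof -
  note [measurable] = positive_density_measurable[OF p] wm borel_measurable_gauss_rank[OF p]
    positive_density_measurable[OF w] borel_measurable_gauss_rank[OF w]
  have [measurable]: "(\<lambda>(x, y). gauss_rank (w x) y) \<in> borel_measurable (borel \<Otimes>\<^sub>M borel)"
    by (rule measurable_gauss_rank_pair) (use w wm in auto)
  have n: "0 \<le> p x" "0 \<le> w x y" for x y
    using positive_density_pos[OF p, of x] positive_density_pos[OF w, of x y] by auto
  let ?c = "\<integral>\<^sup>+b. ennreal (std_normal_density b) * ennreal \<bar>b\<bar> \<partial>lborel"
  have "(\<integral>\<^sup>+q. ennreal (p (fst q) * w (fst q) (snd q) * \<bar>gauss_rank p (fst q) * gauss_rank (w (fst q)) (snd q)\<bar>) \<partial>lborel)
    = (\<integral>\<^sup>+q. ennreal (p (fst q) * w (fst q) (snd q) * \<bar>gauss_rank p (fst q) * gauss_rank (w (fst q)) (snd q)\<bar>) \<partial>(lborel \<Otimes>\<^sub>M lborel))"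
    by (simp only: lborel_prod)
  also have "\<dots> = (\<integral>\<^sup>+x. \<integral>\<^sup>+y. ennreal (p x * w x y * \<bar>gauss_rank p x * gauss_rank (w x) y\<bar>) \<partial>lborel \<partial>lborel)"
    by (subst lborel.nn_integral_fst[symmetric]) simp_all
  also have "\<dots> = (\<integral>\<^sup>+x. ennreal (p x) * ennreal \<bar>gauss_rank p x\<bar> * ?c \<partial>lborel)"
  proof (rule nn_integral_cong)
    fix x
    have "(\<integral>\<^sup>+y. ennreal (p x * w x y * \<bar>gauss_rank p x * gauss_rank (w x) y\<bar>) \<partial>lborel)
      = (\<integral>\<^sup>+y. (ennreal (p x) * ennreal \<bar>gauss_rank p x\<bar>) * (ennreal (w x y) * ennreal \<bar>gauss_rank (w x) y\<bar>) \<partial>lborel)"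
      using n by (intro nn_integral_cong) (simp add: ennreal_mult[symmetric] abs_mult ac_simps)
    then show "(\<integral>\<^sup>+y. ennreal (p x * w x y * \<bar>gauss_rank p x * gauss_rank (w x) y\<bar>) \<partial>lborel)
      = ennreal (p x) * ennreal \<bar>gauss_rank p x\<bar> * ?c"
      by (simp add: nn_integral_cmult nn_integral_abs_gauss_rank[OF w])
  qed
  also have "\<dots> = ?c\<^sup>2"
    by (simp add: nn_integral_multc nn_integral_abs_gauss_rank[OF p] power2_eq_square)
  finally show ?thesis .
qed

text \<open>Integrating over y first suffices for the mean: conditionally on x the second rank is
  centred.\<close>

lemma pair_rank_product:
  shows "integrable lborel (\<lambda>q. p (fst q) * w (fst q) (snd q) * (gauss_rank p (fst q) * gauss_rank (w (fst q)) (snd q)))"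
    (is ?I)
    and "(\<integral>q. p (fst q) * w (fst q) (snd q) * (gauss_rank p (fst q) * gauss_rank (w (fst q)) (snd q)) \<partial>lborel) = 0"
proof -
  note [measurable] = positive_density_measurable[OF p] wm borel_measurable_gauss_rank[OF p]
    positive_density_measurable[OF w] borel_measurable_gauss_rank[OF w]
  have [measurable]: "(\<lambda>(x, y). gauss_rank (w x) y) \<in> borel_measurable (borel \<Otimes>\<^sub>M borel)"
    by (rule measurable_gauss_rank_pair) (use w wm in auto)
  have n: "0 \<le> p x" "0 \<le> w x y" for x y
    using positive_density_pos[OF p, of x] positive_density_pos[OF w, of x y] by auto
  let ?f = "\<lambda>q. p (fst q) * w (fst q) (snd q) * (gauss_rank p (fst q) * gauss_rank (w (fst q)) (snd q))"
  have fm: "?f \<in> borel_measurable (lborel \<Otimes>\<^sub>M lborel)" by measurable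
  show I: ?I
  proof (rule integrableI_bounded)
    show "?f \<in> borel_measurable lborel" using fm by (simp only: lborel_prod)
    have "(\<integral>\<^sup>+q. ennreal (norm (?f q)) \<partial>lborel)
      = (\<integral>\<^sup>+q. ennreal (p (fst q) * w (fst q) (snd q) * \<bar>gauss_rank p (fst q) * gauss_rank (w (fst q)) (snd q)\<bar>) \<partial>lborel)"
      using n by (intro nn_integral_cong) (simp add: abs_mult)
    also have "\<dots> < \<infinity>"
      unfolding nn_integral_pair_abs_rank using std_normal_abs_moment_finite
      by (simp add: power2_eq_square ennreal_mult_less_top)
    finally show "(\<integral>\<^sup>+q. ennreal (norm (?f q)) \<partial>lborel) < \<infinity>" .
  qed
  have "(\<integral>q. ?f q \<partial>lborel) = (\<integral>q. ?f q \<partial>(lborel \<Otimes>\<^sub>M lborel))"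
    by (simp only: lborel_prod)
  also have "\<dots> = (\<integral>x. \<integral>y. ?f (x, y) \<partial>lborel \<partial>lborel)"
    by (rule lborel_pair.integral_fst'[symmetric]) (use I in \<open>simp only: lborel_prod\<close>)
  also have "\<dots> = (\<integral>x. p x * gauss_rank p x * (\<integral>y. w x y * gauss_rank (w x) y \<partial>lborel) \<partial>lborel)"
    by (intro Bochner_Integration.integral_cong refl, subst integral_mult_right_zero[symmetric])
       (auto simp: ac_simps)
  also have "\<dots> = 0" by (simp add: integral_gauss_rank[OF w])
  finally show "(\<integral>q. ?f q \<partial>lborel) = 0" .
qed

end

lemma nn_integral_lborel_pair:
  assumes [measurable]: "F \<in> borel_measurable (borel \<Otimes>\<^sub>M borel)"
  shows "(\<integral>\<^sup>+q. F q \<partial>(lborel :: (real \<times> real) measure)) = (\<integral>\<^sup>+x. \<integral>\<^sup>+y. F (x, y) \<partial>lborel \<partial>lborel)"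
  by (subst lborel_prod[symmetric], subst lborel.nn_integral_fst[symmetric]) simp_all

section \<open>Integration over finite families of pairs, and multiplication of kernel
  bounds\<close>

abbreviation PM :: "nat \<Rightarrow> (nat \<Rightarrow> real \<times> real) measure" where
  "PM n \<equiv> PiM {..<n} (\<lambda>_. lborel)"

interpretation PS: product_sigma_finite "\<lambda>_::nat. lborel :: 'a::euclidean_space measure"
  by standard

lemma nn_integral_PiM_Suc:
  fixes F :: "(nat \<Rightarrow> 'a::euclidean_space) \<Rightarrow> ennreal"
  assumes "F \<in> borel_measurable (PiM {..<Suc n} (\<lambda>_. lborel))"
  shows "(\<integral>\<^sup>+\<omega>. F \<omega> \<partial>PiM {..<Suc n} (\<lambda>_. lborel))
       = (\<integral>\<^sup>+z. \<integral>\<^sup>+q. F (z(n := q)) \<partial>lborel \<partial>PiM {..<n} (\<lambda>_. lborel))"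
  using PS.product_nn_integral_insert[of "{..<n}" n F] assms by (simp add: lessThan_Suc)

lemma measurable_upd_PiM:
  "(\<lambda>(z, q). z(n := q)) \<in> measurable (PiM {..<n} (\<lambda>_. lborel) \<Otimes>\<^sub>M borel) (PiM {..<Suc n} (\<lambda>_. lborel :: 'a::euclidean_space measure))"
  using measurable_add_dim[of n "{..<n}" "\<lambda>_. lborel :: 'a measure"] by (simp add: lessThan_Suc)

lemma measurable_comp_PiM:
  fixes \<pi> :: "real \<times> real \<Rightarrow> real"
  assumes [measurable]: "\<pi> \<in> borel_measurable borel"
  shows "(\<lambda>z. \<lambda>i\<in>{..<n}. \<pi> (z i)) \<in> measurable (PM n) (PiM {..<n} (\<lambda>_. lborel :: real measure))"
  by (intro measurable_restrict) simp

text \<open>The last pair is integrated first, with the past fixed; what remains is the bound for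
  the past, applied to \<open>r\<close> with its last argument integrated out. For this reason the
  bounds are stated against arbitrary test functions. The map \<pi> will be \<open>fst\<close>,
  \<open>snd\<close> or their sum.\<close>

lemma kernel_step:
  fixes V :: "(nat \<Rightarrow> real \<times> real) \<Rightarrow> ennreal" and K :: "(nat \<Rightarrow> real \<times> real) \<Rightarrow> real \<times> real \<Rightarrow> ennreal"
    and \<pi> :: "real \<times> real \<Rightarrow> real"
  assumes Vm [measurable]: "V \<in> borel_measurable (PM n)"
    and Km [measurable]: "(\<lambda>(z, q). K z q) \<in> borel_measurable (PM n \<Otimes>\<^sub>M borel)"
    and \<pi> [measurable]: "\<pi> \<in> borel_measurable borel"
    and IH: "\<And>r :: (nat \<Rightarrow> real) \<Rightarrow> ennreal. r \<in> borel_measurable (PiM {..<n} (\<lambda>_. lborel)) \<Longrightarrow>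
      (\<integral>\<^sup>+z. V z * r (\<lambda>i\<in>{..<n}. \<pi> (z i)) \<partial>PM n) \<le> (\<integral>\<^sup>+s. r s \<partial>PiM {..<n} (\<lambda>_. lborel))"
    and Kle: "\<And>z r. z \<in> space (PM n) \<Longrightarrow> r \<in> borel_measurable borel \<Longrightarrow>
      (\<integral>\<^sup>+q. K z q * r (\<pi> q) \<partial>lborel) \<le> (\<integral>\<^sup>+t. r t \<partial>lborel)"
    and r [measurable]: "r \<in> borel_measurable (PiM {..<Suc n} (\<lambda>_. lborel))"
  shows "(\<integral>\<^sup>+\<omega>. V (restrict \<omega> {..<n}) * K (restrict \<omega> {..<n}) (\<omega> n) * r (\<lambda>i\<in>{..<Suc n}. \<pi> (\<omega> i)) \<partial>PM (Suc n))
    \<le> (\<integral>\<^sup>+s. r s \<partial>PiM {..<Suc n} (\<lambda>_. lborel))"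
proof -
  note [measurable] = measurable_upd_PiM measurable_comp_PiM[OF \<pi>]
  have R [measurable]: "(\<lambda>\<omega>. restrict \<omega> {..<n}) \<in> measurable (PM (Suc n)) (PM n)"
    by (rule measurable_restrict_subset) auto
  have C [measurable]: "(\<lambda>\<omega>. \<omega> n) \<in> measurable (PM (Suc n)) borel"
    using measurable_component_singleton[of n "{..<Suc n}" "\<lambda>_. lborel :: (real \<times> real) measure"] by simp
  let ?\<pi> = "\<lambda>z. \<lambda>i\<in>{..<n}. \<pi> (z i)"
  have [measurable]: "(\<lambda>(s, t). r (s(n := t))) \<in> borel_measurable (PiM {..<n} (\<lambda>_. lborel) \<Otimes>\<^sub>M borel)"
    using measurable_compose[OF measurable_upd_PiM r] by (simp add: split_beta')
  have res: "restrict (z(n := q)) {..<n} = z" if "z \<in> space (PM n)" for z q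
    using that by (auto simp: space_PiM PiE_def extensional_def restrict_def)
  have pi_upd: "(\<lambda>i\<in>{..<Suc n}. \<pi> ((z(n := q)) i)) = (?\<pi> z)(n := \<pi> q)" for z q
    by (auto simp: fun_eq_iff restrict_def less_Suc_eq)
  have "(\<integral>\<^sup>+\<omega>. V (restrict \<omega> {..<n}) * K (restrict \<omega> {..<n}) (\<omega> n) * r (\<lambda>i\<in>{..<Suc n}. \<pi> (\<omega> i)) \<partial>PM (Suc n))
    = (\<integral>\<^sup>+z. \<integral>\<^sup>+q. V (restrict (z(n := q)) {..<n}) * K (restrict (z(n := q)) {..<n}) ((z(n := q)) n)
        * r (\<lambda>i\<in>{..<Suc n}. \<pi> ((z(n := q)) i)) \<partial>lborel \<partial>PM n)"
    by (rule nn_integral_PiM_Suc) measurable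
  also have "\<dots> = (\<integral>\<^sup>+z. V z * (\<integral>\<^sup>+q. K z q * r ((?\<pi> z)(n := \<pi> q)) \<partial>lborel) \<partial>PM n)"
  proof (rule nn_integral_cong)
    fix z assume z: "z \<in> space (PM n)"
    have Kz: "K z \<in> borel_measurable borel"
      using measurable_Pair2[OF Km z] by simp
    have "(\<lambda>t. r ((?\<pi> z)(n := t))) \<in> borel_measurable borel"
      by (rule measurable_Pair2[of "\<lambda>(s, t). r (s(n := t))" "PiM {..<n} (\<lambda>_. lborel)", simplified])
         (auto simp: space_PiM)
    from measurable_compose[OF \<pi> this]
    have rz: "(\<lambda>q. r ((?\<pi> z)(n := \<pi> q))) \<in> borel_measurable borel" .
    show "(\<integral>\<^sup>+q. V (restrict (z(n := q)) {..<n}) * K (restrict (z(n := q)) {..<n}) ((z(n := q)) n)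
        * r (\<lambda>i\<in>{..<Suc n}. \<pi> ((z(n := q)) i)) \<partial>lborel)
      = V z * (\<integral>\<^sup>+q. K z q * r ((?\<pi> z)(n := \<pi> q)) \<partial>lborel)"
      unfolding res[OF z] pi_upd fun_upd_same mult.assoc by (rule nn_integral_cmult) (use borel_measurable_times_ennreal[OF Kz rz] in simp)
  qed
  also have "\<dots> \<le> (\<integral>\<^sup>+z. V z * (\<integral>\<^sup>+t. r ((?\<pi> z)(n := t)) \<partial>lborel) \<partial>PM n)"
  proof (intro nn_integral_mono mult_left_mono)
    fix z assume z: "z \<in> space (PM n)"
    have "(\<lambda>t. r ((?\<pi> z)(n := t))) \<in> borel_measurable borel"
      by (rule measurable_Pair2[of "\<lambda>(s, t). r (s(n := t))" "PiM {..<n} (\<lambda>_. lborel)", simplified])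
         (auto simp: space_PiM)
    from Kle[OF z this] show "(\<integral>\<^sup>+q. K z q * r ((?\<pi> z)(n := \<pi> q)) \<partial>lborel) \<le> (\<integral>\<^sup>+t. r ((?\<pi> z)(n := t)) \<partial>lborel)" .
  qed simp
  also have "\<dots> \<le> (\<integral>\<^sup>+s. \<integral>\<^sup>+t. r (s(n := t)) \<partial>lborel \<partial>PiM {..<n} (\<lambda>_. lborel))"
    by (rule IH) measurable
  also have "\<dots> = (\<integral>\<^sup>+s. r s \<partial>PiM {..<Suc n} (\<lambda>_. lborel))"
    by (rule nn_integral_PiM_Suc[symmetric]) measurable
  finally show ?thesis .
qed

lemma AE_lborel_ex:
  fixes x :: real
  assumes "AE x in lborel. G x"
  shows "\<exists>y\<le>x. G y" and "\<exists>y\<ge>x. G y"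
proof -
  have *: "\<exists>y\<in>{a..b}. G y" if "a < b" for a b
  proof (rule ccontr)
    assume "\<not> ?thesis"
    then have sub: "{a..b} \<subseteq> {x \<in> space lborel. \<not> G x}" by auto
    obtain N where N: "{x \<in> space lborel. \<not> G x} \<subseteq> N" "emeasure lborel N = 0" "N \<in> sets lborel"
      using AE_E[OF assms] by blast
    have "emeasure lborel {a..b} \<le> emeasure lborel N"
      by (rule emeasure_mono) (use sub N in auto)
    then show False using N that by simp
  qed
  from *[of "x - 1" x] *[of x "x + 1"] show "\<exists>y\<le>x. G y" "\<exists>y\<ge>x. G y" by auto
qed

text \<open>The products of unit squares that end at z0, or begin at z0, have measure one and
  therefore meet every set of full measure. The points found bracket z0 in the lattice order, as
  \<open>section_integrable\<close> demands.\<close>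

lemma AE_PM_ex:
  assumes AE: "AE z in PM n. G z" and z0: "z0 \<in> space (PM n)"
  shows "\<exists>z\<in>space (PM n). z \<le> z0 \<and> G z" and "\<exists>z\<in>space (PM n). z0 \<le> z \<and> G z"
proof -
  have *: "\<exists>z\<in>PiE {..<n} (\<lambda>i. {a i..a i + 1} \<times> {b i..b i + 1}). G z" for a b :: "nat \<Rightarrow> real"
  proof (rule ccontr)
    let ?B = "PiE {..<n} (\<lambda>i. {a i..a i + 1} \<times> {b i..b i + 1})"
    assume "\<not> (\<exists>z\<in>?B. G z)"
    then have sub: "?B \<subseteq> {x \<in> space (PM n). \<not> G x}" by (auto simp: space_PiM)
    obtain N where N: "{x \<in> space (PM n). \<not> G x} \<subseteq> N" "emeasure (PM n) N = 0" "N \<in> sets (PM n)"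
      using AE_E[OF AE] by blast
    have sq: "emeasure lborel ({a i..a i + 1} \<times> {b i..b i + 1}) = 1" for i
      by (subst lborel_prod[symmetric], subst lborel.emeasure_pair_measure_Times) auto
    have "emeasure (PM n) ?B = (\<Prod>i<n. emeasure lborel ({a i..a i + 1} \<times> {b i..b i + 1}))"
      by (rule PS.emeasure_PiM) (auto intro!: borel_closed closed_Times)
    then have "emeasure (PM n) ?B = 1" by (simp add: sq)
    moreover have "emeasure (PM n) ?B \<le> emeasure (PM n) N"
      by (rule emeasure_mono) (use sub N in auto)
    ultimately show False using N by simp
  qed
  obtain z where z: "z \<in> PiE {..<n} (\<lambda>i. {fst (z0 i) - 1..fst (z0 i) - 1 + 1} \<times> {snd (z0 i) - 1..snd (z0 i) - 1 + 1})" "G z"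
    using *[of "\<lambda>i. fst (z0 i) - 1" "\<lambda>i. snd (z0 i) - 1"] by blast
  have "z i \<le> z0 i" for i
    using z(1) z0 by (cases "i < n") (auto simp: space_PiM PiE_def extensional_def less_eq_prod_def Pi_iff mem_Times_iff)
  then show "\<exists>z\<in>space (PM n). z \<le> z0 \<and> G z"
    using z by (intro bexI[of _ z]) (auto simp: le_fun_def space_PiM PiE_def)
  obtain z where z: "z \<in> PiE {..<n} (\<lambda>i. {fst (z0 i)..fst (z0 i) + 1} \<times> {snd (z0 i)..snd (z0 i) + 1})" "G z"
    using *[of "\<lambda>i. fst (z0 i)" "\<lambda>i. snd (z0 i)"] by blast
  have "z0 i \<le> z i" for i
    using z(1) z0 by (cases "i < n") (auto simp: space_PiM PiE_def extensional_def less_eq_prod_def Pi_iff mem_Times_iff)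
  then show "\<exists>z\<in>space (PM n). z0 \<le> z \<and> G z"
    using z by (intro bexI[of _ z]) (auto simp: le_fun_def space_PiM PiE_def)
qed

section \<open>Marginals and conditional densities of the last pair given the previous ones\<close>

definition marginal_fst :: "nat \<Rightarrow> ((nat \<Rightarrow> real \<times> real) \<Rightarrow> real) \<Rightarrow> (nat \<Rightarrow> real \<times> real) \<Rightarrow> real \<Rightarrow> real" where
  "marginal_fst n u z x = (\<integral>y. u (z(n := (x, y))) \<partial>lborel)"

definition marginal_past :: "nat \<Rightarrow> ((nat \<Rightarrow> real \<times> real) \<Rightarrow> real) \<Rightarrow> (nat \<Rightarrow> real \<times> real) \<Rightarrow> real" where
  "marginal_past n u z = (\<integral>x. marginal_fst n u z x \<partial>lborel)"

context
  fixes n :: nat and u :: "(nat \<Rightarrow> real \<times> real) \<Rightarrow> real"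
  assumes um: "u \<in> borel_measurable (PM (Suc n))"
    and pos: "\<And>z. z \<in> space (PM (Suc n)) \<Longrightarrow> 0 < u z"
    and tot: "(\<integral>\<^sup>+z. ennreal (u z) \<partial>PM (Suc n)) = 1"
    and lsm: "\<And>z z'. z \<in> space (PM (Suc n)) \<Longrightarrow> z' \<in> space (PM (Suc n)) \<Longrightarrow>
      u z * u z' \<le> u (inf z z') * u (sup z z')"
begin

lemma upd_space: "z \<in> space (PM n) \<Longrightarrow> z(n := q) \<in> space (PM (Suc n))"
  by (auto simp: space_PiM PiE_def extensional_def)

lemma inf_sup_space:
  assumes "z \<in> space (PM n)" "z' \<in> space (PM n)"
  shows "inf z z' \<in> space (PM n)" and "sup z z' \<in> space (PM n)"
  using assms by (auto simp: space_PiM PiE_def extensional_def)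

lemma section_pos: "z \<in> space (PM n) \<Longrightarrow> 0 < u (z(n := q))"
  by (rule pos[OF upd_space])

lemma section_lsm:
  assumes "z \<in> space (PM n)" "z' \<in> space (PM n)"
  shows "u (z(n := (x, y))) * u (z'(n := (x', y')))
    \<le> u ((inf z z')(n := (min x x', min y y'))) * u ((sup z z')(n := (max x x', max y y')))"
proof -
  have "inf (z(n := (x, y))) (z'(n := (x', y'))) = (inf z z')(n := (min x x', min y y'))"
    "sup (z(n := (x, y))) (z'(n := (x', y'))) = (sup z z')(n := (max x x', max y y'))"
    by (auto simp: fun_eq_iff inf_prod_def sup_prod_def inf_min sup_max)
  then show ?thesis using lsm[OF upd_space upd_space, OF assms, of "(x, y)" "(x', y')"] by simp
qed

lemma section_measurable:
  "(\<lambda>(z, x, y). u (z(n := (x, y)))) \<in> borel_measurable (PM n \<Otimes>\<^sub>M (borel \<Otimes>\<^sub>M borel))"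
proof -
  have "(\<lambda>(z, q). u (z(n := q))) \<in> borel_measurable (PM n \<Otimes>\<^sub>M borel)"
    using measurable_compose[OF measurable_upd_PiM um] by (simp add: split_beta')
  then show ?thesis by (simp add: borel_prod split_beta')
qed

lemma marginal_fst_measurable: "(\<lambda>(z, x). marginal_fst n u z x) \<in> borel_measurable (PM n \<Otimes>\<^sub>M borel)"
proof -
  note [measurable] = section_measurable
  have "(\<lambda>(q, y). u ((fst q)(n := (snd q, y)))) \<in> borel_measurable ((PM n \<Otimes>\<^sub>M borel) \<Otimes>\<^sub>M lborel)"
    using measurable_compose[OF _ section_measurable, of "\<lambda>(q, y). (fst q, snd q, y)" "(PM n \<Otimes>\<^sub>M borel) \<Otimes>\<^sub>M lborel"]
    by (simp add: split_beta')
  then show ?thesis unfolding marginal_fst_def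
    by (simp add: split_beta' lborel.borel_measurable_lebesgue_integral)
qed

lemma marginal_past_measurable: "marginal_past n u \<in> borel_measurable (PM n)"
  unfolding marginal_past_def
  using marginal_fst_measurable lborel.borel_measurable_lebesgue_integral[of "marginal_fst n u" "PM n"] by simp

lemma section_measurable1:
  assumes z: "z \<in> space (PM n)"
  shows "(\<lambda>(x, y). u (z(n := (x, y)))) \<in> borel_measurable (borel \<Otimes>\<^sub>M borel)"
    and "(\<lambda>y. u (z(n := (x, y)))) \<in> borel_measurable borel"
    and "marginal_fst n u z \<in> borel_measurable borel"
proof -
  show 1: "(\<lambda>(x, y). u (z(n := (x, y)))) \<in> borel_measurable (borel \<Otimes>\<^sub>M borel)"
    using measurable_Pair2[OF section_measurable z] by (simp add: split_beta')
  show "(\<lambda>y. u (z(n := (x, y)))) \<in> borel_measurable borel"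
    using measurable_Pair2[OF 1, of x] by simp
  show "marginal_fst n u z \<in> borel_measurable borel"
    using measurable_Pair2[OF marginal_fst_measurable z] by simp
qed

lemma tot_iterated: "(\<integral>\<^sup>+z. \<integral>\<^sup>+x. \<integral>\<^sup>+y. ennreal (u (z(n := (x, y)))) \<partial>lborel \<partial>lborel \<partial>PM n) = 1"
proof -
  have "(\<integral>\<^sup>+z. ennreal (u z) \<partial>PM (Suc n)) = (\<integral>\<^sup>+z. \<integral>\<^sup>+q. ennreal (u (z(n := q))) \<partial>lborel \<partial>PM n)"
    by (rule nn_integral_PiM_Suc) (use um in measurable)
  also have "\<dots> = (\<integral>\<^sup>+z. \<integral>\<^sup>+x. \<integral>\<^sup>+y. ennreal (u (z(n := (x, y)))) \<partial>lborel \<partial>lborel \<partial>PM n)"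
  proof (rule nn_integral_cong)
    fix z assume z: "z \<in> space (PM n)"
    note [measurable] = section_measurable1(1)[OF z]
    have "(\<lambda>q. ennreal (u (z(n := q)))) \<in> borel_measurable (borel \<Otimes>\<^sub>M borel)"
      using section_measurable1(1)[OF z] by (simp add: split_beta')
    from nn_integral_lborel_pair[OF this]
    show "(\<integral>\<^sup>+q. ennreal (u (z(n := q))) \<partial>lborel) = (\<integral>\<^sup>+x. \<integral>\<^sup>+y. ennreal (u (z(n := (x, y)))) \<partial>lborel \<partial>lborel)" .
  qed
  finally show ?thesis using tot by simp
qed

lemma AE_section_finite: "AE z in PM n. (\<integral>\<^sup>+x. \<integral>\<^sup>+y. ennreal (u (z(n := (x, y)))) \<partial>lborel \<partial>lborel) \<noteq> \<infinity>"
proof (rule nn_integral_PInf_AE)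
  have "(\<lambda>(q, y). u ((fst q)(n := (snd q, y)))) \<in> borel_measurable ((PM n \<Otimes>\<^sub>M lborel) \<Otimes>\<^sub>M lborel)"
    using measurable_compose[OF _ section_measurable, of "\<lambda>(q, y). (fst q, snd q, y)" "(PM n \<Otimes>\<^sub>M lborel) \<Otimes>\<^sub>M lborel"]
    by (simp add: split_beta')
  then have [measurable]: "(\<lambda>q. u ((fst (fst q))(n := (snd (fst q), snd q)))) \<in> borel_measurable ((PM n \<Otimes>\<^sub>M lborel) \<Otimes>\<^sub>M lborel)"
    by (simp add: split_beta')
  have "(\<lambda>q. \<integral>\<^sup>+y. ennreal (u ((fst q)(n := (snd q, y)))) \<partial>lborel) \<in> borel_measurable (PM n \<Otimes>\<^sub>M lborel)"
    by (rule lborel.borel_measurable_nn_integral) (simp add: split_beta')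
  then show "(\<lambda>z. \<integral>\<^sup>+x. \<integral>\<^sup>+y. ennreal (u (z(n := (x, y)))) \<partial>lborel \<partial>lborel) \<in> borel_measurable (PM n)"
    by (intro lborel.borel_measurable_nn_integral) (simp add: split_beta')
qed (simp add: tot_iterated)

text \<open>Finite total mass makes almost all sections integrable. Good points below and above (z,
  x), treated as one lattice point, then extend this to every section, so that the conditional
  densities are genuine positive densities at every point and the induction carries no exceptional
  sets.\<close>

lemma section_integrable_y:
  assumes z: "z \<in> space (PM n)"
  shows "integrable lborel (\<lambda>y. u (z(n := (x, y))))"
proof -
  let ?U = "\<lambda>q y. u ((fst q)(n := (snd q, y)))"
  have good: "AE x in lborel. integrable lborel (\<lambda>y. u (z1(n := (x, y))))"
    if z1: "z1 \<in> space (PM n)" and f: "(\<integral>\<^sup>+x. \<integral>\<^sup>+y. ennreal (u (z1(n := (x, y)))) \<partial>lborel \<partial>lborel) \<noteq> \<infinity>" for z1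
  proof -
    note [measurable] = section_measurable1(1)[OF z1]
    have "AE x in lborel. (\<integral>\<^sup>+y. ennreal (u (z1(n := (x, y)))) \<partial>lborel) \<noteq> \<infinity>"
      by (rule nn_integral_PInf_AE[OF _ f]) measurable
    then show ?thesis
    proof eventually_elim
      case (elim x)
      show ?case
        using section_measurable1(2)[OF z1] elim section_pos[OF z1]
        by (intro integrableI_bounded) (simp_all add: less_imp_le less_top)
    qed
  qed
  obtain z1 where z1: "z1 \<in> space (PM n)" "z1 \<le> z" "(\<integral>\<^sup>+x. \<integral>\<^sup>+y. ennreal (u (z1(n := (x, y)))) \<partial>lborel \<partial>lborel) \<noteq> \<infinity>"
    using AE_PM_ex(1)[OF AE_section_finite z] by blast
  obtain z2 where z2: "z2 \<in> space (PM n)" "z \<le> z2" "(\<integral>\<^sup>+x. \<integral>\<^sup>+y. ennreal (u (z2(n := (x, y)))) \<partial>lborel \<partial>lborel) \<noteq> \<infinity>"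
    using AE_PM_ex(2)[OF AE_section_finite z] by blast
  obtain x1 where x1: "x1 \<le> x" "integrable lborel (\<lambda>y. u (z1(n := (x1, y))))"
    using AE_lborel_ex(1)[OF good[OF z1(1,3)]] by blast
  obtain x2 where x2: "x \<le> x2" "integrable lborel (\<lambda>y. u (z2(n := (x2, y))))"
    using AE_lborel_ex(2)[OF good[OF z2(1,3)]] by blast
  have "integrable lborel (?U (z, x))"
  proof (rule section_integrable[where E = "space (PM n) \<times> UNIV" and ?z1.0 = "(z1, x1)" and ?z2.0 = "(z2, x2)"])
    fix q q' :: "(nat \<Rightarrow> real \<times> real) \<times> real" and t t' :: real
    assume q: "q \<in> space (PM n) \<times> UNIV"
    then show "0 < ?U q t" by (auto simp: section_pos)
    assume q': "q' \<in> space (PM n) \<times> UNIV"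
    show "?U q t * ?U q' t' \<le> ?U (inf q q') (min t t') * ?U (sup q q') (max t t')"
      using section_lsm[of "fst q" "fst q'" "snd q" t "snd q'" t'] q q'
      by (auto simp: inf_prod_def sup_prod_def inf_min sup_max)
  qed (use z z1 z2 x1 x2 section_measurable1(2)[OF z] in \<open>simp_all only: fst_conv snd_conv mem_Times_iff UNIV_I Pair_le simp_thms\<close>)
  then show ?thesis by simp
qed

lemma marginal_fst_pos: "z \<in> space (PM n) \<Longrightarrow> 0 < marginal_fst n u z x"
  unfolding marginal_fst_def by (rule integral_pos_of_pos[OF section_integrable_y section_pos])

lemma ennreal_marginal_fst:
  "z \<in> space (PM n) \<Longrightarrow> (\<integral>\<^sup>+y. ennreal (u (z(n := (x, y)))) \<partial>lborel) = ennreal (marginal_fst n u z x)"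
  unfolding marginal_fst_def
  by (rule nn_integral_eq_integral[OF section_integrable_y]) (auto simp: section_pos less_imp_le)

lemma marginal_fst_lsm:
  assumes "z \<in> space (PM n)" "z' \<in> space (PM n)"
  shows "marginal_fst n u z x * marginal_fst n u z' x'
    \<le> marginal_fst n u (inf z z') (min x x') * marginal_fst n u (sup z z') (max x x')"
proof -
  let ?U = "\<lambda>q y. u ((fst q)(n := (snd q, y)))"
  have "(\<integral>y. ?U (z, x) y \<partial>lborel) * (\<integral>y. ?U (z', x') y \<partial>lborel)
    \<le> (\<integral>y. ?U (inf (z, x) (z', x')) y \<partial>lborel) * (\<integral>y. ?U (sup (z, x) (z', x')) y \<partial>lborel)"
  proof (rule marginal_log_supermodular[where E = "space (PM n) \<times> UNIV"])
    fix q q' :: "(nat \<Rightarrow> real \<times> real) \<times> real" and t t' :: real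
    assume q: "q \<in> space (PM n) \<times> UNIV"
    then show "0 < ?U q t" by (auto simp: section_pos)
    show "integrable lborel (?U q)" using q by (auto simp: section_integrable_y)
    assume q': "q' \<in> space (PM n) \<times> UNIV"
    show "inf q q' \<in> space (PM n) \<times> UNIV" "sup q q' \<in> space (PM n) \<times> UNIV"
      using q q' inf_sup_space[of "fst q" "fst q'"] by (auto simp: inf_prod_def sup_prod_def)
    show "?U q t * ?U q' t' \<le> ?U (inf q q') (min t t') * ?U (sup q q') (max t t')"
      using section_lsm[of "fst q" "fst q'" "snd q" t "snd q'" t'] q q'
      by (auto simp: inf_prod_def sup_prod_def inf_min sup_max)
  qed (use assms in auto)
  then show ?thesis by (simp add: marginal_fst_def inf_prod_def sup_prod_def inf_min sup_max)
qed

lemma marginal_fst_integrable: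
  assumes z: "z \<in> space (PM n)"
  shows "integrable lborel (marginal_fst n u z)"
proof -
  have good: "integrable lborel (marginal_fst n u z1)"
    if z1: "z1 \<in> space (PM n)" and f: "(\<integral>\<^sup>+x. \<integral>\<^sup>+y. ennreal (u (z1(n := (x, y)))) \<partial>lborel \<partial>lborel) \<noteq> \<infinity>" for z1
    using f section_measurable1(3)[OF z1] marginal_fst_pos[OF z1]
    by (intro integrableI_bounded) (simp_all add: ennreal_marginal_fst[OF z1] less_imp_le less_top)
  obtain z1 where z1: "z1 \<in> space (PM n)" "z1 \<le> z" "(\<integral>\<^sup>+x. \<integral>\<^sup>+y. ennreal (u (z1(n := (x, y)))) \<partial>lborel \<partial>lborel) \<noteq> \<infinity>"
    using AE_PM_ex(1)[OF AE_section_finite z] by blast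
  obtain z2 where z2: "z2 \<in> space (PM n)" "z \<le> z2" "(\<integral>\<^sup>+x. \<integral>\<^sup>+y. ennreal (u (z2(n := (x, y)))) \<partial>lborel \<partial>lborel) \<noteq> \<infinity>"
    using AE_PM_ex(2)[OF AE_section_finite z] by blast
  show ?thesis
    by (rule section_integrable[where E = "space (PM n)" and u = "marginal_fst n u", OF _ _ z z1(1) z2(1) z1(2) z2(2)])
       (use z1 z2 z good marginal_fst_pos marginal_fst_lsm section_measurable1 in auto)
qed

lemma marginal_past_pos: "z \<in> space (PM n) \<Longrightarrow> 0 < marginal_past n u z"
  unfolding marginal_past_def by (rule integral_pos_of_pos[OF marginal_fst_integrable marginal_fst_pos])

lemma ennreal_marginal_past:
  "z \<in> space (PM n) \<Longrightarrow> (\<integral>\<^sup>+x. ennreal (marginal_fst n u z x) \<partial>lborel) = ennreal (marginal_past n u z)"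
  unfolding marginal_past_def
  by (rule nn_integral_eq_integral[OF marginal_fst_integrable]) (auto simp: marginal_fst_pos less_imp_le)

lemma marginal_past_lsm:
  assumes "z \<in> space (PM n)" "z' \<in> space (PM n)"
  shows "marginal_past n u z * marginal_past n u z' \<le> marginal_past n u (inf z z') * marginal_past n u (sup z z')"
  unfolding marginal_past_def
  by (rule marginal_log_supermodular[where E = "space (PM n)" and u = "marginal_fst n u"])
     (use assms inf_sup_space marginal_fst_pos marginal_fst_lsm marginal_fst_integrable in auto)

lemma marginal_past_total: "(\<integral>\<^sup>+z. ennreal (marginal_past n u z) \<partial>PM n) = 1"
proof -
  have "(\<integral>\<^sup>+z. ennreal (marginal_past n u z) \<partial>PM n)
      = (\<integral>\<^sup>+z. \<integral>\<^sup>+x. \<integral>\<^sup>+y. ennreal (u (z(n := (x, y)))) \<partial>lborel \<partial>lborel \<partial>PM n)"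
    by (intro nn_integral_cong) (simp add: ennreal_marginal_fst ennreal_marginal_past)
  then show ?thesis by (simp add: tot_iterated)
qed

definition cond_fst where "cond_fst z x = marginal_fst n u z x / marginal_past n u z"

definition cond_snd where "cond_snd z x y = u (z(n := (x, y))) / marginal_fst n u z x"

lemma section_eq:
  assumes "z \<in> space (PM n)"
  shows "u (z(n := (x, y))) = marginal_past n u z * (cond_fst z x * cond_snd z x y)"
  using marginal_past_pos[OF assms] marginal_fst_pos[OF assms, of x] by (simp add: cond_fst_def cond_snd_def)

lemma cond_fst_density: "z \<in> space (PM n) \<Longrightarrow> positive_density (cond_fst z)"
  using positive_density_normalize[OF marginal_fst_integrable marginal_fst_pos, of z]
  by (simp add: cond_fst_def[abs_def] marginal_past_def)

lemma cond_snd_density: "z \<in> space (PM n) \<Longrightarrow> positive_density (cond_snd z x)"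
  using positive_density_normalize[OF section_integrable_y section_pos, of z x]
  by (simp add: cond_snd_def[abs_def] marginal_fst_def)

lemma cond_fst_measurable: "(\<lambda>(z, x). cond_fst z x) \<in> borel_measurable (PM n \<Otimes>\<^sub>M borel)"
proof -
  note [measurable] = marginal_fst_measurable marginal_past_measurable
  show ?thesis unfolding cond_fst_def by measurable
qed

lemma cond_snd_measurable: "(\<lambda>(z, x, y). cond_snd z x y) \<in> borel_measurable (PM n \<Otimes>\<^sub>M (borel \<Otimes>\<^sub>M borel))"
proof -
  have 1: "(\<lambda>(z, x, y). marginal_fst n u z x) \<in> borel_measurable (PM n \<Otimes>\<^sub>M (borel \<Otimes>\<^sub>M borel))"
    using measurable_compose[OF _ marginal_fst_measurable, of "\<lambda>(z, x, y). (z, x)" "PM n \<Otimes>\<^sub>M (borel \<Otimes>\<^sub>M borel)"]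
    by (simp add: split_beta')
  show ?thesis unfolding cond_snd_def
    using borel_measurable_divide[OF section_measurable 1] by (simp add: split_beta')
qed

text \<open>At a common past, log-supermodularity for the pairs (x', s) and (x, t) is the monotone
  likelihood ratio property of the conditional densities. The normalising factors are the same
  product on both sides. This supplies the hypothesis \<open>dec\<close> of the one-pair
  inequality.\<close>

lemma cond_snd_antimono:
  assumes z: "z \<in> space (PM n)" and x: "x \<le> x'"
  shows "density_cdf (cond_snd z x') y \<le> density_cdf (cond_snd z x) y"
proof (rule density_cdf_antimono_of_lsm[OF cond_snd_density cond_snd_density, OF z z])
  fix s t :: real assume st: "s \<le> t"
  have "u (z(n := (x', s))) * u (z(n := (x, t))) \<le> u (z(n := (x, s))) * u (z(n := (x', t)))"
    using section_lsm[OF z z, of x' s x t] x st by (simp add: min.absorb1 min.absorb2 max.absorb1 max.absorb2)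
  then show "cond_snd z x' s * cond_snd z x t \<le> cond_snd z x s * cond_snd z x' t"
    using divide_right_mono[of _ _ "marginal_fst n u z x * marginal_fst n u z x'"]
      marginal_fst_pos[OF z, of x] marginal_fst_pos[OF z, of x']
    by (simp add: cond_snd_def mult.commute)
qed

end


lemma measurable_last:
  assumes F: "(\<lambda>(z, q). F z q) \<in> borel_measurable (PM n \<Otimes>\<^sub>M borel)"
  shows "(\<lambda>\<omega>. F (restrict \<omega> {..<n}) (\<omega> n)) \<in> borel_measurable (PM (Suc n))"
proof -
  have "(\<lambda>\<omega>. restrict \<omega> {..<n}) \<in> measurable (PM (Suc n)) (PM n)"
    by (rule measurable_restrict_subset) auto
  moreover have "(\<lambda>\<omega>. \<omega> n) \<in> measurable (PM (Suc n)) borel"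
    using measurable_component_singleton[of n "{..<Suc n}" "\<lambda>_. lborel :: (real \<times> real) measure"] by simp
  ultimately have "(\<lambda>\<omega>. (restrict \<omega> {..<n}, \<omega> n)) \<in> measurable (PM (Suc n)) (PM n \<Otimes>\<^sub>M borel)"
    by (rule measurable_Pair)
  from measurable_compose[OF this F] show ?thesis by simp
qed

text \<open>The induction invariant. \<open>P\<close> and \<open>Q\<close> are kept only through
  their product and three bounds, each preserved by \<open>kernel_step\<close>. The first says in
  effect that \<open>P\<close> has integral at most one over the first coordinates for almost every
  choice of the second ones; the next one is its mirror image for \<open>Q\<close>. In the third,
  the exponents \<open>1 - \<theta>\<close> and \<open>\<theta>\<close> arise from multiplying the
  factor with \<open>- \<theta>\<close> and \<open>- (1 - \<theta>)\<close> by
  \<open>u = P * Q\<close>. \<open>Z\<close> collects the products of Gaussian coordinates.\<close>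

definition pair_factorization :: "real \<Rightarrow> nat \<Rightarrow> ((nat \<Rightarrow> real \<times> real) \<Rightarrow> real) \<Rightarrow>
    ((nat \<Rightarrow> real \<times> real) \<Rightarrow> real) \<Rightarrow> ((nat \<Rightarrow> real \<times> real) \<Rightarrow> real) \<Rightarrow> ((nat \<Rightarrow> real \<times> real) \<Rightarrow> real) \<Rightarrow> bool" where
  "pair_factorization \<theta> n u P Q Z \<longleftrightarrow>
    P \<in> borel_measurable (PM n) \<and> Q \<in> borel_measurable (PM n) \<and> Z \<in> borel_measurable (PM n) \<and>
    (\<forall>z\<in>space (PM n). 0 < P z \<and> 0 < Q z \<and> u z = P z * Q z) \<and>
    (\<forall>r\<in>borel_measurable (PiM {..<n} (\<lambda>_. lborel)).
      (\<integral>\<^sup>+z. ennreal (P z) * r (\<lambda>i\<in>{..<n}. snd (z i)) \<partial>PM n) \<le> (\<integral>\<^sup>+s. r s \<partial>PiM {..<n} (\<lambda>_. lborel))) \<and>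
    (\<forall>r\<in>borel_measurable (PiM {..<n} (\<lambda>_. lborel)).
      (\<integral>\<^sup>+z. ennreal (Q z) * r (\<lambda>i\<in>{..<n}. fst (z i)) \<partial>PM n) \<le> (\<integral>\<^sup>+s. r s \<partial>PiM {..<n} (\<lambda>_. lborel))) \<and>
    (\<forall>r\<in>borel_measurable (PiM {..<n} (\<lambda>_. lborel)).
      (\<integral>\<^sup>+z. ennreal (P z powr (1 - \<theta>) * Q z powr \<theta> * exp (real n * mixing_entropy \<theta> + sqrt (\<theta> * (1 - \<theta>)) * Z z))
        * r (\<lambda>i\<in>{..<n}. fst (z i) + snd (z i)) \<partial>PM n) \<le> (\<integral>\<^sup>+s. r s \<partial>PiM {..<n} (\<lambda>_. lborel))) \<and>
    integrable (PM n) (\<lambda>z. u z * Z z) \<and> (\<integral>z. u z * Z z \<partial>PM n) = 0"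

text \<open>The marginal of the past inherits positivity, mass one and log-supermodularity, so the
  invariant is available for it. The last pair multiplies \<open>P'\<close> and \<open>Q'\<close> by
  its conditional densities and adds its rank product to \<open>Z'\<close>.\<close>

lemma pair_factorization_step:
  assumes \<theta>: "0 < \<theta>" "\<theta> < 1"
    and um: "u \<in> borel_measurable (PM (Suc n))"
    and pos: "\<And>z. z \<in> space (PM (Suc n)) \<Longrightarrow> 0 < u z"
    and tot: "(\<integral>\<^sup>+z. ennreal (u z) \<partial>PM (Suc n)) = 1"
    and lsm: "\<And>z z'. z \<in> space (PM (Suc n)) \<Longrightarrow> z' \<in> space (PM (Suc n)) \<Longrightarrow>
      u z * u z' \<le> u (inf z z') * u (sup z z')"
    and IH: "pair_factorization \<theta> n (marginal_past n u) P' Q' Z'"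
  shows "\<exists>P Q Z. pair_factorization \<theta> (Suc n) u P Q Z"
proof -
  note ctx = um pos tot lsm
  define C p w where "C = marginal_past n u" and "p = cond_fst n u" and "w = cond_snd n u"
  let ?S = "space (PM n)"
  have IHs: "P' \<in> borel_measurable (PM n)" "Q' \<in> borel_measurable (PM n)" "Z' \<in> borel_measurable (PM n)"
    "\<And>z. z \<in> ?S \<Longrightarrow> 0 < P' z" "\<And>z. z \<in> ?S \<Longrightarrow> 0 < Q' z" "\<And>z. z \<in> ?S \<Longrightarrow> C z = P' z * Q' z"
    "\<And>r. r \<in> borel_measurable (PiM {..<n} (\<lambda>_. lborel)) \<Longrightarrow>
      (\<integral>\<^sup>+z. ennreal (P' z) * r (\<lambda>i\<in>{..<n}. snd (z i)) \<partial>PM n) \<le> (\<integral>\<^sup>+s. r s \<partial>PiM {..<n} (\<lambda>_. lborel))"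
    "\<And>r. r \<in> borel_measurable (PiM {..<n} (\<lambda>_. lborel)) \<Longrightarrow>
      (\<integral>\<^sup>+z. ennreal (Q' z) * r (\<lambda>i\<in>{..<n}. fst (z i)) \<partial>PM n) \<le> (\<integral>\<^sup>+s. r s \<partial>PiM {..<n} (\<lambda>_. lborel))"
    "\<And>r. r \<in> borel_measurable (PiM {..<n} (\<lambda>_. lborel)) \<Longrightarrow>
      (\<integral>\<^sup>+z. ennreal (P' z powr (1 - \<theta>) * Q' z powr \<theta> * exp (real n * mixing_entropy \<theta> + sqrt (\<theta> * (1 - \<theta>)) * Z' z))
        * r (\<lambda>i\<in>{..<n}. fst (z i) + snd (z i)) \<partial>PM n) \<le> (\<integral>\<^sup>+s. r s \<partial>PiM {..<n} (\<lambda>_. lborel))"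
    "integrable (PM n) (\<lambda>z. C z * Z' z)" "(\<integral>z. C z * Z' z \<partial>PM n) = 0"
    using IH unfolding pair_factorization_def C_def by auto
  note [measurable] = IHs(1-3)
  have Cm [measurable]: "C \<in> borel_measurable (PM n)"
    unfolding C_def by (rule marginal_past_measurable[OF ctx])
  have Cpos: "0 < C z" if "z \<in> ?S" for z
    unfolding C_def by (rule marginal_past_pos[OF ctx that])
  have p: "positive_density (p z)" if "z \<in> ?S" for z
    unfolding p_def by (rule cond_fst_density[OF ctx that])
  have w: "positive_density (w z x)" if "z \<in> ?S" for z x
    unfolding w_def by (rule cond_snd_density[OF ctx that])
  have pm: "(\<lambda>(z, x). p z x) \<in> borel_measurable (PM n \<Otimes>\<^sub>M borel)"
    unfolding p_def by (rule cond_fst_measurable[OF ctx])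
  have wm: "(\<lambda>(z, x, y). w z x y) \<in> borel_measurable (PM n \<Otimes>\<^sub>M (borel \<Otimes>\<^sub>M borel))"
    unfolding w_def by (rule cond_snd_measurable[OF ctx])
  have dec: "density_cdf (w z x') y \<le> density_cdf (w z x) y" if "z \<in> ?S" "x \<le> x'" for z x x' y
    unfolding w_def by (rule cond_snd_antimono[OF ctx that])
  have ueq: "u (z(n := q)) = C z * (p z (fst q) * w z (fst q) (snd q))" if "z \<in> ?S" for z q
  proof -
    have "u (z(n := (fst q, snd q))) = C z * (p z (fst q) * w z (fst q) (snd q))"
      unfolding C_def p_def w_def by (rule section_eq[OF ctx that])
    then show ?thesis by (simp only: prod.collapse)
  qed
  have wz: "(\<lambda>(x, y). w z x y) \<in> borel_measurable (borel \<Otimes>\<^sub>M borel)" if "z \<in> ?S" for z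
    using measurable_Pair2[OF wm that] by (simp add: split_beta')
  have pm' [measurable]: "(\<lambda>(z, q :: real \<times> real). p z (fst q)) \<in> borel_measurable (PM n \<Otimes>\<^sub>M borel)"
  proof -
    have "(\<lambda>(z, q :: real \<times> real). (z, fst q)) \<in> measurable (PM n \<Otimes>\<^sub>M borel) (PM n \<Otimes>\<^sub>M (borel :: real measure))"
      unfolding split_beta' borel_prod[symmetric] by measurable
    from measurable_compose[OF this pm] show ?thesis by (simp add: split_beta')
  qed
  have wm' [measurable]: "(\<lambda>(z, q). w z (fst q) (snd q)) \<in> borel_measurable (PM n \<Otimes>\<^sub>M borel)"
    using wm by (simp add: split_beta' borel_prod)
  define A where "A z q = gauss_rank (p z) (fst q) * gauss_rank (w z (fst q)) (snd q)" for z q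
  have Am [measurable]: "(\<lambda>(z, q). A z q) \<in> borel_measurable (PM n \<Otimes>\<^sub>M borel)"
  proof -
    have 1: "(\<lambda>(z, x). gauss_rank (p z) x) \<in> borel_measurable (PM n \<Otimes>\<^sub>M borel)"
      by (rule measurable_gauss_rank_pair[OF p pm])
    have "(\<lambda>(z, q :: real \<times> real). (z, fst q)) \<in> measurable (PM n \<Otimes>\<^sub>M borel) (PM n \<Otimes>\<^sub>M (borel :: real measure))"
      unfolding split_beta' borel_prod[symmetric] by measurable
    note 1 = measurable_compose[OF this 1]
    have "(\<lambda>(q, y). w (fst q) (snd q) y) \<in> borel_measurable ((PM n \<Otimes>\<^sub>M borel) \<Otimes>\<^sub>M borel)"
      using measurable_compose[OF _ wm, of "\<lambda>(q, y). (fst q, snd q, y)" "(PM n \<Otimes>\<^sub>M borel) \<Otimes>\<^sub>M borel"]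
      by (simp add: split_beta')
    then have 2: "(\<lambda>(q, y). gauss_rank (w (fst q) (snd q)) y) \<in> borel_measurable ((PM n \<Otimes>\<^sub>M borel) \<Otimes>\<^sub>M borel)"
      by (intro measurable_gauss_rank_pair w) (auto simp: space_pair_measure)
    have "(\<lambda>(z, q). ((z, fst q), snd q)) \<in> measurable (PM n \<Otimes>\<^sub>M borel) ((PM n \<Otimes>\<^sub>M (borel :: real measure)) \<Otimes>\<^sub>M (borel :: real measure))"
      unfolding split_beta' borel_prod[symmetric] by measurable
    note 2 = measurable_compose[OF this 2]
    from borel_measurable_times[OF 1 2] show ?thesis by (simp add: A_def split_beta')
  qed
  let ?R = "\<lambda>\<omega>. restrict \<omega> {..<n}"
  define P where "P \<omega> = P' (?R \<omega>) * p (?R \<omega>) (fst (\<omega> n))" for \<omega>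
  define Q where "Q \<omega> = Q' (?R \<omega>) * w (?R \<omega>) (fst (\<omega> n)) (snd (\<omega> n))" for \<omega>
  define Z where "Z \<omega> = Z' (?R \<omega>) + A (?R \<omega>) (\<omega> n)" for \<omega>
  have Pm: "P \<in> borel_measurable (PM (Suc n))"
    using measurable_last[of "\<lambda>z q. P' z * p z (fst q)" n] by (simp add: P_def[abs_def])
  have Qm: "Q \<in> borel_measurable (PM (Suc n))"
    using measurable_last[of "\<lambda>z q. Q' z * w z (fst q) (snd q)" n] by (simp add: Q_def[abs_def])
  have Zm: "Z \<in> borel_measurable (PM (Suc n))"
    using measurable_last[of "\<lambda>z q. Z' z + A z q" n] by (simp add: Z_def[abs_def])
  have RS: "?R \<omega> \<in> ?S" for \<omega> by (auto simp: space_PiM)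
  have Rupd: "?R (z(n := q)) = z" if "z \<in> ?S" for z q
    using that by (auto simp: space_PiM PiE_def extensional_def restrict_def)
  have split: "\<omega> = (?R \<omega>)(n := \<omega> n)" if "\<omega> \<in> space (PM (Suc n))" for \<omega>
    using that by (auto simp: space_PiM PiE_def extensional_def restrict_def fun_eq_iff)
  have ppos: "0 < p z x" and wpos: "0 < w z x y" if "z \<in> ?S" for z x y
    using positive_density_pos[OF p[OF that]] positive_density_pos[OF w[OF that]] by auto
  have PQ: "0 < P \<omega> \<and> 0 < Q \<omega> \<and> u \<omega> = P \<omega> * Q \<omega>" if "\<omega> \<in> space (PM (Suc n))" for \<omega>
  proof -
    have "u \<omega> = C (?R \<omega>) * (p (?R \<omega>) (fst (\<omega> n)) * w (?R \<omega>) (fst (\<omega> n)) (snd (\<omega> n)))"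
      using ueq[OF RS, of \<omega> "\<omega> n"] split[OF that] by simp
    then show ?thesis
      using IHs(4,5,6)[OF RS] ppos[OF RS] wpos[OF RS] by (simp add: P_def Q_def)
  qed
  have fs: "(fst :: real \<times> real \<Rightarrow> real) \<in> borel_measurable borel"
    "(snd :: real \<times> real \<Rightarrow> real) \<in> borel_measurable borel"
    unfolding borel_prod[symmetric] by measurable
  \<comment> \<open>The new factor of \<open>P\<close> does not involve the second coordinate and
    integrates to one over the first. For \<open>Q\<close> below the order is reversed: at fixed
    first coordinate, the conditional density integrates to one over the second.\<close>
  have I1: "(\<integral>\<^sup>+\<omega>. ennreal (P \<omega>) * r (\<lambda>i\<in>{..<Suc n}. snd (\<omega> i)) \<partial>PM (Suc n)) \<le> (\<integral>\<^sup>+s. r s \<partial>PiM {..<Suc n} (\<lambda>_. lborel))"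
    if r: "r \<in> borel_measurable (PiM {..<Suc n} (\<lambda>_. lborel))" for r
  proof -
    have "(\<integral>\<^sup>+\<omega>. ennreal (P' (?R \<omega>)) * ennreal (p (?R \<omega>) (fst (\<omega> n))) * r (\<lambda>i\<in>{..<Suc n}. snd (\<omega> i)) \<partial>PM (Suc n))
      \<le> (\<integral>\<^sup>+s. r s \<partial>PiM {..<Suc n} (\<lambda>_. lborel))"
    proof (rule kernel_step[where V = "\<lambda>z. ennreal (P' z)" and K = "\<lambda>z q. ennreal (p z (fst q))" and \<pi> = snd])
      fix z and r' :: "real \<Rightarrow> ennreal" assume z: "z \<in> ?S" and r' [measurable]: "r' \<in> borel_measurable borel"
      note [measurable] = positive_density_measurable[OF p[OF z]]
      have "(\<integral>\<^sup>+q. ennreal (p z (fst q)) * r' (snd q) \<partial>lborel) = (\<integral>\<^sup>+x. \<integral>\<^sup>+y. ennreal (p z x) * r' y \<partial>lborel \<partial>lborel)"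
        by (subst nn_integral_lborel_pair) simp_all
      also have "\<dots> = (\<integral>\<^sup>+t. r' t \<partial>lborel)"
        by (simp add: nn_integral_cmult nn_integral_multc positive_density_integral[OF p[OF z]])
      finally show "(\<integral>\<^sup>+q. ennreal (p z (fst q)) * r' (snd q) \<partial>lborel) \<le> (\<integral>\<^sup>+t. r' t \<partial>lborel)" by simp
    qed (use IHs(7) r fs in simp_all)
    then show ?thesis
      using IHs(4)[OF RS] ppos[OF RS] by (simp add: P_def ennreal_mult less_imp_le)
  qed
  have I2: "(\<integral>\<^sup>+\<omega>. ennreal (Q \<omega>) * r (\<lambda>i\<in>{..<Suc n}. fst (\<omega> i)) \<partial>PM (Suc n)) \<le> (\<integral>\<^sup>+s. r s \<partial>PiM {..<Suc n} (\<lambda>_. lborel))"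
    if r: "r \<in> borel_measurable (PiM {..<Suc n} (\<lambda>_. lborel))" for r
  proof -
    have "(\<integral>\<^sup>+\<omega>. ennreal (Q' (?R \<omega>)) * ennreal (w (?R \<omega>) (fst (\<omega> n)) (snd (\<omega> n))) * r (\<lambda>i\<in>{..<Suc n}. fst (\<omega> i)) \<partial>PM (Suc n))
      \<le> (\<integral>\<^sup>+s. r s \<partial>PiM {..<Suc n} (\<lambda>_. lborel))"
    proof (rule kernel_step[where V = "\<lambda>z. ennreal (Q' z)" and K = "\<lambda>z q. ennreal (w z (fst q) (snd q))" and \<pi> = fst])
      fix z and r' :: "real \<Rightarrow> ennreal" assume z: "z \<in> ?S" and r' [measurable]: "r' \<in> borel_measurable borel"
      note [measurable] = wz[OF z] positive_density_measurable[OF w[OF z]]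
      have "(\<integral>\<^sup>+q. ennreal (w z (fst q) (snd q)) * r' (fst q) \<partial>lborel) = (\<integral>\<^sup>+x. \<integral>\<^sup>+y. ennreal (w z x y) * r' x \<partial>lborel \<partial>lborel)"
        by (subst nn_integral_lborel_pair) simp_all
      also have "\<dots> = (\<integral>\<^sup>+t. r' t \<partial>lborel)"
        by (simp add: nn_integral_multc positive_density_integral[OF w[OF z]])
      finally show "(\<integral>\<^sup>+q. ennreal (w z (fst q) (snd q)) * r' (fst q) \<partial>lborel) \<le> (\<integral>\<^sup>+t. r' t \<partial>lborel)" by simp
    qed (use IHs(8) r fs in simp_all)
    then show ?thesis
      using IHs(5)[OF RS] wpos[OF RS] by (simp add: Q_def ennreal_mult less_imp_le)
  qed
  define k where "k = sqrt (\<theta> * (1 - \<theta>))"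
  have I3: "(\<integral>\<^sup>+\<omega>. ennreal (P \<omega> powr (1 - \<theta>) * Q \<omega> powr \<theta> * exp (real (Suc n) * mixing_entropy \<theta> + k * Z \<omega>))
        * r (\<lambda>i\<in>{..<Suc n}. fst (\<omega> i) + snd (\<omega> i)) \<partial>PM (Suc n)) \<le> (\<integral>\<^sup>+s. r s \<partial>PiM {..<Suc n} (\<lambda>_. lborel))"
    if r: "r \<in> borel_measurable (PiM {..<Suc n} (\<lambda>_. lborel))" for r
  proof -
    let ?V = "\<lambda>z. P' z powr (1 - \<theta>) * Q' z powr \<theta> * exp (real n * mixing_entropy \<theta> + k * Z' z)"
    let ?K = "\<lambda>z q. pair_kernel \<theta> (p z) (w z) (fst q) (snd q)"
    \<comment> \<open>Powers and exponentials turn products of densities and sums of exponents into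
      one factor for the past and one for the new pair, each with its own copy of the
      constant.\<close>
    have eq: "P \<omega> powr (1 - \<theta>) * Q \<omega> powr \<theta> * exp (real (Suc n) * mixing_entropy \<theta> + k * Z \<omega>) = ?V (?R \<omega>) * ?K (?R \<omega>) (\<omega> n)" for \<omega>
    proof -
      have e: "exp (real (Suc n) * mixing_entropy \<theta> + k * Z \<omega>)
        = exp (real n * mixing_entropy \<theta> + k * Z' (?R \<omega>)) * exp (mixing_entropy \<theta> + k * A (?R \<omega>) (\<omega> n))"
        by (simp add: Z_def exp_add[symmetric] algebra_simps)
      show ?thesis unfolding e pair_kernel_def k_def[symmetric] A_def P_def Q_def
        by (subst (1 2) powr_mult) (simp only: ac_simps)
    qed
    have "(\<integral>\<^sup>+\<omega>. ennreal (?V (?R \<omega>)) * ennreal (?K (?R \<omega>) (\<omega> n)) * r (\<lambda>i\<in>{..<Suc n}. fst (\<omega> i) + snd (\<omega> i)) \<partial>PM (Suc n))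
      \<le> (\<integral>\<^sup>+s. r s \<partial>PiM {..<Suc n} (\<lambda>_. lborel))"
    proof (rule kernel_step[where V = "\<lambda>z. ennreal (?V z)" and K = "\<lambda>z q. ennreal (?K z q)" and \<pi> = "\<lambda>q. fst q + snd q"])
      show "(\<lambda>z. ennreal (?V z)) \<in> borel_measurable (PM n)" by measurable
      have "(\<lambda>(z, q). p z (fst q) powr (1 - \<theta>) * w z (fst q) (snd q) powr \<theta> * exp (mixing_entropy \<theta> + k * A z q)) \<in> borel_measurable (PM n \<Otimes>\<^sub>M borel)"
        by measurable
      then show "(\<lambda>(z, q). ennreal (?K z q)) \<in> borel_measurable (PM n \<Otimes>\<^sub>M borel)"
        unfolding pair_kernel_def k_def A_def by (simp add: split_beta')
      fix z and r' :: "real \<Rightarrow> ennreal" assume z: "z \<in> ?S" and r' [measurable]: "r' \<in> borel_measurable borel"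
      have K1: "(\<lambda>q. ennreal (?K z q)) \<in> borel_measurable (borel \<Otimes>\<^sub>M borel)"
        using measurable_Pair2[OF \<open>(\<lambda>(z, q). ennreal (?K z q)) \<in> borel_measurable (PM n \<Otimes>\<^sub>M borel)\<close> z]
        by (simp add: borel_prod)
      have "(\<integral>\<^sup>+q. ennreal (?K z q) * r' (fst q + snd q) \<partial>lborel)
        = (\<integral>\<^sup>+x. \<integral>\<^sup>+y. ennreal (pair_kernel \<theta> (p z) (w z) x y) * r' (x + y) \<partial>lborel \<partial>lborel)"
        by (subst nn_integral_lborel_pair[OF borel_measurable_times_ennreal[OF K1]]) simp_all
      also have "\<dots> \<le> (\<integral>\<^sup>+t. r' t \<partial>lborel)"
        by (rule pair_kernel_le[OF p[OF z] w[OF z] wz[OF z] dec[OF z] \<theta> r'])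
      finally show "(\<integral>\<^sup>+q. ennreal (?K z q) * r' (fst q + snd q) \<partial>lborel) \<le> (\<integral>\<^sup>+t. r' t \<partial>lborel)" .
    qed (use IHs(9) r borel_measurable_add[OF fs] in \<open>simp_all add: k_def\<close>)
    then show ?thesis
      unfolding eq by (simp add: ennreal_mult pair_kernel_def)
  qed
  define c where "c = (\<integral>\<^sup>+b. ennreal (std_normal_density b) * ennreal \<bar>b\<bar> \<partial>lborel)\<^sup>2"
  have c: "c < \<infinity>"
    unfolding c_def using std_normal_abs_moment_finite by (simp add: power2_eq_square ennreal_mult_less_top)
  have pwz: "(\<lambda>q. ennreal (p z (fst q) * w z (fst q) (snd q))) \<in> borel_measurable (borel \<Otimes>\<^sub>M borel)"
    "(\<integral>\<^sup>+q. ennreal (p z (fst q) * w z (fst q) (snd q)) \<partial>lborel) = 1" if z: "z \<in> ?S" for z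
  proof -
    note [measurable] = wz[OF z] positive_density_measurable[OF w[OF z]] positive_density_measurable[OF p[OF z]]
    show 1: "(\<lambda>q. ennreal (p z (fst q) * w z (fst q) (snd q))) \<in> borel_measurable (borel \<Otimes>\<^sub>M borel)"
      by measurable
    have "(\<integral>\<^sup>+q. ennreal (p z (fst q) * w z (fst q) (snd q)) \<partial>lborel) = (\<integral>\<^sup>+x. \<integral>\<^sup>+y. ennreal (p z x) * ennreal (w z x y) \<partial>lborel \<partial>lborel)"
      using ppos[OF z] wpos[OF z] by (subst nn_integral_lborel_pair[OF 1]) (simp add: ennreal_mult less_imp_le)
    also have "\<dots> = 1"
      by (simp add: nn_integral_cmult positive_density_integral[OF w[OF z]] positive_density_integral[OF p[OF z]])
    finally show "(\<integral>\<^sup>+q. ennreal (p z (fst q) * w z (fst q) (snd q)) \<partial>lborel) = 1" .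
  qed
  \<comment> \<open>The two parts of \<open>Z\<close> are integrated separately: the old part
    reduces to the past because the conditional pair density has mass one, and the new part has the
    absolute moment \<open>c\<close> for every past.\<close>
  have "integrable (PM (Suc n)) (\<lambda>\<omega>. u \<omega> * Z' (?R \<omega>))"
  proof (rule integrableI_bounded)
    show "(\<lambda>\<omega>. u \<omega> * Z' (?R \<omega>)) \<in> borel_measurable (PM (Suc n))"
      using measurable_last[of "\<lambda>z q. Z' z" n] um by simp
    then have "(\<integral>\<^sup>+\<omega>. ennreal (norm (u \<omega> * Z' (?R \<omega>))) \<partial>PM (Suc n))
      = (\<integral>\<^sup>+z. \<integral>\<^sup>+q. ennreal (norm (u (z(n := q)) * Z' (?R (z(n := q))))) \<partial>lborel \<partial>PM n)"
      by (intro nn_integral_PiM_Suc) simp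
    also have "\<dots> = (\<integral>\<^sup>+z. ennreal (norm (C z * Z' z)) \<partial>PM n)"
    proof (rule nn_integral_cong)
      fix z assume z: "z \<in> ?S"
      have "(\<integral>\<^sup>+q. ennreal (norm (u (z(n := q)) * Z' (?R (z(n := q))))) \<partial>lborel)
        = (\<integral>\<^sup>+q. ennreal (norm (C z * Z' z)) * ennreal (p z (fst q) * w z (fst q) (snd q)) \<partial>lborel)"
        using Cpos[OF z] ppos[OF z] wpos[OF z]
        by (intro nn_integral_cong) (simp add: Rupd[OF z] ueq[OF z] abs_mult ennreal_mult[symmetric] less_imp_le ac_simps)
      also have "\<dots> = ennreal (norm (C z * Z' z))"
        using pwz[OF z] by (subst nn_integral_cmult) (simp_all add: borel_prod)
      finally show "(\<integral>\<^sup>+q. ennreal (norm (u (z(n := q)) * Z' (?R (z(n := q))))) \<partial>lborel) = ennreal (norm (C z * Z' z))" .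
    qed
    also have "\<dots> < \<infinity>" using IHs(10) by (simp only: integrable_iff_bounded)
    finally show "(\<integral>\<^sup>+\<omega>. ennreal (norm (u \<omega> * Z' (?R \<omega>))) \<partial>PM (Suc n)) < \<infinity>" .
  qed
  moreover have "integrable (PM (Suc n)) (\<lambda>\<omega>. u \<omega> * A (?R \<omega>) (\<omega> n))"
  proof (rule integrableI_bounded)
    show "(\<lambda>\<omega>. u \<omega> * A (?R \<omega>) (\<omega> n)) \<in> borel_measurable (PM (Suc n))"
      using measurable_last[OF Am] um by simp
    then have "(\<integral>\<^sup>+\<omega>. ennreal (norm (u \<omega> * A (?R \<omega>) (\<omega> n))) \<partial>PM (Suc n))
      = (\<integral>\<^sup>+z. \<integral>\<^sup>+q. ennreal (norm (u (z(n := q)) * A (?R (z(n := q))) ((z(n := q)) n))) \<partial>lborel \<partial>PM n)"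
      by (intro nn_integral_PiM_Suc) simp
    also have "\<dots> = (\<integral>\<^sup>+z. ennreal (C z) * c \<partial>PM n)"
    proof (rule nn_integral_cong)
      fix z assume z: "z \<in> ?S"
      have "(\<integral>\<^sup>+q. ennreal (norm (u (z(n := q)) * A (?R (z(n := q))) ((z(n := q)) n))) \<partial>lborel)
        = (\<integral>\<^sup>+q. ennreal (C z) * ennreal (p z (fst q) * w z (fst q) (snd q) * \<bar>A z q\<bar>) \<partial>lborel)"
        using Cpos[OF z] ppos[OF z] wpos[OF z]
        by (intro nn_integral_cong) (simp add: Rupd[OF z] ueq[OF z] abs_mult ennreal_mult[symmetric] less_imp_le ac_simps)
      also have "\<dots> = ennreal (C z) * (\<integral>\<^sup>+q. ennreal (p z (fst q) * w z (fst q) (snd q) * \<bar>A z q\<bar>) \<partial>lborel)"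
      proof (rule nn_integral_cmult)
        have "(\<lambda>(z, q). ennreal (p z (fst q) * w z (fst q) (snd q) * \<bar>A z q\<bar>)) \<in> borel_measurable (PM n \<Otimes>\<^sub>M borel)"
          by measurable
        from measurable_Pair2[OF this z]
        show "(\<lambda>q. ennreal (p z (fst q) * w z (fst q) (snd q) * \<bar>A z q\<bar>)) \<in> borel_measurable lborel" by simp
      qed
      finally show "(\<integral>\<^sup>+q. ennreal (norm (u (z(n := q)) * A (?R (z(n := q))) ((z(n := q)) n))) \<partial>lborel) = ennreal (C z) * c"
        unfolding A_def c_def nn_integral_pair_abs_rank[OF p[OF z] w[OF z] wz[OF z]] .
    qed
    also have "\<dots> = (\<integral>\<^sup>+z. ennreal (C z) \<partial>PM n) * c"
      by (rule nn_integral_multc) measurable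
    also have "(\<integral>\<^sup>+z. ennreal (C z) \<partial>PM n) = 1"
      unfolding C_def by (rule marginal_past_total[OF ctx])
    also have "1 * c < \<infinity>" using c by simp
    finally show "(\<integral>\<^sup>+\<omega>. ennreal (norm (u \<omega> * A (?R \<omega>) (\<omega> n))) \<partial>PM (Suc n)) < \<infinity>" .
  qed
  ultimately have Zint: "integrable (PM (Suc n)) (\<lambda>\<omega>. u \<omega> * Z \<omega>)"
    unfolding Z_def distrib_left by (rule Bochner_Integration.integrable_add)
  have "(\<integral>\<omega>. u \<omega> * Z \<omega> \<partial>PM (Suc n)) = (\<integral>z. \<integral>q. u (z(n := q)) * Z (z(n := q)) \<partial>lborel \<partial>PM n)"
    using PS.product_integral_insert[of "{..<n}" n "\<lambda>\<omega>. u \<omega> * Z \<omega>"] Zint by (simp add: lessThan_Suc)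
  also have "\<dots> = (\<integral>z. C z * Z' z \<partial>PM n)"
  proof (rule Bochner_Integration.integral_cong)
    fix z assume z: "z \<in> ?S"
    have pw: "integrable lborel (\<lambda>q. p z (fst q) * w z (fst q) (snd q))" "(\<integral>q. p z (fst q) * w z (fst q) (snd q) \<partial>lborel) = 1"
    proof -
      have "(\<lambda>(z, q). p z (fst q) * w z (fst q) (snd q)) \<in> borel_measurable (PM n \<Otimes>\<^sub>M borel)" by measurable
      from measurable_Pair2[OF this z]
      have m: "(\<lambda>q. p z (fst q) * w z (fst q) (snd q)) \<in> borel_measurable lborel" by simp
      show "integrable lborel (\<lambda>q. p z (fst q) * w z (fst q) (snd q))"
        using m pwz(2)[OF z] ppos[OF z] wpos[OF z] by (intro integrableI_nn_integral_finite[where x=1]) (auto simp: less_imp_le)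
      show "(\<integral>q. p z (fst q) * w z (fst q) (snd q) \<partial>lborel) = 1"
        using m pwz(2)[OF z] ppos[OF z] wpos[OF z] by (intro integral_eq_nn_integral[THEN trans]) (auto simp: less_imp_le)
    qed
    note rp = pair_rank_product[OF p[OF z] w[OF z] wz[OF z]]
    \<comment> \<open>For each fixed past the new rank product integrates to zero, so only the old
      term survives and the induction hypothesis finishes the mean-zero claim.\<close>
    have "(\<integral>q. u (z(n := q)) * Z (z(n := q)) \<partial>lborel)
      = (\<integral>q. C z * Z' z * (p z (fst q) * w z (fst q) (snd q)) + C z * (p z (fst q) * w z (fst q) (snd q) * A z q) \<partial>lborel)"
      by (intro Bochner_Integration.integral_cong) (simp_all add: Z_def Rupd[OF z] ueq[OF z] algebra_simps)
    also have "\<dots> = C z * Z' z"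
      using pw rp by (simp add: A_def)
    finally show "(\<integral>q. u (z(n := q)) * Z (z(n := q)) \<partial>lborel) = C z * Z' z" .
  qed simp
  finally have "(\<integral>\<omega>. u \<omega> * Z \<omega> \<partial>PM (Suc n)) = 0" by (simp add: IHs(11))
  then have "pair_factorization \<theta> (Suc n) u P Q Z"
    unfolding pair_factorization_def using Pm Qm Zm PQ I1 I2 I3 Zint by (simp add: k_def)
  then show ?thesis by blast
qed

lemma pair_factorization_exists:
  assumes \<theta>: "0 < \<theta>" "\<theta> < 1"
    and "u \<in> borel_measurable (PM n)"
    and "\<And>z. z \<in> space (PM n) \<Longrightarrow> 0 < u z"
    and "(\<integral>\<^sup>+z. ennreal (u z) \<partial>PM n) = 1"
    and "\<And>z z'. z \<in> space (PM n) \<Longrightarrow> z' \<in> space (PM n) \<Longrightarrow> u z * u z' \<le> u (inf z z') * u (sup z z')"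
  shows "\<exists>P Q Z. pair_factorization \<theta> n u P Q Z"
  using assms(3-)
proof (induction n arbitrary: u)
  case 0
  \<comment> \<open>The empty product is a single point of mass one. Normalisation forces
    \<open>u\<close> to be 1 there, and the empty products and the empty sum serve as
    witnesses.\<close>
  have PM0: "PM 0 = count_space {\<lambda>_. undefined}" "PiM {..<0::nat} (\<lambda>_. lborel :: real measure) = count_space {\<lambda>_. undefined}"
    by (simp_all only: lessThan_0 PiM_empty)
  have "ennreal (u (\<lambda>_. undefined)) = 1"
    using 0(3) unfolding PM0 by (simp only: nn_integral_count_space_finite finite.intros sum.insert sum.empty) simp
  then have "u (\<lambda>_. undefined) = 1" by (simp only: ennreal_eq_1)
  moreover have "(\<lambda>i\<in>{..<0::nat}. g i) = (\<lambda>_. undefined)" for g :: "nat \<Rightarrow> real"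
    by (simp add: fun_eq_iff)
  ultimately have "pair_factorization \<theta> 0 u (\<lambda>_. 1) (\<lambda>_. 1) (\<lambda>_. 0)"
    unfolding pair_factorization_def PM0 by (simp add: nn_integral_count_space_finite)
  then show ?case by blast
next
  case (Suc n)
  have "\<exists>P Q Z. pair_factorization \<theta> n (marginal_past n u) P Q Z"
  proof (rule Suc.IH)
    show "marginal_past n u \<in> borel_measurable (PM n)" by (rule marginal_past_measurable[OF Suc.prems])
    show "(\<integral>\<^sup>+z. ennreal (marginal_past n u z) \<partial>PM n) = 1" by (rule marginal_past_total[OF Suc.prems])
    fix z assume z: "z \<in> space (PM n)"
    show "0 < marginal_past n u z" by (rule marginal_past_pos[OF Suc.prems z])
    fix z' assume z': "z' \<in> space (PM n)"
    show "marginal_past n u z * marginal_past n u z' \<le> marginal_past n u (inf z z') * marginal_past n u (sup z z')"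
      by (rule marginal_past_lsm[OF Suc.prems z z'])
  qed
  then show ?case using pair_factorization_step[OF \<theta> Suc.prems] by blast
qed

section \<open>Entropies\<close>

lemma emeasure_lborel_box_vec:
  fixes l u :: "real^'d"
  assumes "\<And>i. l $ i \<le> u $ i"
  shows "emeasure lborel (box l u) = (\<Prod>i\<in>UNIV. ennreal (u $ i - l $ i))"
proof -
  have inj: "inj (\<lambda>i::'d. axis i (1::real))" by (auto simp: inj_on_def axis_eq_axis)
  have B: "(Basis :: (real^'d) set) = range (\<lambda>i. axis i 1)" by (auto simp: Basis_vec_def)
  have "emeasure lborel (box l u) = ennreal (\<Prod>b\<in>Basis. (u - l) \<bullet> b)"
    using assms by (intro emeasure_lborel_box) (auto simp: B inner_axis)
  also have "(\<Prod>b\<in>Basis. (u - l) \<bullet> b) = (\<Prod>i\<in>UNIV. u $ i - l $ i)"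
    unfolding B by (subst prod.reindex[OF inj]) (simp add: inner_axis)
  also have "ennreal \<dots> = (\<Prod>i\<in>UNIV. ennreal (u $ i - l $ i))"
    using assms by (simp add: prod_ennreal)
  finally show ?thesis .
qed

context
  fixes e :: "nat \<Rightarrow> 'd::finite"
  assumes e: "bij_betw e {..<CARD('d)} UNIV"
begin

text \<open>The index type has no distinguished order; the enumeration \<open>e\<close> numbers its
  elements, so that the induction on the number of pairs applies to vectors.\<close>

definition vec_of :: "(nat \<Rightarrow> real) \<Rightarrow> real^'d" where
  "vec_of s = (\<chi> i. s (the_inv_into {..<CARD('d)} e i))"

definition vecs_of :: "(nat \<Rightarrow> real \<times> real) \<Rightarrow> (real^'d) \<times> (real^'d)" where
  "vecs_of z = (vec_of (\<lambda>k. fst (z k)), vec_of (\<lambda>k. snd (z k)))"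

definition coords_of :: "(real^'d) \<times> (real^'d) \<Rightarrow> nat \<Rightarrow> real \<times> real" where
  "coords_of q = (\<lambda>k\<in>{..<CARD('d)}. (fst q $ e k, snd q $ e k))"

lemma inv_less: "the_inv_into {..<CARD('d)} e i < CARD('d)"
  using e the_inv_into_into[of e "{..<CARD('d)}" i "{..<CARD('d)}"] by (auto simp: bij_betw_def)

lemma e_inv [simp]: "e (the_inv_into {..<CARD('d)} e i) = i"
  using e by (auto simp: bij_betw_def intro: f_the_inv_into_f)

lemma inv_e: "k < CARD('d) \<Longrightarrow> the_inv_into {..<CARD('d)} e (e k) = k"
  using e by (auto simp: bij_betw_def intro: the_inv_into_f_f)

lemma vec_of_cong: "(\<And>k. k < CARD('d) \<Longrightarrow> s k = s' k) \<Longrightarrow> vec_of s = vec_of s'"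
  by (simp add: vec_of_def inv_less vec_eq_iff)

lemma vec_of_restrict [simp]: "vec_of (restrict s {..<CARD('d)}) = vec_of s"
  by (rule vec_of_cong) simp

lemma vecs_of_coords_of [simp]: "vecs_of (coords_of q) = q"
  by (simp add: vecs_of_def coords_of_def vec_of_def inv_less prod_eq_iff vec_eq_iff)

lemma coords_of_vecs_of: "z \<in> space (PM CARD('d)) \<Longrightarrow> coords_of (vecs_of z) = z"
  by (auto simp: fun_eq_iff vecs_of_def coords_of_def vec_of_def inv_e space_PiM PiE_def extensional_def)

lemma measurable_vec_of: "vec_of \<in> measurable (PiM {..<CARD('d)} (\<lambda>_. lborel)) borel"
proof -
  have "(\<lambda>s. vec_of s \<bullet> b) \<in> borel_measurable (PiM {..<CARD('d)} (\<lambda>_. lborel))" if b: "b \<in> Basis" for b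
  proof -
    obtain i where "b = axis i 1" using b by (auto simp: Basis_vec_def)
    then have "(\<lambda>s. vec_of s \<bullet> b) = (\<lambda>s. s (the_inv_into {..<CARD('d)} e i))"
      by (simp add: vec_of_def inner_axis)
    moreover have "(\<lambda>s. s (the_inv_into {..<CARD('d)} e i)) \<in> measurable (PiM {..<CARD('d)} (\<lambda>_. lborel)) (lborel :: real measure)"
      by (rule measurable_component_singleton) (simp add: inv_less)
    ultimately show ?thesis by simp
  qed
  then show ?thesis by (subst borel_measurable_euclidean_space) simp
qed

lemma measurable_vecs_of: "vecs_of \<in> measurable (PM CARD('d)) borel"
proof -
  have f: "(fst :: real \<times> real \<Rightarrow> real) \<in> borel_measurable borel" "(snd :: real \<times> real \<Rightarrow> real) \<in> borel_measurable borel"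
    unfolding borel_prod[symmetric] by measurable
  note m = measurable_compose[OF measurable_comp_PiM[OF f(1)] measurable_vec_of]
    measurable_compose[OF measurable_comp_PiM[OF f(2)] measurable_vec_of]
  from measurable_Pair[OF m] show ?thesis
    by (simp add: vecs_of_def[abs_def] borel_prod)
qed

lemma measurable_coords_of: "coords_of \<in> measurable borel (PM CARD('d))"
  unfolding coords_of_def
proof (rule measurable_restrict)
  fix k
  have "(\<lambda>q :: (real^'d) \<times> (real^'d). (fst q $ e k, snd q $ e k)) \<in> borel_measurable borel"
    by (intro borel_measurable_continuous_onI continuous_intros)
  then show "(\<lambda>q :: (real^'d) \<times> (real^'d). (fst q $ e k, snd q $ e k)) \<in> measurable borel lborel" by simp
qed

lemma distr_vec_of: "distr (PiM {..<CARD('d)} (\<lambda>_. lborel)) borel vec_of = lborel"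
proof (rule lborel_eqI[symmetric])
  fix l u :: "real^'d" assume "\<And>b. b \<in> Basis \<Longrightarrow> l \<bullet> b \<le> u \<bullet> b"
  then have lu: "l $ i \<le> u $ i" for i
    using Basis_vec_def by (metis axis_in_Basis_iff cart_eq_inner_axis real_inner_1_left Basis_real_def insertI1)
  have "emeasure (distr (PiM {..<CARD('d)} (\<lambda>_. lborel)) borel vec_of) (box l u)
    = emeasure (PiM {..<CARD('d)} (\<lambda>_. lborel)) (PiE {..<CARD('d)} (\<lambda>k. {l $ e k<..<u $ e k}))"
  proof (subst emeasure_distr[OF measurable_vec_of])
    show "emeasure (PiM {..<CARD('d)} (\<lambda>_. lborel)) (vec_of -` box l u \<inter> space (PiM {..<CARD('d)} (\<lambda>_. lborel)))
      = emeasure (PiM {..<CARD('d)} (\<lambda>_. lborel)) (PiE {..<CARD('d)} (\<lambda>k. {l $ e k<..<u $ e k}))"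
    proof (rule arg_cong[where f = "emeasure _"], intro set_eqI iffI)
      fix s assume s: "s \<in> vec_of -` box l u \<inter> space (PiM {..<CARD('d)} (\<lambda>_. lborel))"
      then have "l $ e k < s k \<and> s k < u $ e k" if "k < CARD('d)" for k
        using inv_e[OF that] by (auto simp: mem_box_cart vec_of_def dest: spec[of _ "e k"])
      then show "s \<in> PiE {..<CARD('d)} (\<lambda>k. {l $ e k<..<u $ e k})"
        using s by (auto simp: space_PiM PiE_def)
    next
      fix s assume s: "s \<in> PiE {..<CARD('d)} (\<lambda>k. {l $ e k<..<u $ e k})"
      have "s (the_inv_into {..<CARD('d)} e i) \<in> {l $ i<..<u $ i}" for i
        using PiE_mem[OF s, of "the_inv_into {..<CARD('d)} e i"] by (simp add: inv_less)
      then show "s \<in> vec_of -` box l u \<inter> space (PiM {..<CARD('d)} (\<lambda>_. lborel))"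
        using s by (auto simp: mem_box_cart vec_of_def space_PiM PiE_def)
    qed
  qed simp
  also have "\<dots> = (\<Prod>k<CARD('d). emeasure lborel {l $ e k<..<u $ e k})"
    by (rule PS.emeasure_PiM) auto
  also have "\<dots> = (\<Prod>k<CARD('d). ennreal (u $ e k - l $ e k))" using lu by simp
  also have "\<dots> = (\<Prod>i\<in>UNIV. ennreal (u $ i - l $ i))" by (rule prod.reindex_bij_betw[OF e])
  also have "\<dots> = emeasure lborel (box l u)" by (rule emeasure_lborel_box_vec[OF lu, symmetric])
  also have "\<dots> = ennreal (\<Prod>b\<in>Basis. (u - l) \<bullet> b)" by (rule emeasure_lborel_box) fact
  finally show "emeasure (distr (PiM {..<CARD('d)} (\<lambda>_. lborel)) borel vec_of) (box l u) = ennreal (\<Prod>b\<in>Basis. (u - l) \<bullet> b)" .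
qed simp

text \<open>Lebesgue measure is determined by boxes. A box in the product of the two vector spaces
  becomes, after interleaving, a product of rectangles, one for each pair, and the enumeration
  merely permutes the factors of its volume.\<close>

lemma distr_vecs_of: "distr (PM CARD('d)) borel vecs_of = lborel"
proof (rule lborel_eqI[symmetric])
  fix l u :: "(real^'d) \<times> (real^'d)" assume A: "\<And>b. b \<in> Basis \<Longrightarrow> l \<bullet> b \<le> u \<bullet> b"
  obtain l1 l2 u1 u2 where lu: "l = (l1, l2)" "u = (u1, u2)" by force
  have 1: "l1 $ i \<le> u1 $ i" for i
    using A[of "(axis i 1, 0)"] by (simp add: lu Basis_prod_def inner_axis axis_in_Basis_iff)
  have 2: "l2 $ i \<le> u2 $ i" for i
    using A[of "(0, axis i 1)"] by (simp add: lu Basis_prod_def inner_axis axis_in_Basis_iff)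
  let ?A = "\<lambda>k. {l1 $ e k<..<u1 $ e k} \<times> {l2 $ e k<..<u2 $ e k}"
  have box: "box l u = box l1 u1 \<times> box l2 u2"
    by (auto simp: lu box_def Basis_prod_def ball_Un)
  have "emeasure (distr (PM CARD('d)) borel vecs_of) (box l u) = emeasure (PM CARD('d)) (PiE {..<CARD('d)} ?A)"
  proof (subst emeasure_distr[OF measurable_vecs_of])
    show "emeasure (PM CARD('d)) (vecs_of -` box l u \<inter> space (PM CARD('d))) = emeasure (PM CARD('d)) (PiE {..<CARD('d)} ?A)"
    proof (rule arg_cong[where f = "emeasure _"], intro set_eqI iffI)
      fix s assume s: "s \<in> vecs_of -` box l u \<inter> space (PM CARD('d))"
      then have "s k \<in> ?A k" if "k < CARD('d)" for k
        using inv_e[OF that] by (auto simp: box vecs_of_def mem_box_cart vec_of_def mem_Times_iff dest: spec[of _ "e k"])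
      then show "s \<in> PiE {..<CARD('d)} ?A"
        using s by (auto simp: space_PiM PiE_def)
    next
      fix s assume s: "s \<in> PiE {..<CARD('d)} ?A"
      have "s (the_inv_into {..<CARD('d)} e i) \<in> {l1 $ i<..<u1 $ i} \<times> {l2 $ i<..<u2 $ i}" for i
        using PiE_mem[OF s, of "the_inv_into {..<CARD('d)} e i"] by (simp add: inv_less)
      then show "s \<in> vecs_of -` box l u \<inter> space (PM CARD('d))"
        using s by (auto simp: box vecs_of_def mem_box_cart vec_of_def space_PiM PiE_def mem_Times_iff)
    qed
  qed simp
  also have "\<dots> = (\<Prod>k<CARD('d). emeasure lborel (?A k))"
    by (rule PS.emeasure_PiM) (auto intro!: borel_open open_Times)
  also have "\<dots> = (\<Prod>k<CARD('d). ennreal (u1 $ e k - l1 $ e k) * ennreal (u2 $ e k - l2 $ e k))"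
    by (intro prod.cong refl, subst lborel_prod[symmetric], subst lborel.emeasure_pair_measure_Times)
       (use 1 2 in auto)
  also have "\<dots> = (\<Prod>i\<in>UNIV. ennreal (u1 $ i - l1 $ i)) * (\<Prod>i\<in>UNIV. ennreal (u2 $ i - l2 $ i))"
    by (simp only: prod.distrib prod.reindex_bij_betw[OF e, of "\<lambda>i. ennreal (u1 $ i - l1 $ i)"]
        prod.reindex_bij_betw[OF e, of "\<lambda>i. ennreal (u2 $ i - l2 $ i)"])
  also have "\<dots> = emeasure lborel (box l1 u1) * emeasure lborel (box l2 u2)"
    by (simp only: emeasure_lborel_box_vec[OF 1] emeasure_lborel_box_vec[OF 2])
  also have "\<dots> = emeasure lborel (box l u)"
    unfolding box by (subst lborel_prod[symmetric], subst lborel.emeasure_pair_measure_Times) auto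
  also have "\<dots> = ennreal (\<Prod>b\<in>Basis. (u - l) \<bullet> b)" by (rule emeasure_lborel_box) fact
  finally show "emeasure (distr (PM CARD('d)) borel vecs_of) (box l u) = ennreal (\<Prod>b\<in>Basis. (u - l) \<bullet> b)" .
qed simp

lemma nn_integral_vec_of:
  assumes "r \<in> borel_measurable borel"
  shows "(\<integral>\<^sup>+s. r (vec_of s) \<partial>PiM {..<CARD('d)} (\<lambda>_. lborel)) = (\<integral>\<^sup>+x. r x \<partial>lborel)"
  using assms by (subst distr_vec_of[symmetric], subst nn_integral_distr) (simp_all add: measurable_vec_of)

lemma nn_integral_vecs_of:
  assumes "r \<in> borel_measurable borel"
  shows "(\<integral>\<^sup>+z. r (vecs_of z) \<partial>PM CARD('d)) = (\<integral>\<^sup>+x. r x \<partial>lborel)"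
  using assms by (subst distr_vecs_of[symmetric], subst nn_integral_distr) (simp_all add: measurable_vecs_of)

lemma log_supermodular_coords:
  assumes "log_supermodular f"
  shows "f (vecs_of z) * f (vecs_of z') \<le> f (vecs_of (inf z z')) * f (vecs_of (sup z z'))"
proof -
  have "vecs_of (inf z z') = (vmin (fst (vecs_of z)) (fst (vecs_of z')), vmin (snd (vecs_of z)) (snd (vecs_of z')))"
    "vecs_of (sup z z') = (vmax (fst (vecs_of z)) (fst (vecs_of z')), vmax (snd (vecs_of z)) (snd (vecs_of z')))"
    by (simp_all add: vecs_of_def vec_of_def vmin_def vmax_def inf_prod_def sup_prod_def inf_min sup_max)
  then show ?thesis using assms unfolding log_supermodular_def by (metis prod.collapse)
qed

end

lemma vector_factorization:
  fixes f :: "(real^'d) \<times> (real^'d) \<Rightarrow> real"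
  assumes \<theta>: "0 < \<theta>" "\<theta> < 1"
    and fm: "f \<in> borel_measurable borel" and lsm: "log_supermodular f" and tot: "(\<integral>\<^sup>+q. ennreal (f q) \<partial>lborel) = 1"
  obtains P Q Z :: "(real^'d) \<times> (real^'d) \<Rightarrow> real"
  where "P \<in> borel_measurable borel" "Q \<in> borel_measurable borel" "Z \<in> borel_measurable borel"
    and "\<And>q. 0 < P q" "\<And>q. 0 < Q q" "\<And>q. f q = P q * Q q"
    and "\<And>r. r \<in> borel_measurable borel \<Longrightarrow> (\<integral>\<^sup>+q. ennreal (P q) * r (snd q) \<partial>lborel) \<le> (\<integral>\<^sup>+y. r y \<partial>lborel)"
    and "\<And>r. r \<in> borel_measurable borel \<Longrightarrow> (\<integral>\<^sup>+q. ennreal (Q q) * r (fst q) \<partial>lborel) \<le> (\<integral>\<^sup>+x. r x \<partial>lborel)"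
    and "\<And>r. r \<in> borel_measurable borel \<Longrightarrow>
      (\<integral>\<^sup>+q. ennreal (P q powr (1 - \<theta>) * Q q powr \<theta> * exp (real CARD('d) * mixing_entropy \<theta> + sqrt (\<theta> * (1 - \<theta>)) * Z q))
        * r (fst q + snd q) \<partial>lborel) \<le> (\<integral>\<^sup>+s. r s \<partial>lborel)"
    and "integrable lborel (\<lambda>q. f q * Z q)" "(\<integral>q. f q * Z q \<partial>lborel) = 0"
proof -
  obtain e :: "nat \<Rightarrow> 'd" where e: "bij_betw e {..<CARD('d)} UNIV"
    using ex_bij_betw_nat_finite[of "UNIV :: 'd set"] by (auto simp: atLeast0LessThan)
  let ?v = "vecs_of e" and ?c = "coords_of e" and ?d = "CARD('d)"
  note vm [measurable] = measurable_vecs_of[OF e] and cm [measurable] = measurable_coords_of[OF e]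
  note [measurable] = fm
  have pos: "0 < f q" for q using lsm unfolding log_supermodular_def by blast
  obtain P Q Z where F: "pair_factorization \<theta> ?d (\<lambda>z. f (?v z)) P Q Z"
  proof -
    have "\<exists>P Q Z. pair_factorization \<theta> ?d (\<lambda>z. f (?v z)) P Q Z"
    proof (rule pair_factorization_exists[OF \<theta>])
      show "(\<lambda>z. f (?v z)) \<in> borel_measurable (PM ?d)" by measurable
      show "(\<integral>\<^sup>+z. ennreal (f (?v z)) \<partial>PM ?d) = 1"
        using nn_integral_vecs_of[OF e, of "\<lambda>q. ennreal (f q)"] tot by simp
      show "f (?v z) * f (?v z') \<le> f (?v (inf z z')) * f (?v (sup z z'))" for z z'
        by (rule log_supermodular_coords[OF e lsm])
    qed (rule pos)
    then show ?thesis using that by blast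
  qed
  note F = F[unfolded pair_factorization_def]
  have [measurable]: "P \<in> borel_measurable (PM ?d)" "Q \<in> borel_measurable (PM ?d)" "Z \<in> borel_measurable (PM ?d)"
    using F by auto
  have F1: "0 < P z" "0 < Q z" "f (?v z) = P z * Q z" if "z \<in> space (PM ?d)" for z using F that by auto
  have csp: "?c q \<in> space (PM ?d)" for q using measurable_space[OF cm, of q] by simp
  have fsm: "(fst :: (real^'d) \<times> (real^'d) \<Rightarrow> real^'d) \<in> borel_measurable borel" "(snd :: (real^'d) \<times> (real^'d) \<Rightarrow> real^'d) \<in> borel_measurable borel"
    unfolding borel_prod[symmetric] by measurable
  have cv: "?c (?v z) = z" if "z \<in> space (PM ?d)" for z by (rule coords_of_vecs_of[OF e that])
  have vr: "vec_of e (restrict s {..<?d}) = vec_of e s" for s by (rule vec_of_restrict[OF e])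
  \<comment> \<open>The three bounds differ only in the weight \<open>G\<close> and in the map
    \<open>p\<close> applied to each pair, so one argument carries all of them over; \<pi> is the
    vector form of \<open>p\<close>.\<close>
  have transfer: "(\<integral>\<^sup>+q. ennreal (G (?c q)) * r (\<pi> q) \<partial>lborel) \<le> (\<integral>\<^sup>+s. r s \<partial>lborel)"
    if le: "\<forall>r\<in>borel_measurable (PiM {..<?d} (\<lambda>_. lborel)). (\<integral>\<^sup>+z. ennreal (G z) * r (\<lambda>i\<in>{..<?d}. p (z i)) \<partial>PM ?d) \<le> (\<integral>\<^sup>+s. r s \<partial>PiM {..<?d} (\<lambda>_. lborel))"
      and Gm [measurable]: "G \<in> borel_measurable (PM ?d)" and pm [measurable]: "\<pi> \<in> borel_measurable borel"
      and r [measurable]: "r \<in> borel_measurable borel" and pp: "\<And>z. \<pi> (?v z) = vec_of e (\<lambda>i. p (z i))"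
    for G and p :: "real \<times> real \<Rightarrow> real" and \<pi> :: "(real^'d) \<times> (real^'d) \<Rightarrow> real^'d" and r :: "real^'d \<Rightarrow> ennreal"
  proof -
    have "(\<integral>\<^sup>+q. ennreal (G (?c q)) * r (\<pi> q) \<partial>lborel) = (\<integral>\<^sup>+z. ennreal (G (?c (?v z))) * r (\<pi> (?v z)) \<partial>PM ?d)"
      by (rule nn_integral_vecs_of[OF e, symmetric]) measurable
    also have "\<dots> = (\<integral>\<^sup>+z. ennreal (G z) * r (vec_of e (\<lambda>i\<in>{..<?d}. p (z i))) \<partial>PM ?d)"
      by (intro nn_integral_cong) (simp add: cv pp vr)
    also have "\<dots> \<le> (\<integral>\<^sup>+s. r (vec_of e s) \<partial>PiM {..<?d} (\<lambda>_. lborel))"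
      using bspec[OF le measurable_compose[OF measurable_vec_of[OF e] r]] .
    also have "\<dots> = (\<integral>\<^sup>+s. r s \<partial>lborel)" by (rule nn_integral_vec_of[OF e r])
    finally show ?thesis .
  qed
  show ?thesis
  proof (rule that[of "\<lambda>q. P (?c q)" "\<lambda>q. Q (?c q)" "\<lambda>q. Z (?c q)"])
    show "(\<lambda>q. P (?c q)) \<in> borel_measurable borel" "(\<lambda>q. Q (?c q)) \<in> borel_measurable borel"
      "(\<lambda>q. Z (?c q)) \<in> borel_measurable borel" by measurable
    show "0 < P (?c q)" "0 < Q (?c q)" "f q = P (?c q) * Q (?c q)" for q
      using F1[OF csp] by (simp_all add: vecs_of_coords_of[OF e])
    fix r :: "real^'d \<Rightarrow> ennreal" assume r: "r \<in> borel_measurable borel"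
    show "(\<integral>\<^sup>+q. ennreal (P (?c q)) * r (snd q) \<partial>lborel) \<le> (\<integral>\<^sup>+y. r y \<partial>lborel)"
      by (rule transfer[of P snd]) (use F r fsm in \<open>simp_all add: vecs_of_def[OF e]\<close>)
    show "(\<integral>\<^sup>+q. ennreal (Q (?c q)) * r (fst q) \<partial>lborel) \<le> (\<integral>\<^sup>+x. r x \<partial>lborel)"
      by (rule transfer[of Q fst]) (use F r fsm in \<open>simp_all add: vecs_of_def[OF e]\<close>)
    show "(\<integral>\<^sup>+q. ennreal (P (?c q) powr (1 - \<theta>) * Q (?c q) powr \<theta> * exp (real ?d * mixing_entropy \<theta> + sqrt (\<theta> * (1 - \<theta>)) * Z (?c q)))
        * r (fst q + snd q) \<partial>lborel) \<le> (\<integral>\<^sup>+s. r s \<partial>lborel)"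
      by (rule transfer[of "\<lambda>z. P z powr (1 - \<theta>) * Q z powr \<theta> * exp (real ?d * mixing_entropy \<theta> + sqrt (\<theta> * (1 - \<theta>)) * Z z)"
            "\<lambda>q. fst q + snd q"])
         (use F r borel_measurable_add[OF fsm] in \<open>simp_all add: vecs_of_def[OF e] vec_of_def[OF e] vec_eq_iff\<close>)
  next
    have I: "integrable (PM ?d) (\<lambda>z. f (?v z) * Z (?c (?v z)))"
      by (rule Bochner_Integration.integrable_cong[THEN iffD1, OF refl _ F[THEN conjunct2, THEN conjunct2, THEN conjunct2, THEN conjunct2, THEN conjunct2, THEN conjunct2, THEN conjunct2, THEN conjunct1]])
         (simp add: cv)
    then show "integrable lborel (\<lambda>q. f q * Z (?c q))"
      by (subst distr_vecs_of[OF e, symmetric], subst integrable_distr_eq) simp_all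
    have "(\<integral>q. f q * Z (?c q) \<partial>lborel) = (\<integral>z. f (?v z) * Z (?c (?v z)) \<partial>PM ?d)"
      by (subst distr_vecs_of[OF e, symmetric], subst integral_distr) simp_all
    also have "\<dots> = (\<integral>z. f (?v z) * Z z \<partial>PM ?d)"
      by (intro Bochner_Integration.integral_cong refl) (simp add: cv)
    also have "\<dots> = 0" using F by blast
    finally show "(\<integral>q. f q * Z (?c q) \<partial>lborel) = 0" .
  qed
qed


section \<open>From the weighted bounds to the entropy inequality\<close>

lemma exp_add_le_of_mixing:
  fixes a b d s :: real
  assumes le: "\<And>\<theta>. 0 < \<theta> \<Longrightarrow> \<theta> < 1 \<Longrightarrow> \<theta> * a + (1 - \<theta>) * b + d * mixing_entropy \<theta> \<le> s" and d: "0 < d"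
  shows "exp (2 / d * a) + exp (2 / d * b) \<le> exp (2 / d * s)"
proof -
  define A B where "A = exp (2 / d * a)" and "B = exp (2 / d * b)"
  \<comment> \<open>The maximiser in Gibbs' variational formula: at this weight the left side of
    \<open>le\<close> equals \<open>d / 2 * ln (A + B)\<close>.\<close>
  define \<theta> where "\<theta> = A / (A + B)"
  have AB: "0 < A" "0 < B" by (auto simp: A_def B_def)
  have AB': "0 < A + B" using AB by simp
  have \<theta>: "0 < \<theta>" "\<theta> < 1" and c: "1 - \<theta> = B / (A + B)" using AB AB' by (auto simp: \<theta>_def field_simps)
  have la: "a = d / 2 * ln A" "b = d / 2 * ln B" using d by (simp_all add: A_def B_def)
  have lt: "ln \<theta> = ln A - ln (A + B)" "ln (1 - \<theta>) = ln B - ln (A + B)"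
    unfolding c using AB AB' by (simp_all add: \<theta>_def ln_div)
  have "\<theta> * a + (1 - \<theta>) * b + d * mixing_entropy \<theta> = d / 2 * ln (A + B)"
    unfolding mixing_entropy_def lt unfolding la by (simp add: field_simps)
  with le[OF \<theta>] have "d / 2 * ln (A + B) \<le> s" by simp
  then have "ln (A + B) \<le> 2 / d * s" using d by (simp add: field_simps)
  then have "A + B \<le> exp (2 / d * s)" using AB' by (metis exp_le_cancel_iff exp_ln)
  then show ?thesis by (simp add: A_def B_def)
qed

text \<open>The laws of X, Y and X + Y may have densities with zeros, while the bound ln t \<le> t -
  1 is applied to positive t; a random vector almost surely avoids the zeros of its own
  density.\<close>

lemma distributed_AE_pos:
  fixes g :: "'b::euclidean_space \<Rightarrow> real"
  assumes D: "distributed M lborel X (\<lambda>x. ennreal (g x))" and g: "\<And>x. 0 \<le> g x"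
  shows "AE \<omega> in M. 0 < g (X \<omega>)"
proof -
  have [measurable]: "g \<in> borel_measurable borel"
    using distributed_real_measurable[OF g D] by simp
  have X [measurable]: "X \<in> measurable M borel" using distributed_measurable[OF D] by simp
  have "(\<integral>\<^sup>+\<omega>. indicator {x. g x = 0} (X \<omega>) \<partial>M) = (\<integral>\<^sup>+x. ennreal (g x) * indicator {x. g x = 0} x \<partial>lborel)"
    by (rule distributed_nn_integral[OF D, symmetric]) simp
  also have "\<dots> = (\<integral>\<^sup>+x. 0 \<partial>(lborel :: 'b measure))" by (intro nn_integral_cong) (auto simp: indicator_def)
  finally have "(\<integral>\<^sup>+\<omega>. indicator {x. g x = 0} (X \<omega>) \<partial>M) = (0 :: ennreal)" by simp
  then have "AE \<omega> in M. indicator {x. g x = 0} (X \<omega>) = (0 :: ennreal)"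
    by (subst (asm) nn_integral_0_iff_AE) simp_all
  then show ?thesis
  proof eventually_elim
    case (elim \<omega>)
    then show ?case using g[of "X \<omega>"] by (auto simp: indicator_def split: if_splits)
  qed
qed

lemma integrable_integral_le_1:
  assumes m: "T \<in> borel_measurable M" and nn: "\<And>x. 0 \<le> T x" and le: "(\<integral>\<^sup>+x. ennreal (T x) \<partial>M) \<le> 1"
  shows "integrable M T" and "(\<integral>x. T x \<partial>M) \<le> 1"
proof -
  show I: "integrable M T"
    using m nn le_less_trans[OF le] by (intro integrableI_nonneg) auto
  have "ennreal (\<integral>x. T x \<partial>M) \<le> 1"
    using le nn_integral_eq_integral[OF I] nn by simp
  then show "(\<integral>x. T x \<partial>M) \<le> 1" by (simp add: ennreal_le_1)
qed

text \<open>Three nonnegative variables \<open>T1\<close>, \<open>T2\<close>, \<open>T3\<close> have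
  mean at most one. In ln T1 + \<theta> ln T2 + (1 - \<theta>) ln T3 the coefficients of ln P and of
  ln Q both become -1 and combine to -ln f. Only logarithms with known integrals remain, and each
  expectation is an entropy, up to sign.\<close>

lemma linearized_entropy_inequality:
  fixes M :: "'w measure"
    and X Y :: "'w \<Rightarrow> real^'d"
    and f :: "(real^'d) \<times> (real^'d) \<Rightarrow> real"
    and fX fY fS :: "real^'d \<Rightarrow> real"
  assumes "prob_space M"
    and joint: "distributed M lborel (\<lambda>\<omega>. (X \<omega>, Y \<omega>)) (\<lambda>z. ennreal (f z))"
    and lsm: "log_supermodular f"
    and densX: "distributed M lborel X (\<lambda>x. ennreal (fX x))" "\<And>x. 0 \<le> fX x"
    and densY: "distributed M lborel Y (\<lambda>y. ennreal (fY y))" "\<And>y. 0 \<le> fY y"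
    and densS: "distributed M lborel (\<lambda>\<omega>. X \<omega> + Y \<omega>) (\<lambda>s. ennreal (fS s))" "\<And>s. 0 \<le> fS s"
    and int: "integrable lborel (\<lambda>z. f z * ln (f z))"
      "integrable lborel (\<lambda>x. fX x * ln (fX x))"
      "integrable lborel (\<lambda>y. fY y * ln (fY y))"
      "integrable lborel (\<lambda>s. fS s * ln (fS s))"
    and \<theta>: "0 < \<theta>" "\<theta> < 1"
  shows "\<theta> * (diff_entropy f - diff_entropy fY) + (1 - \<theta>) * (diff_entropy f - diff_entropy fX)
      + real CARD('d) * mixing_entropy \<theta> \<le> diff_entropy fS"
proof -
  interpret prob_space M by fact
  have pos: "0 < f q" and pos0: "0 \<le> f q" for q
    using lsm unfolding log_supermodular_def by (blast, blast intro: less_imp_le)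
  have fm [measurable]: "f \<in> borel_measurable borel" "fX \<in> borel_measurable borel" "fY \<in> borel_measurable borel" "fS \<in> borel_measurable borel"
    using distributed_real_measurable[OF pos0 joint] distributed_real_measurable[OF densX(2,1)]
      distributed_real_measurable[OF densY(2,1)] distributed_real_measurable[OF densS(2,1)] by simp_all
  have rv [measurable]: "X \<in> measurable M borel" "Y \<in> measurable M borel"
    using distributed_measurable[OF densX(1)] distributed_measurable[OF densY(1)] by simp_all
  have XY [measurable]: "(\<lambda>\<omega>. (X \<omega>, Y \<omega>)) \<in> measurable M borel"
    using distributed_measurable[OF joint] by simp
  have mass: "(\<integral>\<^sup>+x. ennreal (g x) \<partial>lborel) = 1"
    if "distributed M lborel V (\<lambda>x. ennreal (g x))" for V :: "'w \<Rightarrow> 'b::euclidean_space" and g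
    using distributed_nn_integral[OF that, of "\<lambda>_. 1"] by (simp add: emeasure_space_1)
  obtain P Q Z :: "(real^'d) \<times> (real^'d) \<Rightarrow> real" where
    m [measurable]: "P \<in> borel_measurable borel" "Q \<in> borel_measurable borel" "Z \<in> borel_measurable borel"
    and PQ: "\<And>q. 0 < P q" "\<And>q. 0 < Q q" "\<And>q. f q = P q * Q q"
    and IP: "\<And>r. r \<in> borel_measurable borel \<Longrightarrow> (\<integral>\<^sup>+q. ennreal (P q) * r (snd q) \<partial>lborel) \<le> (\<integral>\<^sup>+y. r y \<partial>lborel)"
    and IQ: "\<And>r. r \<in> borel_measurable borel \<Longrightarrow> (\<integral>\<^sup>+q. ennreal (Q q) * r (fst q) \<partial>lborel) \<le> (\<integral>\<^sup>+x. r x \<partial>lborel)"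
    and IW: "\<And>r. r \<in> borel_measurable borel \<Longrightarrow>
      (\<integral>\<^sup>+q. ennreal (P q powr (1 - \<theta>) * Q q powr \<theta> * exp (real CARD('d) * mixing_entropy \<theta> + sqrt (\<theta> * (1 - \<theta>)) * Z q))
        * r (fst q + snd q) \<partial>lborel) \<le> (\<integral>\<^sup>+s. r s \<partial>lborel)"
    and IZ: "integrable lborel (\<lambda>q. f q * Z q)" "(\<integral>q. f q * Z q \<partial>lborel) = 0"
    using vector_factorization[OF \<theta> fm(1) lsm mass[OF joint]] by blast
  have fsm [measurable]: "(fst :: (real^'d) \<times> (real^'d) \<Rightarrow> real^'d) \<in> borel_measurable borel" "(snd :: (real^'d) \<times> (real^'d) \<Rightarrow> real^'d) \<in> borel_measurable borel"
    unfolding borel_prod[symmetric] by measurable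
  define \<Xi> where "\<Xi> \<omega> = (X \<omega>, Y \<omega>)" for \<omega>
  have \<Xi>: "distributed M lborel \<Xi> (\<lambda>z. ennreal (f z))" using joint by (simp add: \<Xi>_def[abs_def])
  have [measurable]: "\<Xi> \<in> measurable M borel" using XY by (simp add: \<Xi>_def[abs_def])
  have fsXi: "fst (\<Xi> \<omega>) = X \<omega>" "snd (\<Xi> \<omega>) = Y \<omega>" for \<omega> by (simp_all add: \<Xi>_def)
  define E where "E q = exp (real CARD('d) * mixing_entropy \<theta> + sqrt (\<theta> * (1 - \<theta>)) * Z q)" for q
  have [measurable]: "E \<in> borel_measurable borel" unfolding E_def by measurable
  have Epos: "0 < E q" for q by (simp add: E_def)
  \<comment> \<open>Multiplied by \<open>f\<close>, the three variables become the integrands of the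
    three bounds of the factorization, tested against \<open>fS\<close>, \<open>fY\<close> and
    \<open>fX\<close>, each of total mass one.\<close>
  define T1 where "T1 q = P q powr (- \<theta>) * Q q powr (- (1 - \<theta>)) * E q * fS (fst q + snd q)" for q
  define T2 where "T2 q = fY (snd q) / Q q" for q
  define T3 where "T3 q = fX (fst q) / P q" for q
  have Tm [measurable]: "T1 \<in> borel_measurable borel" "T2 \<in> borel_measurable borel" "T3 \<in> borel_measurable borel"
    unfolding T1_def T2_def T3_def by measurable
  have T0: "0 \<le> T1 q" "0 \<le> T2 q" "0 \<le> T3 q" for q
    using PQ Epos[of q] densX(2) densY(2) densS(2) by (simp_all add: T1_def T2_def T3_def less_imp_le)
  have nnT: "(\<integral>\<^sup>+\<omega>. ennreal (T (\<Xi> \<omega>)) \<partial>M) = (\<integral>\<^sup>+q. ennreal (f q * T q) \<partial>lborel)"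
    if "T \<in> borel_measurable borel" "\<And>q. 0 \<le> T q" for T
  proof -
    have "(\<integral>\<^sup>+\<omega>. ennreal (T (\<Xi> \<omega>)) \<partial>M) = (\<integral>\<^sup>+q. ennreal (f q) * ennreal (T q) \<partial>lborel)"
      by (rule distributed_nn_integral[OF \<Xi>, symmetric]) (use that in simp)
    then show ?thesis using that pos0 by (simp add: ennreal_mult)
  qed
  have "(\<integral>\<^sup>+q. ennreal (f q * T1 q) \<partial>lborel) = (\<integral>\<^sup>+q. ennreal (P q powr (1 - \<theta>) * Q q powr \<theta> * E q) * ennreal (fS (fst q + snd q)) \<partial>lborel)"
  proof (rule nn_integral_cong)
    fix q
    have "P q * P q powr (- \<theta>) = P q powr (1 - \<theta>)" "Q q * Q q powr (- (1 - \<theta>)) = Q q powr \<theta>"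
      using PQ(1,2)[of q] by (simp_all add: powr_mult_base)
    from this[symmetric] have "f q * T1 q = P q powr (1 - \<theta>) * Q q powr \<theta> * E q * fS (fst q + snd q)"
      unfolding T1_def PQ(3) by (simp only: ac_simps)
    then show "ennreal (f q * T1 q) = ennreal (P q powr (1 - \<theta>) * Q q powr \<theta> * E q) * ennreal (fS (fst q + snd q))"
      using Epos[of q] densS(2) by (simp add: ennreal_mult less_imp_le)
  qed
  also have "\<dots> \<le> (\<integral>\<^sup>+s. ennreal (fS s) \<partial>lborel)"
    unfolding E_def by (rule IW) measurable
  finally have N1: "(\<integral>\<^sup>+\<omega>. ennreal (T1 (\<Xi> \<omega>)) \<partial>M) \<le> 1"
    by (simp add: nnT[OF Tm(1) T0(1)] mass[OF densS(1)])
  have "(\<integral>\<^sup>+q. ennreal (f q * T2 q) \<partial>lborel) = (\<integral>\<^sup>+q. ennreal (P q) * ennreal (fY (snd q)) \<partial>lborel)"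
    using PQ(1) densY(2) less_imp_neq[OF PQ(2)]
    by (intro nn_integral_cong) (simp add: T2_def PQ(3) ennreal_mult[symmetric] less_imp_le)
  also have "\<dots> \<le> (\<integral>\<^sup>+s. ennreal (fY s) \<partial>lborel)" by (rule IP) measurable
  finally have N2: "(\<integral>\<^sup>+\<omega>. ennreal (T2 (\<Xi> \<omega>)) \<partial>M) \<le> 1"
    by (simp add: nnT[OF Tm(2) T0(2)] mass[OF densY(1)])
  have "(\<integral>\<^sup>+q. ennreal (f q * T3 q) \<partial>lborel) = (\<integral>\<^sup>+q. ennreal (Q q) * ennreal (fX (fst q)) \<partial>lborel)"
    using PQ(2) densX(2) less_imp_neq[OF PQ(1)]
    by (intro nn_integral_cong) (simp add: T3_def PQ(3) ennreal_mult[symmetric] less_imp_le)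
  also have "\<dots> \<le> (\<integral>\<^sup>+s. ennreal (fX s) \<partial>lborel)" by (rule IQ) measurable
  finally have N3: "(\<integral>\<^sup>+\<omega>. ennreal (T3 (\<Xi> \<omega>)) \<partial>M) \<le> 1"
    by (simp add: nnT[OF Tm(3) T0(3)] mass[OF densX(1)])
  have J1: "integrable M (\<lambda>\<omega>. T1 (\<Xi> \<omega>))" "(\<integral>\<omega>. T1 (\<Xi> \<omega>) \<partial>M) \<le> 1"
    by (rule integrable_integral_le_1[OF _ T0(1) N1]; measurable)+
  have J2: "integrable M (\<lambda>\<omega>. T2 (\<Xi> \<omega>))" "(\<integral>\<omega>. T2 (\<Xi> \<omega>) \<partial>M) \<le> 1"
    by (rule integrable_integral_le_1[OF _ T0(2) N2]; measurable)+
  have J3: "integrable M (\<lambda>\<omega>. T3 (\<Xi> \<omega>))" "(\<integral>\<omega>. T3 (\<Xi> \<omega>) \<partial>M) \<le> 1"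
    by (rule integrable_integral_le_1[OF _ T0(3) N3]; measurable)+
  have K: "integrable M (\<lambda>\<omega>. ln (g (V \<omega>)))" "(\<integral>\<omega>. ln (g (V \<omega>)) \<partial>M) = - diff_entropy g"
    if D: "distributed M lborel V (\<lambda>x. ennreal (g x))" and g: "\<And>x. 0 \<le> g x" and i: "integrable lborel (\<lambda>x. g x * ln (g x))"
    for V :: "'w \<Rightarrow> 'b::euclidean_space" and g
  proof -
    have gm: "(\<lambda>x. ln (g x)) \<in> borel_measurable lborel"
      using distributed_real_measurable[OF g D] by measurable
    show "integrable M (\<lambda>\<omega>. ln (g (V \<omega>)))" using distributed_integrable[OF D gm g] i by simp
    show "(\<integral>\<omega>. ln (g (V \<omega>)) \<partial>M) = - diff_entropy g"
      using distributed_integral[OF D gm g] by (simp add: diff_entropy_def)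
  qed
  note KX = K[OF densX int(2)] and KY = K[OF densY int(3)] and KS = K[OF densS int(4)] and KF = K[OF \<Xi> pos0 int(1)]
  have KZ: "integrable M (\<lambda>\<omega>. Z (\<Xi> \<omega>))" "(\<integral>\<omega>. Z (\<Xi> \<omega>) \<partial>M) = 0"
    using distributed_integrable[OF \<Xi> _ pos0, of Z] distributed_integral[OF \<Xi> _ pos0, of Z] IZ by simp_all
  let ?c = "real CARD('d) * mixing_entropy \<theta>" and ?k = "sqrt (\<theta> * (1 - \<theta>))"
  \<comment> \<open>The combination of logarithms is written with \<open>P\<close> and
    \<open>Q\<close> already eliminated, so that it is visibly integrable; the identity with ln T1,
    ln T2 and ln T3 is needed only pointwise.\<close>
  let ?L = "\<lambda>\<omega>. ln (fS (X \<omega> + Y \<omega>)) + \<theta> * (ln (fY (Y \<omega>)) - ln (f (\<Xi> \<omega>)))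
    + (1 - \<theta>) * (ln (fX (X \<omega>)) - ln (f (\<Xi> \<omega>))) + (?c + ?k * Z (\<Xi> \<omega>))"
  let ?U = "\<lambda>\<omega>. (T1 (\<Xi> \<omega>) - 1) + \<theta> * (T2 (\<Xi> \<omega>) - 1) + (1 - \<theta>) * (T3 (\<Xi> \<omega>) - 1)"
  have "(\<integral>\<omega>. ?L \<omega> \<partial>M) \<le> (\<integral>\<omega>. ?U \<omega> \<partial>M)"
  proof (rule integral_mono_AE)
    show "integrable M ?L" using KX KY KS KF KZ by (intro Bochner_Integration.integrable_add integrable_mult_right Bochner_Integration.integrable_diff) simp_all
    show "integrable M ?U" using J1 J2 J3 by simp
    show "AE \<omega> in M. ?L \<omega> \<le> ?U \<omega>"
      using distributed_AE_pos[OF densX] distributed_AE_pos[OF densY] distributed_AE_pos[OF densS]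
    proof eventually_elim
      case (elim \<omega>)
      define q where "q = \<Xi> \<omega>"
      have p: "0 < P q" "0 < Q q" "0 < E q" "0 < fX (X \<omega>)" "0 < fY (Y \<omega>)" "0 < fS (X \<omega> + Y \<omega>)"
        using PQ(1,2) Epos elim by auto
      have t: "T1 q = P q powr (- \<theta>) * Q q powr (- (1 - \<theta>)) * E q * fS (X \<omega> + Y \<omega>)"
        "T2 q = fY (Y \<omega>) / Q q" "T3 q = fX (X \<omega>) / P q"
        by (simp_all add: T1_def T2_def T3_def q_def fsXi)
      have tp: "0 < T1 q" "0 < T2 q" "0 < T3 q" using p by (simp_all add: t)
      have l1: "ln (T1 q) = - \<theta> * ln (P q) - (1 - \<theta>) * ln (Q q) + (?c + ?k * Z q) + ln (fS (X \<omega> + Y \<omega>))"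
        unfolding t using p by (simp add: ln_mult ln_powr) (simp add: E_def algebra_simps)
      have l2: "ln (T2 q) = ln (fY (Y \<omega>)) - ln (Q q)" "ln (T3 q) = ln (fX (X \<omega>)) - ln (P q)" "ln (f q) = ln (P q) + ln (Q q)"
        unfolding t PQ(3) using p by (simp_all add: ln_div ln_mult)
      have "?L \<omega> = ln (T1 q) + \<theta> * ln (T2 q) + (1 - \<theta>) * ln (T3 q)"
        unfolding q_def[symmetric] l1 l2 by (simp add: algebra_simps)
      also have "\<dots> \<le> (T1 q - 1) + \<theta> * (T2 q - 1) + (1 - \<theta>) * (T3 q - 1)"
        using \<theta> tp by (intro add_mono mult_left_mono ln_le_minus_one) auto
      finally show ?case by (simp add: q_def)
    qed
  qed
  also have "(\<integral>\<omega>. ?U \<omega> \<partial>M) = ((\<integral>\<omega>. T1 (\<Xi> \<omega>) \<partial>M) - 1) + \<theta> * ((\<integral>\<omega>. T2 (\<Xi> \<omega>) \<partial>M) - 1) + (1 - \<theta>) * ((\<integral>\<omega>. T3 (\<Xi> \<omega>) \<partial>M) - 1)"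
    using J1 J2 J3 by (simp add: prob_space)
  also have "\<dots> \<le> 0"
    using J1 J2 J3 \<theta> by (intro add_nonpos_nonpos mult_nonneg_nonpos) auto
  also have "(\<integral>\<omega>. ?L \<omega> \<partial>M) = - diff_entropy fS + \<theta> * (- diff_entropy fY - (- diff_entropy f))
      + (1 - \<theta>) * (- diff_entropy fX - (- diff_entropy f)) + (?c + ?k * 0)"
    unfolding KX(2)[symmetric] KY(2)[symmetric] KS(2)[symmetric] KF(2)[symmetric] KZ(2)[symmetric]
    using KX(1) KY(1) KS(1) KF(1) KZ(1) by (simp add: prob_space)
  finally show ?thesis by (simp add: algebra_simps)
qed

theorem theorem1:
  fixes M :: "'w measure"
    and X Y :: "'w \<Rightarrow> real^'d"
    and f :: "(real^'d) \<times> (real^'d) \<Rightarrow> real"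
    and fX fY fS :: "real^'d \<Rightarrow> real"
  assumes "prob_space M"
    and joint: "distributed M lborel (\<lambda>\<omega>. (X \<omega>, Y \<omega>)) (\<lambda>z. ennreal (f z))"
    and lsm: "log_supermodular f"
    and densX: "distributed M lborel X (\<lambda>x. ennreal (fX x))" "\<And>x. 0 \<le> fX x"
    and densY: "distributed M lborel Y (\<lambda>y. ennreal (fY y))" "\<And>y. 0 \<le> fY y"
    and densS: "distributed M lborel (\<lambda>\<omega>. X \<omega> + Y \<omega>) (\<lambda>s. ennreal (fS s))" "\<And>s. 0 \<le> fS s"
    and mom: "integrable M (\<lambda>\<omega>. (norm (X \<omega>))\<^sup>2)" "integrable M (\<lambda>\<omega>. (norm (Y \<omega>))\<^sup>2)"
    and int: "integrable lborel (\<lambda>z. f z * ln (f z))"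
      "integrable lborel (\<lambda>x. fX x * ln (fX x))"
      "integrable lborel (\<lambda>y. fY y * ln (fY y))"
      "integrable lborel (\<lambda>s. fS s * ln (fS s))"
  shows "exp (2 / real CARD('d) * diff_entropy fS)
         \<ge> exp (2 / real CARD('d) * (diff_entropy f - diff_entropy fY))
          + exp (2 / real CARD('d) * (diff_entropy f - diff_entropy fX))"
  by (rule exp_add_le_of_mixing[OF linearized_entropy_inequality[OF assms(1-9) int]]) simp_all

end
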